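(* Let $\mathcal{A}$ be a commutative $C^*$-algebra contained in $\mathcal{B}(H)$, where $H$ is a separable Hilbert space, and let $\widehat{\mathcal{A}}$ be its spectrum. Then the following are equivalent: (i) $\mathcal{A}$ is projective in the category of left Banach $\mathcal{A}$-modules; (ii) the spectrum $\widehat{\mathcal{A}}$ of $\mathcal{A}$ is paracompact; (iii) $\mathcal{A}$ contains a strictly positive element; (iv) the spectrum $\widehat{\mathcal{A}}$ is $\sigma$-compact; (v) $\widehat{\mathcal{A}}$ is a Lindelöf space; (vi) $\mathcal{A}$ has a sequential approximate identity bounded by one; (vii) $\mathcal{H}^2(\mathcal{A},X)=\{0\}$ for any right annihilator Banach $\mathcal{A}$-bimodule $X$.
   Context: $\mathcal{B}(H)$ is the $C^*$-algebra of all bounded linear operators on $H$. The spectrum $\widehat{\mathcal{A}}$ is the space of characters of $\mathcal{A}$ with the relative weak-* topology (a locally compact Hausdorff space). $\mathcal{A}$ need not be unital. A space is Lindelöf if each open cover has a countable subcover. A Hausdorff space is paracompact if every open cover has an open locally finite refinement that is also a cover. A left Banach $\mathcal{A}$-module $P$ is projective if every epimorphism of left Banach $\mathcal{A}$-modules $\varphi:Y\to P$ that has a right inverse as a morphism of Banach spaces has a right inverse that is a module morphism. Equivalently for $P=\mathcal{A}$: there is a morphism of left Banach $\mathcal{A}$-modules $\rho:\mathcal{A}\to\mathcal{A}_+\widehat{\otimes}\mathcal{A}$ with $\pi\circ\rho=\mathrm{id}$, where $\mathcal{A}_+$ is $\mathcal{A}$ with an identity adjoined, $\widehat{\otimes}$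 is the projective tensor product, and $\pi(a\otimes b)=ab$. A strictly positive element of a $C^*$-algebra is a positive element $h$ with $\varphi(h)>0$ for every state $\varphi$. $\mathcal{H}^2(\mathcal{A},X)$ is the second continuous Hochschild cohomology group of $\mathcal{A}$ with coefficients in $X$, i.e. computed from the complex of bounded $n$-linear maps $\mathcal{A}^n\to X$ with the usual Hochschild coboundary. $X$ is right annihilator if $x\cdot a=0$ for all $x\in X$, $a\in\mathcal{A}$. *)

theory Defs
  imports "HOL-Analysis.Analysis" "HOL-Library.Complex_Order"
begin

text \<open>
  The order used on complex numbers is that of \<open>HOL-Library.Complex_Order\<close>: \<open>0 \<le> z\<close> means that
  \<open>z\<close> is real and nonnegative, \<open>0 < z\<close> that it is real and strictly positive.
\<close>

section \<open>Hilbert spaces and operators\<close>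

text \<open>
  Complex Hilbert spaces, with inner product linear in the first argument. Completeness comes
  from \<open>banach\<close>; the underlying real normed structure is the one induced by the complex one.
\<close>

class complex_hilbert_space = banach +
  fixes scaleC :: "complex \<Rightarrow> 'a \<Rightarrow> 'a" (infixr "*\<^sub>C" 75)
    and cinner :: "'a \<Rightarrow> 'a \<Rightarrow> complex"
  assumes scaleC_add_right: "c *\<^sub>C (x + y) = c *\<^sub>C x + c *\<^sub>C y"
    and scaleC_add_left: "(c + d) *\<^sub>C x = c *\<^sub>C x + d *\<^sub>C x"
    and scaleC_scaleC: "c *\<^sub>C (d *\<^sub>C x) = (c * d) *\<^sub>C x"
    and scaleC_of_real: "complex_of_real r *\<^sub>C x = r *\<^sub>R x"
    and cinner_commute: "cinner x y = cnj (cinner y x)"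
    and cinner_add_left: "cinner (x + y) z = cinner x z + cinner y z"
    and cinner_scaleC_left: "cinner (c *\<^sub>C x) y = c * cinner x y"
    and cinner_ge_zero: "0 \<le> cinner x x"
    and norm_eq_sqrt_cinner: "norm x = sqrt (Re (cinner x x))"

lemma norm_scaleC: "norm (c *\<^sub>C x) = cmod c * norm (x::'h::complex_hilbert_space)"
proof -
  have "cinner (c *\<^sub>C x) (c *\<^sub>C x) = c * cnj (c * cinner x x)"
    by (metis cinner_commute cinner_scaleC_left)
  also have "\<dots> = of_real ((cmod c)\<^sup>2) * cinner x x"
    using cinner_commute[of x x] by (simp add: complex_norm_square mult.assoc del: of_real_power)
  finally have "Re (cinner (c *\<^sub>C x) (c *\<^sub>C x)) = (cmod c)\<^sup>2 * Re (cinner x x)"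
    by simp
  then show ?thesis
    by (simp add: norm_eq_sqrt_cinner real_sqrt_mult)
qed

lemma bounded_linear_scaleC: "bounded_linear (\<lambda>x::'h::complex_hilbert_space. c *\<^sub>C x)"
proof (rule bounded_linear_intro[where K = "cmod c"])
  fix r and x y :: 'h
  show "c *\<^sub>C (x + y) = c *\<^sub>C x + c *\<^sub>C y"
    by (rule scaleC_add_right)
  have "c *\<^sub>C (complex_of_real r *\<^sub>C x) = complex_of_real r *\<^sub>C (c *\<^sub>C x)"
    by (simp only: scaleC_scaleC mult.commute)
  then show "c *\<^sub>C (r *\<^sub>R x) = r *\<^sub>R (c *\<^sub>C x)"
    by (simp only: scaleC_of_real)
  show "norm (c *\<^sub>C x) \<le> norm x * cmod c"
    by (simp add: norm_scaleC mult.commute)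
qed

type_synonym 'h oper = "'h \<Rightarrow>\<^sub>L 'h"

text \<open>
  The type of bounded linear maps provided by the library consists of real-linear maps;
  \<open>B(H)\<close> is its subset of complex-linear ones.
\<close>

definition bounded_operators :: "'h::complex_hilbert_space oper set" where
  "bounded_operators =
     {T. \<forall>c x. blinfun_apply T (c *\<^sub>C x) = c *\<^sub>C blinfun_apply T x}"

definition op_scale :: "complex \<Rightarrow> 'h::complex_hilbert_space oper \<Rightarrow> 'h oper" where
  "op_scale c T = Blinfun (\<lambda>x. c *\<^sub>C x) o\<^sub>L T"

lemma op_scale_apply: "blinfun_apply (op_scale c T) x = c *\<^sub>C blinfun_apply T x"
  by (simp add: op_scale_def bounded_linear_Blinfun_apply[OF bounded_linear_scaleC])

definition adjoint_op :: "'h::complex_hilbert_space oper \<Rightarrow> 'h oper" where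
  "adjoint_op T =
     (THE S. \<forall>x y. cinner (blinfun_apply T x) y = cinner x (blinfun_apply S y))"

definition cstar_subalgebra :: "'h::complex_hilbert_space oper set \<Rightarrow> bool" where
  "cstar_subalgebra A \<longleftrightarrow>
     A \<subseteq> bounded_operators \<and> 0 \<in> A \<and>
     (\<forall>S\<in>A. \<forall>T\<in>A. S + T \<in> A) \<and>
     (\<forall>c. \<forall>T\<in>A. op_scale c T \<in> A) \<and>
     (\<forall>S\<in>A. \<forall>T\<in>A. S o\<^sub>L T \<in> A) \<and>
     (\<forall>T\<in>A. adjoint_op T \<in> A) \<and>
     closed A"

definition commutative_algebra :: "'h::complex_hilbert_space oper set \<Rightarrow> bool" where
  "commutative_algebra A \<longleftrightarrow> (\<forall>S\<in>A. \<forall>T\<in>A. S o\<^sub>L T = T o\<^sub>L S)"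

section \<open>Spectrum\<close>

definition linear_functional ::
    "'h::complex_hilbert_space oper set \<Rightarrow> ('h oper \<Rightarrow> complex) \<Rightarrow> bool" where
  "linear_functional A \<phi> \<longleftrightarrow>
     (\<forall>S\<in>A. \<forall>T\<in>A. \<phi> (S + T) = \<phi> S + \<phi> T) \<and>
     (\<forall>c. \<forall>T\<in>A. \<phi> (op_scale c T) = c * \<phi> T)"

text \<open>
  Functionals on \<open>A\<close> are represented by functions that are \<open>undefined\<close> outside \<open>A\<close>, so that
  distinct functions are distinct characters.
\<close>

definition characters ::
    "'h::complex_hilbert_space oper set \<Rightarrow> ('h oper \<Rightarrow> complex) set" where
  "characters A =
     {\<theta> \<in> extensional A. linear_functional A \<theta> \<and>
        (\<forall>S\<in>A. \<forall>T\<in>A. \<theta> (S o\<^sub>L T) = \<theta> S * \<theta> T) \<and> (\<exists>T\<in>A. \<theta> T \<noteq> 0)}"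

text \<open>The weak-* topology is the topology of pointwise convergence on \<open>A\<close>.\<close>

definition spectrum ::
    "'h::complex_hilbert_space oper set \<Rightarrow> ('h oper \<Rightarrow> complex) topology" where
  "spectrum A = subtopology (product_topology (\<lambda>_. euclidean) A) (characters A)"

definition paracompact_space :: "'a topology \<Rightarrow> bool" where
  "paracompact_space X \<longleftrightarrow>
     Hausdorff_space X \<and>
     (\<forall>\<U>. (\<forall>U\<in>\<U>. openin X U) \<and> \<Union>\<U> = topspace X \<longrightarrow>
        (\<exists>\<V>. (\<forall>V\<in>\<V>. openin X V) \<and> \<Union>\<V> = topspace X \<and>
             (\<forall>V\<in>\<V>. \<exists>U\<in>\<U>. V \<subseteq> U) \<and> locally_finite_in X \<V>))"

definition sigma_compact_space :: "'a topology \<Rightarrow> bool" where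
  "sigma_compact_space X \<longleftrightarrow>
     (\<exists>K :: nat \<Rightarrow> 'a set. (\<forall>n. compactin X (K n)) \<and> (\<Union>n. K n) = topspace X)"

section \<open>Positivity and approximate identities\<close>

definition positive_element :: "'h::complex_hilbert_space oper set \<Rightarrow> 'h oper \<Rightarrow> bool" where
  "positive_element A h \<longleftrightarrow> (\<exists>b\<in>A. h = adjoint_op b o\<^sub>L b)"

definition state_on ::
    "'h::complex_hilbert_space oper set \<Rightarrow> ('h oper \<Rightarrow> complex) \<Rightarrow> bool" where
  "state_on A \<phi> \<longleftrightarrow>
     linear_functional A \<phi> \<and>
     (\<forall>h. positive_element A h \<longrightarrow> 0 \<le> \<phi> h) \<and>
     bdd_above ((\<lambda>a. cmod (\<phi> a)) ` {a\<in>A. norm a \<le> 1}) \<and>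
     (SUP a\<in>{a\<in>A. norm a \<le> 1}. cmod (\<phi> a)) = 1"

definition strictly_positive :: "'h::complex_hilbert_space oper set \<Rightarrow> 'h oper \<Rightarrow> bool" where
  "strictly_positive A h \<longleftrightarrow>
     positive_element A h \<and> (\<forall>\<phi>. state_on A \<phi> \<longrightarrow> 0 < \<phi> h)"

definition sequential_approximate_identity ::
    "'h::complex_hilbert_space oper set \<Rightarrow> (nat \<Rightarrow> 'h oper) \<Rightarrow> bool" where
  "sequential_approximate_identity A e \<longleftrightarrow>
     (\<forall>n. e n \<in> A) \<and>
     (\<forall>a\<in>A. (\<lambda>n. e n o\<^sub>L a) \<longlonglongrightarrow> a \<and> (\<lambda>n. a o\<^sub>L e n) \<longlonglongrightarrow> a)"

section \<open>Banach spaces and modules with explicit carriers\<close>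

text \<open>
  Banach modules are quantified over inside formulas, hence they are records whose carrier is a
  subset of a type, rather than types of a class.
\<close>

record 'x normed_struct =
  car :: "'x set"
  zer :: "'x"
  add :: "'x \<Rightarrow> 'x \<Rightarrow> 'x"
  scl :: "complex \<Rightarrow> 'x \<Rightarrow> 'x"
  nrm :: "'x \<Rightarrow> real"

record ('a, 'x) left_struct = "'x normed_struct" +
  lact :: "'a \<Rightarrow> 'x \<Rightarrow> 'x"

record ('a, 'x) bi_struct = "('a, 'x) left_struct" +
  ract :: "'x \<Rightarrow> 'a \<Rightarrow> 'x"

definition sub :: "('x, 'm) normed_struct_scheme \<Rightarrow> 'x \<Rightarrow> 'x \<Rightarrow> 'x" where
  "sub E x y = add E x (scl E (- 1) y)"

definition complex_vector_space :: "('x, 'm) normed_struct_scheme \<Rightarrow> bool" where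
  "complex_vector_space E \<longleftrightarrow>
     zer E \<in> car E \<and>
     (\<forall>x\<in>car E. \<forall>y\<in>car E. add E x y \<in> car E) \<and>
     (\<forall>c. \<forall>x\<in>car E. scl E c x \<in> car E) \<and>
     (\<forall>x\<in>car E. \<forall>y\<in>car E. \<forall>z\<in>car E. add E (add E x y) z = add E x (add E y z)) \<and>
     (\<forall>x\<in>car E. \<forall>y\<in>car E. add E x y = add E y x) \<and>
     (\<forall>x\<in>car E. add E x (zer E) = x) \<and>
     (\<forall>x\<in>car E. sub E x x = zer E) \<and>
     (\<forall>c. \<forall>x\<in>car E. \<forall>y\<in>car E. scl E c (add E x y) = add E (scl E c x) (scl E c y)) \<and>
     (\<forall>c d. \<forall>x\<in>car E. scl E (c + d) x = add E (scl E c x) (scl E d x)) \<and>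
     (\<forall>c d. \<forall>x\<in>car E. scl E c (scl E d x) = scl E (c * d) x) \<and>
     (\<forall>x\<in>car E. scl E 1 x = x)"

definition complex_banach_space :: "('x, 'm) normed_struct_scheme \<Rightarrow> bool" where
  "complex_banach_space E \<longleftrightarrow>
     complex_vector_space E \<and>
     (\<forall>x\<in>car E. 0 \<le> nrm E x) \<and>
     (\<forall>x\<in>car E. nrm E x = 0 \<longleftrightarrow> x = zer E) \<and>
     (\<forall>x\<in>car E. \<forall>y\<in>car E. nrm E (add E x y) \<le> nrm E x + nrm E y) \<and>
     (\<forall>c. \<forall>x\<in>car E. nrm E (scl E c x) = cmod c * nrm E x) \<and>
     (\<forall>u :: nat \<Rightarrow> 'x. (\<forall>n. u n \<in> car E) \<and>
        (\<forall>e>0. \<exists>N. \<forall>m\<ge>N. \<forall>n\<ge>N. nrm E (sub E (u m) (u n)) < e) \<longrightarrow>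
        (\<exists>l\<in>car E. (\<lambda>n. nrm E (sub E (u n) l)) \<longlonglongrightarrow> 0))"

definition clinear_on ::
    "('x, 'm) normed_struct_scheme \<Rightarrow> ('y, 'n) normed_struct_scheme \<Rightarrow> ('x \<Rightarrow> 'y) \<Rightarrow> bool" where
  "clinear_on E F f \<longleftrightarrow>
     (\<forall>x\<in>car E. f x \<in> car F) \<and>
     (\<forall>x\<in>car E. \<forall>y\<in>car E. f (add E x y) = add F (f x) (f y)) \<and>
     (\<forall>c. \<forall>x\<in>car E. f (scl E c x) = scl F c (f x))"

definition bounded_clinear_on ::
    "('x, 'm) normed_struct_scheme \<Rightarrow> ('y, 'n) normed_struct_scheme \<Rightarrow> ('x \<Rightarrow> 'y) \<Rightarrow> bool" where
  "bounded_clinear_on E F f \<longleftrightarrow>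
     clinear_on E F f \<and> (\<exists>K. \<forall>x\<in>car E. nrm F (f x) \<le> K * nrm E x)"

text \<open>The algebra \<open>A\<close> as a left module over itself.\<close>

definition regular_module ::
    "'h::complex_hilbert_space oper set \<Rightarrow> ('h oper, 'h oper) left_struct" where
  "regular_module A =
     \<lparr>car = A, zer = 0, add = (+), scl = op_scale, nrm = norm, lact = (o\<^sub>L)\<rparr>"

definition left_banach_module ::
    "'h::complex_hilbert_space oper set \<Rightarrow> ('h oper, 'x, 'm) left_struct_scheme \<Rightarrow> bool" where
  "left_banach_module A Y \<longleftrightarrow>
     complex_banach_space Y \<and>
     (\<forall>a\<in>A. clinear_on Y Y (\<lambda>x. lact Y a x)) \<and>
     (\<forall>x\<in>car Y. clinear_on (regular_module A) Y (\<lambda>a. lact Y a x)) \<and>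
     (\<forall>a\<in>A. \<forall>b\<in>A. \<forall>x\<in>car Y. lact Y (a o\<^sub>L b) x = lact Y a (lact Y b x)) \<and>
     (\<exists>K. \<forall>a\<in>A. \<forall>x\<in>car Y. nrm Y (lact Y a x) \<le> K * norm a * nrm Y x)"

definition banach_bimodule ::
    "'h::complex_hilbert_space oper set \<Rightarrow> ('h oper, 'x, 'm) bi_struct_scheme \<Rightarrow> bool" where
  "banach_bimodule A X \<longleftrightarrow>
     left_banach_module A X \<and>
     (\<forall>a\<in>A. clinear_on X X (\<lambda>x. ract X x a)) \<and>
     (\<forall>x\<in>car X. clinear_on (regular_module A) X (\<lambda>a. ract X x a)) \<and>
     (\<forall>a\<in>A. \<forall>b\<in>A. \<forall>x\<in>car X. ract X x (a o\<^sub>L b) = ract X (ract X x a) b) \<and>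
     (\<forall>a\<in>A. \<forall>b\<in>A. \<forall>x\<in>car X. lact X a (ract X x b) = ract X (lact X a x) b) \<and>
     (\<exists>K. \<forall>a\<in>A. \<forall>x\<in>car X. nrm X (ract X x a) \<le> K * nrm X x * norm a)"

definition right_annihilator ::
    "'h::complex_hilbert_space oper set \<Rightarrow> ('h oper, 'x, 'm) bi_struct_scheme \<Rightarrow> bool" where
  "right_annihilator A X \<longleftrightarrow> (\<forall>x\<in>car X. \<forall>a\<in>A. ract X x a = zer X)"

definition module_morphism ::
    "'h::complex_hilbert_space oper set \<Rightarrow> ('h oper, 'x, 'm) left_struct_scheme \<Rightarrow>
     ('h oper, 'y, 'n) left_struct_scheme \<Rightarrow> ('x \<Rightarrow> 'y) \<Rightarrow> bool" where
  "module_morphism A Y P \<phi> \<longleftrightarrow>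
     bounded_clinear_on Y P \<phi> \<and>
     (\<forall>a\<in>A. \<forall>x\<in>car Y. \<phi> (lact Y a x) = lact P a (\<phi> x))"

text \<open>
  HOL cannot quantify over types inside a formula, so the type in which the carriers of the test
  modules live is a parameter. The epimorphisms concerned are surjective, since they have a
  right inverse.
\<close>

definition projective_module ::
    "'u itself \<Rightarrow> 'h::complex_hilbert_space oper set \<Rightarrow>
     ('h oper, 'p, 'm) left_struct_scheme \<Rightarrow> bool" where
  "projective_module U A P \<longleftrightarrow>
     left_banach_module A P \<and>
     (\<forall>(Y :: ('h oper, 'u) left_struct) \<phi>.
        left_banach_module A Y \<and> module_morphism A Y P \<phi> \<and> \<phi> ` car Y = car P \<and>
        (\<exists>\<sigma>. bounded_clinear_on P Y \<sigma> \<and> (\<forall>x\<in>car P. \<phi> (\<sigma> x) = x)) \<longrightarrow>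
        (\<exists>\<rho>. module_morphism A P Y \<rho> \<and> (\<forall>x\<in>car P. \<phi> (\<rho> x) = x)))"

section \<open>Second continuous Hochschild cohomology\<close>

text \<open>As for functionals, cochains are \<open>undefined\<close> outside \<open>A\<close> and \<open>A \<times> A\<close>, respectively.\<close>

definition cochains1 ::
    "'h::complex_hilbert_space oper set \<Rightarrow> ('h oper, 'x) bi_struct \<Rightarrow> ('h oper \<Rightarrow> 'x) set" where
  "cochains1 A X = {g \<in> extensional A. bounded_clinear_on (regular_module A) X g}"

definition cochains2 ::
    "'h::complex_hilbert_space oper set \<Rightarrow> ('h oper, 'x) bi_struct \<Rightarrow>
     ('h oper \<times> 'h oper \<Rightarrow> 'x) set" where
  "cochains2 A X =
     {f \<in> extensional (A \<times> A).
        (\<forall>a\<in>A. clinear_on (regular_module A) X (\<lambda>b. f (a, b))) \<and>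
        (\<forall>b\<in>A. clinear_on (regular_module A) X (\<lambda>a. f (a, b))) \<and>
        (\<exists>K. \<forall>a\<in>A. \<forall>b\<in>A. nrm X (f (a, b)) \<le> K * norm a * norm b)}"

definition coboundary1 ::
    "'h::complex_hilbert_space oper set \<Rightarrow> ('h oper, 'x) bi_struct \<Rightarrow>
     ('h oper \<Rightarrow> 'x) \<Rightarrow> ('h oper \<times> 'h oper \<Rightarrow> 'x)" where
  "coboundary1 A X g =
     (\<lambda>(a, b)\<in>A \<times> A. add X (sub X (lact X a (g b)) (g (a o\<^sub>L b))) (ract X (g a) b))"

definition coboundary2 ::
    "'h::complex_hilbert_space oper set \<Rightarrow> ('h oper, 'x) bi_struct \<Rightarrow>
     ('h oper \<times> 'h oper \<Rightarrow> 'x) \<Rightarrow> ('h oper \<times> 'h oper \<times> 'h oper \<Rightarrow> 'x)" where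
  "coboundary2 A X f =
     (\<lambda>(a, b, c)\<in>A \<times> A \<times> A.
        sub X (add X (sub X (lact X a (f (b, c))) (f (a o\<^sub>L b, c))) (f (a, b o\<^sub>L c)))
              (ract X (f (a, b)) c))"

definition cocycles2 ::
    "'h::complex_hilbert_space oper set \<Rightarrow> ('h oper, 'x) bi_struct \<Rightarrow>
     ('h oper \<times> 'h oper \<Rightarrow> 'x) set" where
  "cocycles2 A X = {f \<in> cochains2 A X. coboundary2 A X f = (\<lambda>_\<in>A \<times> A \<times> A. zer X)}"

definition coboundaries2 ::
    "'h::complex_hilbert_space oper set \<Rightarrow> ('h oper, 'x) bi_struct \<Rightarrow>
     ('h oper \<times> 'h oper \<Rightarrow> 'x) set" where
  "coboundaries2 A X = coboundary1 A X ` cochains1 A X"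

definition hochschild_H2 ::
    "'h::complex_hilbert_space oper set \<Rightarrow> ('h oper, 'x) bi_struct \<Rightarrow>
     ('h oper \<times> 'h oper \<Rightarrow> 'x) set set" where
  "hochschild_H2 A X =
     cocycles2 A X //
       {(f, f'). f \<in> cocycles2 A X \<and> f' \<in> cocycles2 A X \<and>
                 (\<lambda>p\<in>A \<times> A. sub X (f' p) (f p)) \<in> coboundaries2 A X}"

text \<open>
  The zero element of the quotient is the class \<open>coboundaries2 A X\<close>. The carriers of the
  coefficient bimodules live in the type parameter, as in the definition of projectivity.
\<close>

definition H2_vanishes_right_annihilator ::
    "'u itself \<Rightarrow> 'h::complex_hilbert_space oper set \<Rightarrow> bool" where
  "H2_vanishes_right_annihilator U A \<longleftrightarrow>
     (\<forall>X :: ('h oper, 'u) bi_struct.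
        banach_bimodule A X \<and> right_annihilator A X \<longrightarrow>
        hochschild_H2 A X = {coboundaries2 A X})"

text \<open>
  The theorem takes carriers in \<open>'u + real\<close> for an arbitrary type \<open>'u\<close>. Every Banach module
  carried by a set in \<open>'u\<close> has an isomorphic copy there, so letting \<open>'u\<close> vary covers all Banach
  modules. The summand \<open>real\<close> only excludes universes that are too small to hold the modules
  which test the conditions: for \<open>'u = unit\<close> alone there would be nothing but zero modules.
\<close>

type_synonym 'u universe = "'u + real"

definition all_equivalent :: "bool list \<Rightarrow> bool" where
  "all_equivalent ps \<longleftrightarrow> (\<forall>p\<in>set ps. \<forall>q\<in>set ps. p \<longleftrightarrow> q)"

end

theory Submission
  imports Defs
begin

text \<open>
  All conditions are compared with the sigma-compactness of the spectrum. The Gelfand transform is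
  isometric: a maximal ideal of the bicommutant of \<open>A\<close> is closed and prime, and since the product of the
  positive and negative parts of \<open>x - c\<close> is zero, connectedness yields a scalar \<open>c\<close> with \<open>x - c\<close> in the ideal.

  Sigma-compactness yields \<open>h\<close> with \<open>0 < \<theta> h \<le> 1\<close> for all characters \<open>\<theta>\<close>, and the elements
  \<open>1 - (1 - h)^(2^n)\<close> form an approximate identity. Certain polynomials \<open>f\<^sub>n\<close>, \<open>g\<^sub>n\<close> in \<open>h\<close> satisfy
  \<open>\<Sum> f\<^sub>n g\<^sub>n = 1\<close> pointwise on the spectrum with \<open>\<Sum> |f\<^sub>n|\<close> and \<open>\<Sum> |g\<^sub>n|\<close> bounded. Averaging over signs shows
  that \<open>G a = \<Sum> \<beta> (a f\<^sub>n) g\<^sub>n\<close> converges for each bounded bilinear \<open>\<beta>\<close>; if \<open>\<beta>\<close> is a cocycle, then \<open>- G\<close> has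
  coboundary \<open>\<beta>\<close>. Vanishing cohomology in turn splits every admissible epimorphism onto \<open>A\<close>, because the
  obstruction is a cocycle with values in the kernel.

  Conversely, a separable \<open>H\<close> provides a sequence in \<open>A\<close> whose supports have a dense union, so that a
  locally finite cover by relatively compact open sets is countable. If \<open>A\<close> is projective, restriction to
  the diagonal has a module section on the closure of \<open>A\<^sub>+ \<otimes> A\<close> in the bounded functions of two characters.
  It maps the sequence to functions whose level sets have relatively compact projections, and these
  projections cover the spectrum. The closure has at most the cardinality of the continuum, hence a copy
  in the universe \<open>'u + real\<close>.
\<close>

section \<open>Complex Hilbert spaces and adjoints\<close>

text \<open>The difficulty in splitting cocycles is that the norms of f_n and g_n need not tend to
  zero, so that the series for G has no reason to converge absolutely; what is controlled are sums
  of |f_n| and of |g_n| at single characters. With w_n = 1 - (1 - h)^(2^n), repeated squaring gives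
  w_(n+1) - w_n = w_n - w_n^2, so these differences are polynomials in h, nonnegative on the
  spectrum and with sum at most one. To give each of the two factors one copy of w_n - w_n^2, the
  telescoping function must have differences divisible by the square of this expression. It
  therefore has to be flat at 0 and 1, the fixed points of w \<mapsto> 2w - w^2, and 3w^2 - 2w^3 is
  the cubic with this property and the values 0 and 1 there.

  In the converse direction the section is taken in a space of functions because two features
  matter: large values of an element of the closure of \<open>A\<^sub>+ \<otimes> A\<close> confine
  the second variable to a compact set, and the module action touches the first variable alone.
  Commutativity then transfers nonvanishing from one element of A to another.\<close>

lemma cinner_zero_left [simp]: "cinner 0 (x::'h::complex_hilbert_space) = 0"
  using cinner_add_left[of 0 0 x] by simp

lemma cinner_zero_right [simp]: "cinner (x::'h::complex_hilbert_space) 0 = 0"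
  using cinner_commute[of x 0] by simp

lemma cinner_add_right: "cinner (x::'h::complex_hilbert_space) (y + z) = cinner x y + cinner x z"
  by (metis cinner_commute cinner_add_left complex_cnj_add)

lemma cinner_scaleC_right: "cinner (x::'h::complex_hilbert_space) (c *\<^sub>C y) = cnj c * cinner x y"
  by (metis cinner_commute cinner_scaleC_left complex_cnj_mult)

lemma cinner_scaleR_left: "cinner (r *\<^sub>R x) (y::'h::complex_hilbert_space) = of_real r * cinner x y"
  by (metis cinner_scaleC_left scaleC_of_real)

lemma cinner_scaleR_right: "cinner (x::'h::complex_hilbert_space) (r *\<^sub>R y) = of_real r * cinner x y"
  by (metis cinner_scaleC_right scaleC_of_real complex_cnj_complex_of_real)

lemma cinner_minus_left: "cinner (- x) (y::'h::complex_hilbert_space) = - cinner x y"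
  using cinner_scaleR_left[of "-1" x y] by simp

lemma cinner_minus_right: "cinner (x::'h::complex_hilbert_space) (- y) = - cinner x y"
  using cinner_scaleR_right[of x "-1" y] by simp

lemma cinner_diff_left: "cinner (x - y) (z::'h::complex_hilbert_space) = cinner x z - cinner y z"
  using cinner_add_left[of x "- y" z] by (simp add: cinner_minus_left)

lemma cinner_diff_right: "cinner (x::'h::complex_hilbert_space) (y - z) = cinner x y - cinner x z"
  using cinner_add_right[of x y "- z"] by (simp add: cinner_minus_right)

lemmas cinner_simps = cinner_add_left cinner_add_right cinner_diff_left cinner_diff_right
  cinner_minus_left cinner_minus_right cinner_scaleR_left cinner_scaleR_right
  cinner_scaleC_left cinner_scaleC_right

lemma cinner_self: "cinner x (x::'h::complex_hilbert_space) = of_real ((norm x)\<^sup>2)"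
proof -
  have "0 \<le> Re (cinner x x)" "Im (cinner x x) = 0"
    using cinner_ge_zero[of x] by (auto simp: less_eq_complex_def)
  then show ?thesis
    by (simp add: norm_eq_sqrt_cinner complex_eq_iff del: of_real_power)
qed

lemma scaleC_zero_right [simp]: "c *\<^sub>C (0::'h::complex_hilbert_space) = 0"
  using norm_scaleC[of c "0::'h"] by simp

lemma norm_add_sq:
  "(norm (x + y))\<^sup>2 = (norm x)\<^sup>2 + 2 * Re (cinner x y) + (norm (y::'h::complex_hilbert_space))\<^sup>2"
proof -
  have "complex_of_real ((norm (x + y))\<^sup>2) = cinner x x + cinner x y + cnj (cinner x y) + cinner y y"
    using cinner_commute[of y x] by (simp only: cinner_self[symmetric] cinner_simps) (simp add: add_ac)
  then have "Re (complex_of_real ((norm (x + y))\<^sup>2)) = Re (cinner x x + cinner x y + cnj (cinner x y) + cinner y y)"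
    by simp
  then show ?thesis by (simp add: cinner_self del: of_real_power)
qed

lemma norm_diff_sq:
  "(norm (x - y))\<^sup>2 = (norm x)\<^sup>2 - 2 * Re (cinner x y) + (norm (y::'h::complex_hilbert_space))\<^sup>2"
  using norm_add_sq[of x "- y"] by (simp add: cinner_minus_right)

lemma Re_cinner_le: "Re (cinner x y) \<le> norm x * norm (y::'h::complex_hilbert_space)"
proof -
  have "(norm (x + y))\<^sup>2 \<le> (norm x + norm y)\<^sup>2"
    by (simp add: norm_triangle_ineq power_mono)
  then show ?thesis by (simp add: norm_add_sq power2_sum)
qed

lemma cmod_cinner_le: "cmod (cinner x y) \<le> norm x * norm (y::'h::complex_hilbert_space)"
proof -
  \<comment> \<open>A phase rotates the inner product onto the nonnegative axis, where
    \<open>Re_cinner_le\<close> applies.\<close>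
  obtain u where u: "cmod u = 1" "u * cinner x y = of_real (cmod (cinner x y))"
  proof (cases "cinner x y = 0")
    case True then show ?thesis using that[of 1] by simp
  next
    case False
    then have "cnj (cinner x y) / of_real (cmod (cinner x y)) * cinner x y = of_real (cmod (cinner x y))"
      using complex_norm_square[of "cinner x y"] by (simp add: power2_eq_square field_simps)
    with False show ?thesis using that[of "cnj (cinner x y) / of_real (cmod (cinner x y))"]
      by (simp add: norm_divide)
  qed
  have "cmod (cinner x y) = Re (cinner (u *\<^sub>C x) y)"
    by (simp add: cinner_simps u)
  also have "\<dots> \<le> norm (u *\<^sub>C x) * norm y" by (rule Re_cinner_le)
  finally show ?thesis by (simp add: norm_scaleC u)
qed

lemma cinner_left_eqI:
  assumes "\<And>x. cinner x y = cinner x z"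
  shows "y = (z::'h::complex_hilbert_space)"
proof -
  have "cinner (y - z) (y - z) = 0" by (simp add: cinner_diff_right assms)
  then show ?thesis by (simp add: cinner_self)
qed

text \<open>The first-order condition at a minimum: for small t the linear term dominates. It serves
  the representing vector in \<open>riesz_real\<close> and, later, the vanishing of a state on
  products with h.\<close>

lemma quadratic_nonneg_imp_zero:
  fixes b c :: real
  assumes "\<And>t. 0 \<le> 2 * t * b + t\<^sup>2 * c"
  shows "b = 0"
proof (rule ccontr)
  assume b: "b \<noteq> 0"
  \<comment> \<open>The linear term becomes -2 b^2 / (1 + |c|), whereas c \<le> 1 + |c| keeps the
    quadratic term at most b^2 / (1 + |c|).\<close>
  define t where "t = - b / (1 + \<bar>c\<bar>)"
  have "t\<^sup>2 * c \<le> t\<^sup>2 * (1 + \<bar>c\<bar>)" by (intro mult_left_mono) auto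
  also have "\<dots> = b\<^sup>2 / (1 + \<bar>c\<bar>)" using abs_ge_zero[of c] by (simp add: t_def power_divide power2_eq_square)
  finally have "0 \<le> 2 * t * b + b\<^sup>2 / (1 + \<bar>c\<bar>)" using assms[of t] by linarith
  moreover have "t * b = - (b\<^sup>2 / (1 + \<bar>c\<bar>))" by (simp add: t_def power2_eq_square)
  ultimately have "b\<^sup>2 / (1 + \<bar>c\<bar>) \<le> 0" by simp
  moreover have "0 < b\<^sup>2 / (1 + \<bar>c\<bar>)" using b by simp
  ultimately show False by linarith
qed

text \<open>The representing vector of \<open>f\<close> minimizes \<open>\<parallel>x\<parallel>\<^sup>2 - 2 f x\<close>; the parallelogram law makes every
  minimizing sequence Cauchy.\<close>

lemma riesz_real:
  fixes f :: "'h::complex_hilbert_space \<Rightarrow> real"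
  assumes "bounded_linear f"
  shows "\<exists>z. \<forall>x. f x = Re (cinner x z)"
proof -
  interpret bounded_linear f by fact
  obtain K where K: "\<And>x. norm (f x) \<le> norm x * K" "K > 0" using pos_bounded by blast
  define J where "J x = (norm x)\<^sup>2 - 2 * f x" for x
  have J_ge: "J x \<ge> - K\<^sup>2" for x
  proof -
    have "f x \<le> norm x * K" using K(1)[of x] by simp
    moreover have "0 \<le> (norm x - K)\<^sup>2" by simp
    ultimately show ?thesis by (simp add: J_def power2_diff)
  qed
  define m where "m = Inf (range J)"
  have bdd: "bdd_below (range J)" using J_ge by (auto intro!: bdd_belowI)
  have m_le: "m \<le> J x" for x unfolding m_def by (rule cInf_lower[OF _ bdd]) auto
  have "\<exists>x. J x < m + 1 / real (Suc n)" for n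
  proof -
    have "Inf (range J) < m + 1 / real (Suc n)" by (simp add: m_def)
    then show ?thesis using cInf_lessD[of "range J"] by blast
  qed
  then obtain u where u: "\<And>n. J (u n) < m + 1 / real (Suc n)" by metis
  have par: "(norm (x - y))\<^sup>2 \<le> 2 * (J x - m) + 2 * (J y - m)" for x y
  proof -
    have "m \<le> J ((1/2) *\<^sub>R (x + y))" by (rule m_le)
    also have "\<dots> = (norm (x + y))\<^sup>2 / 4 - (f x + f y)"
      by (simp add: J_def scaleR add power_mult_distrib power2_eq_square del: scaleR_add_right)
        (simp add: field_simps)
    finally have "4 * m \<le> (norm (x + y))\<^sup>2 - 4 * (f x + f y)" by simp
    then show ?thesis
      using norm_add_sq[of x y] norm_diff_sq[of x y] by (simp add: J_def)
  qed
  have "Cauchy u"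
  proof (rule metric_CauchyI)
    fix e :: real assume e: "e > 0"
    obtain N where N: "N > 0" "4 / real N < e\<^sup>2"
    proof -
      obtain N :: nat where "4 / e\<^sup>2 < real N" using reals_Archimedean2 by blast
      moreover from this have "N > 0" using e by (metis divide_pos_pos gr0I less_asym of_nat_0 zero_less_numeral zero_less_power)
      ultimately show ?thesis using that[of N] e by (simp add: field_simps)
    qed
    have "dist (u m') (u n) < e" if "m' \<ge> N" "n \<ge> N" for m' n
    proof -
      have *: "J (u k) - m < 1 / real N" if "k \<ge> N" for k
      proof -
        have "1 / real (Suc k) \<le> 1 / real N" using that N(1) by (intro divide_left_mono) auto
        then show ?thesis using u[of k] by linarith
      qed
      have "(norm (u m' - u n))\<^sup>2 < 4 / real N"
        using par[of "u m'" "u n"] *[OF that(1)] *[OF that(2)] by simp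
      then have "(norm (u m' - u n))\<^sup>2 < e\<^sup>2" using N(2) by linarith
      then show ?thesis using e by (simp add: dist_norm power2_less_imp_less)
    qed
    then show "\<exists>M. \<forall>m\<ge>M. \<forall>n\<ge>M. dist (u m) (u n) < e" by blast
  qed
  then obtain z where z: "u \<longlonglongrightarrow> z" using Cauchy_convergent_iff convergent_def by blast
  have "(\<lambda>n. J (u n)) \<longlonglongrightarrow> J z"
    unfolding J_def by (intro tendsto_intros z tendsto)
  moreover have "(\<lambda>n. m + 1 / real (Suc n)) \<longlonglongrightarrow> m"
    using tendsto_add[OF tendsto_const[of m] LIMSEQ_inverse_real_of_nat] by (simp add: inverse_eq_divide)
  ultimately have Jz: "J z \<le> m"
    by (rule LIMSEQ_le) (use u less_imp_le in blast)
  have "f x = Re (cinner x z)" for x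
  proof -
    \<comment> \<open>J does not fall below its minimum along the line through z in direction x;
      expanding in t gives a quadratic inequality.\<close>
    have "0 \<le> 2 * t * (Re (cinner z x) - f x) + t\<^sup>2 * (norm x)\<^sup>2" for t
    proof -
      have "J z \<le> J (z + t *\<^sub>R x)" using Jz m_le order_trans by blast
      then show ?thesis
        by (simp add: J_def norm_add_sq add scaleR cinner_simps power_mult_distrib algebra_simps)
    qed
    then have "Re (cinner z x) - f x = 0" by (rule quadratic_nonneg_imp_zero)
    then show ?thesis using cinner_commute[of z x] by simp
  qed
  then show ?thesis by blast
qed

lemma blinfun_apply_bounded_linear_cinner:
  "bounded_linear (\<lambda>x. Re (cinner (blinfun_apply T x) (y::'h::complex_hilbert_space)))"
proof (rule bounded_linear_intro[where K = "norm T * norm y"])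
  fix x
  have "\<bar>Re (cinner (blinfun_apply T x) y)\<bar> \<le> cmod (cinner (blinfun_apply T x) y)"
    by (rule abs_Re_le_cmod)
  also have "\<dots> \<le> norm (blinfun_apply T x) * norm y" by (rule cmod_cinner_le)
  also have "\<dots> \<le> (norm T * norm x) * norm y" by (intro mult_right_mono norm_blinfun) auto
  finally show "norm (Re (cinner (blinfun_apply T x) y)) \<le> norm x * (norm T * norm y)"
    by (simp add: mult_ac)
qed (simp_all add: blinfun.add_right blinfun.scaleR_right cinner_simps)

section \<open>Adjoints of complex-linear operators\<close>

lemma bounded_operators_scale:
  "T \<in> bounded_operators \<Longrightarrow> blinfun_apply T (c *\<^sub>C x) = c *\<^sub>C blinfun_apply T x"
  by (simp add: bounded_operators_def)

lemma ex_adjoint: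
  assumes T: "T \<in> bounded_operators"
  shows "\<exists>S\<in>bounded_operators. (\<forall>x y. cinner (blinfun_apply T x) y = cinner x (blinfun_apply S y)) \<and> norm S \<le> norm T"
proof -
  have "\<exists>z. \<forall>x. cinner (blinfun_apply T x) y = cinner x z" for y
  proof -
    obtain z where z: "\<And>x. Re (cinner (blinfun_apply T x) y) = Re (cinner x z)"
      using riesz_real[OF blinfun_apply_bounded_linear_cinner[of T y]] by blast
    \<comment> \<open>Both sides are complex-linear in x, so the identity of real parts at
      \<open>\<i> *\<^sub>C x\<close> is the identity of imaginary parts at x.\<close>
    have "Im (cinner (blinfun_apply T x) y) = Im (cinner x z)" for x
      using z[of "\<i> *\<^sub>C x"] by (simp add: bounded_operators_scale[OF T] cinner_simps)
    with z show ?thesis by (metis complex_eqI)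
  qed
  then obtain s where s: "\<And>x y. cinner (blinfun_apply T x) y = cinner x (s y)" by metis
  have s_add: "s (x + y) = s x + s y" for x y
    by (rule cinner_left_eqI) (simp only: s[symmetric] cinner_add_right)
  have s_scaleC: "s (c *\<^sub>C x) = c *\<^sub>C s x" for c x
    by (rule cinner_left_eqI) (simp only: s[symmetric] cinner_scaleC_right)
  have s_norm: "norm (s y) \<le> norm y * norm T" for y
  proof -
    have "(norm (s y))\<^sup>2 = cmod (cinner (s y) (s y))" by (simp add: cinner_self norm_power)
    also have "\<dots> = cmod (cinner (blinfun_apply T (s y)) y)" by (simp add: s)
    also have "\<dots> \<le> norm (blinfun_apply T (s y)) * norm y" by (rule cmod_cinner_le)
    also have "\<dots> \<le> (norm T * norm (s y)) * norm y" by (intro mult_right_mono norm_blinfun) auto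
    finally have "norm (s y) * norm (s y) \<le> norm (s y) * (norm y * norm T)"
      by (simp add: power2_eq_square mult_ac)
    then show ?thesis by (cases "norm (s y) = 0") (auto simp: mult_le_cancel_left_pos)
  qed
  have bl: "bounded_linear s"
    by (rule bounded_linear_intro[where K = "norm T"])
      (use s_add s_scaleC s_norm in \<open>auto simp: scaleC_of_real[symmetric]\<close>)
  have ap: "blinfun_apply (Blinfun s) y = s y" for y
    by (simp add: bounded_linear_Blinfun_apply[OF bl])
  have "norm (Blinfun s) \<le> norm T"
    by (rule norm_blinfun_bound) (use s_norm ap in \<open>auto simp: mult.commute\<close>)
  then show ?thesis
    by (intro bexI[of _ "Blinfun s"]) (auto simp: ap s bounded_operators_def s_scaleC)
qed

lemma adjoint_op_unique:
  assumes "\<And>x y. cinner (blinfun_apply T x) y = cinner x (blinfun_apply S y)"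
  shows "adjoint_op T = S"
  unfolding adjoint_op_def
proof (rule the_equality)
  show "\<forall>x y. cinner (blinfun_apply T x) y = cinner x (blinfun_apply S y)" using assms by blast
  fix S' assume "\<forall>x y. cinner (blinfun_apply T x) y = cinner x (blinfun_apply S' y)"
  then have "cinner x (blinfun_apply S' y) = cinner x (blinfun_apply S y)" for x y by (metis assms)
  then show "S' = S" by (intro blinfun_eqI cinner_left_eqI)
qed

lemma
  assumes T: "T \<in> bounded_operators"
  shows adjoint_op_bounded_operators: "adjoint_op T \<in> bounded_operators"
    and adjoint_op_left: "cinner (blinfun_apply T x) y = cinner x (blinfun_apply (adjoint_op T) y)"
    and norm_adjoint_op_le: "norm (adjoint_op T) \<le> norm T"
proof -
  obtain S where S: "S \<in> bounded_operators" "\<And>x y. cinner (blinfun_apply T x) y = cinner x (blinfun_apply S y)"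
      "norm S \<le> norm T"
    using ex_adjoint[OF T] by blast
  have "adjoint_op T = S" by (rule adjoint_op_unique) (rule S(2))
  then show "adjoint_op T \<in> bounded_operators" "norm (adjoint_op T) \<le> norm T"
    "cinner (blinfun_apply T x) y = cinner x (blinfun_apply (adjoint_op T) y)" using S by auto
qed

lemma adjoint_op_right:
  assumes T: "T \<in> bounded_operators"
  shows "cinner x (blinfun_apply T y) = cinner (blinfun_apply (adjoint_op T) x) y"
  by (metis adjoint_op_left[OF T] cinner_commute)

lemma adjoint_op_adjoint_op: "T \<in> bounded_operators \<Longrightarrow> adjoint_op (adjoint_op T) = T"
  by (rule adjoint_op_unique) (simp add: adjoint_op_right)

lemma adjoint_op_compose:
  "S \<in> bounded_operators \<Longrightarrow> T \<in> bounded_operators \<Longrightarrow>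
    adjoint_op (S o\<^sub>L T) = adjoint_op T o\<^sub>L adjoint_op S"
  by (rule adjoint_op_unique) (simp add: adjoint_op_left)

lemma adjoint_op_add:
  "S \<in> bounded_operators \<Longrightarrow> T \<in> bounded_operators \<Longrightarrow>
    adjoint_op (S + T) = adjoint_op S + adjoint_op T"
  by (rule adjoint_op_unique) (simp add: adjoint_op_left blinfun.add_left cinner_simps)

lemma adjoint_op_op_scale:
  "T \<in> bounded_operators \<Longrightarrow> adjoint_op (op_scale c T) = op_scale (cnj c) (adjoint_op T)"
  by (rule adjoint_op_unique) (simp add: adjoint_op_left op_scale_apply cinner_simps)

text \<open>The C*-identity. The nontrivial half follows from
  \<open>(norm (T x))\<^sup>2 = cinner x (P x)\<close> with P the product on the left, and
  Cauchy-Schwarz.\<close>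

lemma norm_adjoint_op_compose:
  assumes T: "T \<in> bounded_operators"
  shows "norm (adjoint_op T o\<^sub>L T) = (norm T)\<^sup>2"
proof (rule antisym)
  have "norm (adjoint_op T o\<^sub>L T) \<le> norm (adjoint_op T) * norm T" by (rule norm_blinfun_compose)
  also have "\<dots> \<le> norm T * norm T" by (intro mult_right_mono norm_adjoint_op_le T) auto
  finally show "norm (adjoint_op T o\<^sub>L T) \<le> (norm T)\<^sup>2" by (simp add: power2_eq_square)
  let ?P = "adjoint_op T o\<^sub>L T"
  have "norm (blinfun_apply T x) \<le> sqrt (norm ?P) * norm x" for x
  proof -
    have "(norm (blinfun_apply T x))\<^sup>2 = cmod (cinner (blinfun_apply T x) (blinfun_apply T x))"
      by (simp add: cinner_self norm_power)
    also have "\<dots> = cmod (cinner x (blinfun_apply ?P x))" by (simp add: adjoint_op_left[OF T])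
    also have "\<dots> \<le> norm x * norm (blinfun_apply ?P x)" by (rule cmod_cinner_le)
    also have "\<dots> \<le> norm x * (norm ?P * norm x)" by (intro mult_left_mono norm_blinfun) auto
    also have "\<dots> = (sqrt (norm ?P) * norm x)\<^sup>2" by (simp add: power_mult_distrib power2_eq_square)
    finally show ?thesis by (rule power2_le_imp_le) auto
  qed
  then have "norm T \<le> sqrt (norm ?P)" by (intro norm_blinfun_bound) auto
  then have "(norm T)\<^sup>2 \<le> (sqrt (norm ?P))\<^sup>2" by (intro power_mono) auto
  then show "(norm T)\<^sup>2 \<le> norm ?P" by simp
qed

section \<open>Square roots\<close>

interpretation blinfun_compose: bounded_bilinear "(o\<^sub>L)"
  by (rule bounded_bilinear_blinfun_compose)

lemma blinfun_compose_assoc: "(R o\<^sub>L S) o\<^sub>L T = R o\<^sub>L (S o\<^sub>L T)"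
  by (rule blinfun_eqI) simp

lemma blinfun_compose_id [simp]: "id_blinfun o\<^sub>L T = T" "T o\<^sub>L id_blinfun = T"
  by (auto intro: blinfun_eqI)

lemmas bcomp_simps = blinfun_compose.add_left blinfun_compose.add_right
  blinfun_compose.diff_left blinfun_compose.diff_right blinfun_compose.minus_left
  blinfun_compose.minus_right blinfun_compose.scaleR_left blinfun_compose.scaleR_right

text \<open>A fixed point r of r \<mapsto> (t + r^2) / 2 satisfies (1 - r)^2 = 1 - t. The iteration
  thus yields a square root of 1 - t by polynomials in t.\<close>

fun sqrt_iter :: "('a::real_normed_vector \<Rightarrow>\<^sub>L 'a) \<Rightarrow> nat \<Rightarrow> 'a \<Rightarrow>\<^sub>L 'a" where
  "sqrt_iter t 0 = 0"
| "sqrt_iter t (Suc n) = (1/2) *\<^sub>R (t + (sqrt_iter t n o\<^sub>L sqrt_iter t n))"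

text \<open>The same iteration for the number t = 1, which majorizes all others; its convergence
  controls every \<open>t\<close> with norm at most one.\<close>

fun sqrt_bound :: "nat \<Rightarrow> real" where
  "sqrt_bound 0 = 0"
| "sqrt_bound (Suc n) = (1 + (sqrt_bound n)\<^sup>2) / 2"

lemma sqrt_bound_range: "0 \<le> sqrt_bound n \<and> sqrt_bound n \<le> 1"
proof (induction n)
  case (Suc n)
  then have "(sqrt_bound n)\<^sup>2 \<le> 1" by (simp add: power_le_one)
  then show ?case by simp
qed simp

lemma sqrt_bound_Suc_ge: "sqrt_bound n \<le> sqrt_bound (Suc n)"
proof -
  have "0 \<le> (1 - sqrt_bound n)\<^sup>2" by simp
  then show ?thesis by (simp add: power2_diff)
qed

lemma sqrt_bound_tendsto: "sqrt_bound \<longlonglongrightarrow> 1"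
proof -
  have "incseq sqrt_bound" by (rule incseq_SucI) (rule sqrt_bound_Suc_ge)
  then obtain L where L: "sqrt_bound \<longlonglongrightarrow> L"
    using incseq_convergent[of sqrt_bound 1] sqrt_bound_range by metis
  have "(\<lambda>n. sqrt_bound (Suc n)) \<longlonglongrightarrow> (1 + L\<^sup>2) / 2"
    unfolding sqrt_bound.simps by (intro tendsto_intros L) auto
  then have "L = (1 + L\<^sup>2) / 2" using LIMSEQ_Suc[OF L] LIMSEQ_unique by blast
  then have "(L - 1)\<^sup>2 = 0" by (simp add: power2_diff)
  then show ?thesis using L by simp
qed

lemma sqrt_iter_commute:
  assumes "S o\<^sub>L t = t o\<^sub>L S"
  shows "S o\<^sub>L sqrt_iter t n = sqrt_iter t n o\<^sub>L S"
proof (induction n)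
  case (Suc n)
  have "S o\<^sub>L (sqrt_iter t n o\<^sub>L sqrt_iter t n) = (sqrt_iter t n o\<^sub>L sqrt_iter t n) o\<^sub>L S"
    by (metis Suc blinfun_compose_assoc)
  then show ?case by (simp add: bcomp_simps assms)
qed (simp add: blinfun_compose.zero_left blinfun_compose.zero_right)

lemma norm_sqrt_iter:
  assumes "norm t \<le> 1"
  shows "norm (sqrt_iter t n) \<le> sqrt_bound n"
proof (induction n)
  case (Suc n)
  have "norm (t + (sqrt_iter t n o\<^sub>L sqrt_iter t n)) \<le> norm t + norm (sqrt_iter t n) * norm (sqrt_iter t n)"
    by (intro norm_triangle_mono norm_blinfun_compose order_refl)
  also have "\<dots> \<le> 1 + sqrt_bound n * sqrt_bound n"
    by (intro add_mono mult_mono assms Suc) (use sqrt_bound_range in auto)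
  finally show ?case by (simp add: power2_eq_square)
qed simp

text \<open>All iterates commute, so the difference of two squares factors into difference and sum.
  Estimating both factors by the scalar sequence reproduces the recursion of its increments.\<close>

lemma norm_sqrt_iter_Suc_diff:
  assumes t: "norm t \<le> 1"
  shows "norm (sqrt_iter t (Suc n) - sqrt_iter t n) \<le> sqrt_bound (Suc n) - sqrt_bound n"
proof (induction n)
  case 0
  show ?case using t by simp
next
  case (Suc n)
  let ?r = "sqrt_iter t" and ?b = sqrt_bound
  have com: "?r m o\<^sub>L ?r k = ?r k o\<^sub>L ?r m" for m k
    by (intro sqrt_iter_commute sqrt_iter_commute[symmetric] refl)
  have "?r (Suc (Suc n)) - ?r (Suc n) = (1/2) *\<^sub>R ((?r (Suc n) o\<^sub>L ?r (Suc n)) - (?r n o\<^sub>L ?r n))"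
    using sqrt_iter.simps(2)[of t "Suc n"] sqrt_iter.simps(2)[of t n]
    by (metis (no_types, lifting) add_diff_cancel_left scaleR_diff_right)
  also have "(?r (Suc n) o\<^sub>L ?r (Suc n)) - (?r n o\<^sub>L ?r n) = (?r (Suc n) - ?r n) o\<^sub>L (?r (Suc n) + ?r n)"
    unfolding blinfun_compose.add_right blinfun_compose.diff_left com[of n "Suc n"]
    by (simp only: algebra_simps)
  finally have "norm (?r (Suc (Suc n)) - ?r (Suc n)) = (1/2) * norm ((?r (Suc n) - ?r n) o\<^sub>L (?r (Suc n) + ?r n))"
    by simp
  also have "\<dots> \<le> (1/2) * (norm (?r (Suc n) - ?r n) * norm (?r (Suc n) + ?r n))"
    by (intro mult_left_mono norm_blinfun_compose) auto
  also have "\<dots> \<le> (1/2) * ((?b (Suc n) - ?b n) * (?b (Suc n) + ?b n))"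
  proof (intro mult_left_mono mult_mono Suc norm_triangle_mono norm_sqrt_iter t)
    show "0 \<le> ?b (Suc n) - ?b n" using sqrt_bound_Suc_ge[of n] by linarith
  qed auto
  also have "\<dots> = ?b (Suc (Suc n)) - ?b (Suc n)"
    by (simp add: power2_eq_square field_simps)
  finally show ?case .
qed

lemma norm_sqrt_iter_diff:
  assumes t: "norm t \<le> 1" and "m \<le> n"
  shows "norm (sqrt_iter t n - sqrt_iter t m) \<le> sqrt_bound n - sqrt_bound m"
  using \<open>m \<le> n\<close>
proof (induction n rule: dec_induct)
  case (step n)
  have "sqrt_iter t (Suc n) - sqrt_iter t m = (sqrt_iter t (Suc n) - sqrt_iter t n) + (sqrt_iter t n - sqrt_iter t m)"
    by simp
  then have "norm (sqrt_iter t (Suc n) - sqrt_iter t m) \<le> norm (sqrt_iter t (Suc n) - sqrt_iter t n) + norm (sqrt_iter t n - sqrt_iter t m)"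
    by (metis norm_triangle_ineq)
  then show ?case using step.IH norm_sqrt_iter_Suc_diff[OF t, of n] by linarith
qed simp

definition sqrt_lim :: "('a::banach \<Rightarrow>\<^sub>L 'a) \<Rightarrow> 'a \<Rightarrow>\<^sub>L 'a" where
  "sqrt_lim t = lim (sqrt_iter t)"

lemma sqrt_iter_tendsto:
  fixes t :: "'a::banach \<Rightarrow>\<^sub>L 'a"
  assumes t: "norm t \<le> 1"
  shows "sqrt_iter t \<longlonglongrightarrow> sqrt_lim t"
proof -
  have "Cauchy (sqrt_iter t)"
  proof (rule metric_CauchyI)
    fix e :: real assume "e > 0"
    then obtain N where N: "\<And>m n. m \<ge> N \<Longrightarrow> n \<ge> N \<Longrightarrow> dist (sqrt_bound m) (sqrt_bound n) < e"
      using LIMSEQ_imp_Cauchy[OF sqrt_bound_tendsto] metric_CauchyD by blast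
    have "dist (sqrt_iter t m) (sqrt_iter t n) < e" if "m \<ge> N" "n \<ge> N" for m n
    proof (cases "m \<le> n")
      case True
      then show ?thesis using norm_sqrt_iter_diff[OF t True] N[OF that]
        by (simp add: dist_norm norm_minus_commute abs_le_iff)
    next
      case False
      then show ?thesis using norm_sqrt_iter_diff[OF t, of n m] N[OF that]
        by (simp add: dist_norm)
    qed
    then show "\<exists>M. \<forall>m\<ge>M. \<forall>n\<ge>M. dist (sqrt_iter t m) (sqrt_iter t n) < e" by blast
  qed
  then show ?thesis
    by (simp add: sqrt_lim_def Cauchy_convergent_iff convergent_LIMSEQ_iff)
qed

lemma norm_sqrt_lim_diff:
  fixes t :: "'a::banach \<Rightarrow>\<^sub>L 'a"
  assumes t: "norm t \<le> 1"
  shows "norm (sqrt_lim t - sqrt_iter t n) \<le> 1 - sqrt_bound n"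
proof (rule LIMSEQ_le)
  show "(\<lambda>k. norm (sqrt_iter t k - sqrt_iter t n)) \<longlonglongrightarrow> norm (sqrt_lim t - sqrt_iter t n)"
    by (intro tendsto_intros sqrt_iter_tendsto t)
  show "(\<lambda>k. sqrt_bound k - sqrt_bound n) \<longlonglongrightarrow> 1 - sqrt_bound n"
    by (intro tendsto_intros sqrt_bound_tendsto)
qed (use norm_sqrt_iter_diff[OF t] in blast)

lemma norm_sqrt_lim: "norm (t :: 'a::banach \<Rightarrow>\<^sub>L 'a) \<le> 1 \<Longrightarrow> norm (sqrt_lim t) \<le> 1"
  using norm_sqrt_lim_diff[of t 0] by simp

lemma sqrt_lim_eq:
  fixes t :: "'a::banach \<Rightarrow>\<^sub>L 'a"
  assumes t: "norm t \<le> 1"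
  shows "(id_blinfun - sqrt_lim t) o\<^sub>L (id_blinfun - sqrt_lim t) = id_blinfun - t"
proof -
  let ?r = "sqrt_lim t"
  have "(\<lambda>n. sqrt_iter t (Suc n)) \<longlonglongrightarrow> (1/2) *\<^sub>R (t + (?r o\<^sub>L ?r))"
    unfolding sqrt_iter.simps by (intro tendsto_intros blinfun_compose.tendsto sqrt_iter_tendsto t)
  from LIMSEQ_unique[OF LIMSEQ_Suc[OF sqrt_iter_tendsto[OF t]] this]
  have "2 *\<^sub>R ?r = 2 *\<^sub>R ((1/2) *\<^sub>R (t + (?r o\<^sub>L ?r)))" by simp
  then have "2 *\<^sub>R ?r = t + (?r o\<^sub>L ?r)" by simp
  then show ?thesis by (simp add: bcomp_simps scaleR_2 algebra_simps)
qed

text \<open>Each iterate is a polynomial in \<open>T c\<close>, and the rate of convergence is that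
  of \<open>sqrt_bound\<close>, independently of c; hence the limit is uniform. The connectedness
  argument for maximal ideals lets c vary.\<close>

lemma continuous_on_sqrt_lim:
  fixes T :: "real \<Rightarrow> 'a::banach \<Rightarrow>\<^sub>L 'a"
  assumes "continuous_on I T" "\<And>c. c \<in> I \<Longrightarrow> norm (T c) \<le> 1"
  shows "continuous_on I (\<lambda>c. sqrt_lim (T c))"
proof (rule uniform_limit_theorem)
  have "continuous_on I (\<lambda>c. sqrt_iter (T c) n)" for n
    by (induction n) (auto intro!: continuous_intros blinfun_compose.continuous_on assms)
  then show "\<forall>\<^sub>F n in sequentially. continuous_on I (\<lambda>c. sqrt_iter (T c) n)" by simp
  show "uniform_limit I (\<lambda>n c. sqrt_iter (T c) n) (\<lambda>c. sqrt_lim (T c)) sequentially"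
  proof (rule uniform_limitI)
    fix e :: real assume "e > 0"
    then have "\<forall>\<^sub>F n in sequentially. dist (sqrt_bound n) 1 < e"
      using sqrt_bound_tendsto tendstoD by blast
    then show "\<forall>\<^sub>F n in sequentially. \<forall>c\<in>I. dist (sqrt_iter (T c) n) (sqrt_lim (T c)) < e"
    proof eventually_elim
      case (elim n)
      then show ?case
        using norm_sqrt_lim_diff[OF assms(2), of _ n] by (fastforce simp: dist_norm norm_minus_commute)
    qed
  qed
qed simp

section \<open>Commutative C*-algebras of operators and their characters\<close>

lemma op_scale_one [simp]: "op_scale 1 T = T"
  by (rule blinfun_eqI) (metis op_scale_apply scaleC_of_real of_real_1 scaleR_one)

lemma op_scale_of_real: "op_scale (of_real r) T = r *\<^sub>R T"
  by (rule blinfun_eqI) (simp add: op_scale_apply scaleC_of_real blinfun.scaleR_left)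

lemma op_scale_add_right: "op_scale c (S + T) = op_scale c S + op_scale c T"
  by (rule blinfun_eqI) (simp add: op_scale_apply scaleC_add_right blinfun.add_left)

lemma op_scale_add_left: "op_scale (c + d) T = op_scale c T + op_scale d T"
  by (rule blinfun_eqI) (simp add: op_scale_apply scaleC_add_left blinfun.add_left)

lemma op_scale_op_scale: "op_scale c (op_scale d T) = op_scale (c * d) T"
  by (rule blinfun_eqI) (simp add: op_scale_apply scaleC_scaleC)

lemma op_scale_zero_left [simp]: "op_scale 0 T = 0"
  using op_scale_of_real[of 0 T] by simp

lemma op_scale_zero_right [simp]: "op_scale c 0 = 0"
  by (rule blinfun_eqI) (simp add: op_scale_apply)

lemma op_scale_minus_one [simp]: "op_scale (- 1) T = - T"
  using op_scale_of_real[of "-1" T] by simp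

lemma op_scale_compose_left: "op_scale c S o\<^sub>L T = op_scale c (S o\<^sub>L T)"
  by (rule blinfun_eqI) (simp add: op_scale_apply)

lemma op_scale_compose_right:
  "S \<in> bounded_operators \<Longrightarrow> S o\<^sub>L op_scale c T = op_scale c (S o\<^sub>L T)"
  by (rule blinfun_eqI) (simp add: op_scale_apply bounded_operators_scale)

lemma norm_op_scale: "norm (op_scale c T) = cmod c * norm T"
proof -
  have le: "norm (op_scale c T) \<le> cmod c * norm T" for c and T :: "'h::complex_hilbert_space oper"
  proof (rule norm_blinfun_bound)
    show "norm (blinfun_apply (op_scale c T) x) \<le> cmod c * norm T * norm x" for x
      using mult_left_mono[OF norm_blinfun[of T x], of "cmod c"]
      by (simp add: op_scale_apply norm_scaleC mult_ac)
  qed simp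
  show ?thesis
  proof (cases "c = 0")
    case False
    have "cmod c * norm T = cmod c * norm (op_scale (inverse c) (op_scale c T))"
      using False by (simp add: op_scale_op_scale)
    also have "\<dots> \<le> cmod c * (cmod (inverse c) * norm (op_scale c T))"
      by (intro mult_left_mono le) simp
    also have "\<dots> = norm (op_scale c T)" using False by (simp add: norm_inverse)
    finally show ?thesis using le[of c T] by simp
  qed simp
qed

lemma id_blinfun_bounded_operators: "id_blinfun \<in> bounded_operators"
  by (simp add: bounded_operators_def)

lemma adjoint_op_id [simp]: "adjoint_op id_blinfun = id_blinfun"
  by (rule adjoint_op_unique) simp

text \<open>The solution is the Neumann series of the inverse of 1 - T applied to a. Obtaining it as
  a fixed point in the closed set A places it in A even when T itself lies outside.\<close>

lemma neumann_series:
  fixes T :: "'a::banach \<Rightarrow>\<^sub>L 'a"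
  assumes "norm T < 1" "closed A" "a \<in> A" "\<And>y. y \<in> A \<Longrightarrow> a + (T o\<^sub>L y) \<in> A"
  shows "\<exists>b\<in>A. b = a + (T o\<^sub>L b)"
proof -
  have "\<exists>!b\<in>A. a + (T o\<^sub>L b) = b"
  proof (rule Banach_fix)
    show "complete A" using assms(2) by (simp add: complete_eq_closed)
    show "dist (a + (T o\<^sub>L x)) (a + (T o\<^sub>L y)) \<le> norm T * dist x y" for x y
      by (simp add: dist_norm blinfun_compose.diff_right[symmetric] norm_blinfun_compose)
  qed (use assms in auto)
  then show ?thesis by metis
qed

locale comm_cstar =
  fixes A :: "'h::complex_hilbert_space oper set"
  assumes cstar: "cstar_subalgebra A" and comm: "commutative_algebra A"
begin

lemma A_bounded_operators: "T \<in> A \<Longrightarrow> T \<in> bounded_operators"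
  and A_zero: "0 \<in> A"
  and A_add: "S \<in> A \<Longrightarrow> T \<in> A \<Longrightarrow> S + T \<in> A"
  and A_op_scale: "T \<in> A \<Longrightarrow> op_scale c T \<in> A"
  and A_compose: "S \<in> A \<Longrightarrow> T \<in> A \<Longrightarrow> S o\<^sub>L T \<in> A"
  and A_adjoint: "T \<in> A \<Longrightarrow> adjoint_op T \<in> A"
  and A_closed: "closed A"
  using cstar by (auto simp: cstar_subalgebra_def)

lemma A_scaleR: "T \<in> A \<Longrightarrow> r *\<^sub>R T \<in> A"
  by (metis A_op_scale op_scale_of_real)

lemma A_minus: "T \<in> A \<Longrightarrow> - T \<in> A"
  by (metis A_op_scale op_scale_minus_one)

lemma A_diff: "S \<in> A \<Longrightarrow> T \<in> A \<Longrightarrow> S - T \<in> A"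
  using A_add[of S "- T"] A_minus by simp

lemma A_sum: "(\<And>i. i \<in> I \<Longrightarrow> f i \<in> A) \<Longrightarrow> sum f I \<in> A"
  by (induction I rule: infinite_finite_induct) (auto intro: A_zero A_add)

lemmas A_intros = A_zero A_add A_op_scale A_compose A_adjoint A_scaleR A_minus A_diff A_sum

lemma A_commute: "S \<in> A \<Longrightarrow> T \<in> A \<Longrightarrow> S o\<^sub>L T = T o\<^sub>L S"
  using comm by (simp add: commutative_algebra_def)

lemma A_limit: "(\<And>n. u n \<in> A) \<Longrightarrow> u \<longlonglongrightarrow> l \<Longrightarrow> l \<in> A"
  using A_closed closed_sequentially by blast

definition chars :: "('h oper \<Rightarrow> complex) set" where "chars = characters A"

lemma
  assumes "\<theta> \<in> chars"
  shows chi_add: "S \<in> A \<Longrightarrow> T \<in> A \<Longrightarrow> \<theta> (S + T) = \<theta> S + \<theta> T"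
    and chi_op_scale: "T \<in> A \<Longrightarrow> \<theta> (op_scale c T) = c * \<theta> T"
    and chi_compose: "S \<in> A \<Longrightarrow> T \<in> A \<Longrightarrow> \<theta> (S o\<^sub>L T) = \<theta> S * \<theta> T"
    and chi_nonzero: "\<exists>T\<in>A. \<theta> T \<noteq> 0"
  using assms by (auto simp: chars_def characters_def linear_functional_def)

lemma chi_zero: "\<theta> \<in> chars \<Longrightarrow> \<theta> 0 = 0"
  using chi_op_scale[of \<theta> 0 0] A_zero by simp

lemma chi_scaleR: "\<theta> \<in> chars \<Longrightarrow> T \<in> A \<Longrightarrow> \<theta> (r *\<^sub>R T) = of_real r * \<theta> T"
  by (metis chi_op_scale op_scale_of_real)

lemma chi_minus: "\<theta> \<in> chars \<Longrightarrow> T \<in> A \<Longrightarrow> \<theta> (- T) = - \<theta> T"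
  using chi_op_scale[of \<theta> T "-1"] by simp

lemma chi_diff: "\<theta> \<in> chars \<Longrightarrow> S \<in> A \<Longrightarrow> T \<in> A \<Longrightarrow> \<theta> (S - T) = \<theta> S - \<theta> T"
  using chi_add[of \<theta> S "- T"] chi_minus A_minus by simp

lemma chi_sum:
  "\<theta> \<in> chars \<Longrightarrow> (\<And>i. i \<in> I \<Longrightarrow> f i \<in> A) \<Longrightarrow> \<theta> (sum f I) = (\<Sum>i\<in>I. \<theta> (f i))"
  by (induction I rule: infinite_finite_induct) (auto simp: chi_zero chi_add A_sum)

lemmas chi_simps = chi_add chi_op_scale chi_compose chi_zero chi_scaleR chi_minus chi_diff

text \<open>Characters extend contractively to the unitization; since the algebra may already contain the
  identity, this is stated without extending \<open>\<theta>\<close>.\<close>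

lemma cmod_add_chi_le:
  assumes \<theta>: "\<theta> \<in> chars" and x: "x \<in> A"
  shows "cmod (c + \<theta> x) \<le> norm (op_scale c id_blinfun + x)"
proof (rule ccontr)
  define z where "z = c + \<theta> x"
  define N where "N = op_scale c id_blinfun + x"
  assume "\<not> ?thesis"
  then have less: "norm N < cmod z" by (simp add: z_def N_def)
  then have z: "z \<noteq> 0" by auto
  obtain a where a: "a \<in> A" "\<theta> a \<noteq> 0" using chi_nonzero[OF \<theta>] by blast
  \<comment> \<open>T is a strict contraction, yet \<theta> takes the same value on
    \<open>T o\<^sub>L y\<close> and y. Solving \<open>b = a + (T o\<^sub>L b)\<close> in A
    therefore forces \<theta> a = 0.\<close>
  define T where "T = op_scale (inverse z) N"
  have T_comp: "T o\<^sub>L y = op_scale (inverse z) (op_scale c y + (x o\<^sub>L y))" for y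
    by (simp add: T_def N_def op_scale_compose_left bcomp_simps)
  have T_A: "T o\<^sub>L y \<in> A" and T_chi: "\<theta> (T o\<^sub>L y) = \<theta> y" if "y \<in> A" for y
  proof -
    show "T o\<^sub>L y \<in> A" using that x by (auto simp: T_comp intro!: A_intros)
    have "\<theta> (T o\<^sub>L y) = inverse z * (z * \<theta> y)"
      using that x \<theta> by (simp add: T_comp chi_simps A_intros z_def algebra_simps)
    then show "\<theta> (T o\<^sub>L y) = \<theta> y" using z by simp
  qed
  have "norm T < 1"
  proof -
    have "norm T = norm N / cmod z" by (simp add: T_def norm_op_scale norm_inverse divide_inverse mult.commute)
    then show ?thesis using less z by simp
  qed
  then obtain b where b: "b \<in> A" "b = a + (T o\<^sub>L b)"
    using neumann_series[of T A a] A_closed a(1) T_A A_add by blast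
  then have "\<theta> b = \<theta> a + \<theta> b"
    using chi_add[OF \<theta> a(1) T_A[OF b(1)]] T_chi[OF b(1)] by simp
  then show False using a(2) by simp
qed

lemma cmod_chi_le: "\<theta> \<in> chars \<Longrightarrow> x \<in> A \<Longrightarrow> cmod (\<theta> x) \<le> norm x"
  using cmod_add_chi_le[of \<theta> x 0] by simp

text \<open>For self-adjoint x the squared norm of i t + x is at most
  \<open>(norm x)\<^sup>2\<close> + t^2, whereas |i t + \<theta> x|^2 contains the cross term 2 t Im
  (\<theta> x). As t ranges over all reals, the cross term has to vanish.\<close>

lemma chi_selfadjoint_real:
  assumes \<theta>: "\<theta> \<in> chars" and x: "x \<in> A" "adjoint_op x = x"
  shows "Im (\<theta> x) = 0"
proof -
  have bound: "norm (op_scale (\<i> * of_real t) id_blinfun + x) \<le> sqrt ((norm x)\<^sup>2 + t\<^sup>2)" for t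
  proof (rule norm_blinfun_bound)
    fix v :: 'h
    have real: "Im (cinner v (blinfun_apply x v)) = 0"
    proof -
      have "cinner v (blinfun_apply x v) = cnj (cinner v (blinfun_apply x v))"
        by (metis adjoint_op_right[OF A_bounded_operators[OF x(1)]] cinner_commute x(2))
      then show ?thesis by (simp add: complex_eq_iff)
    qed
    have "(norm (blinfun_apply (op_scale (\<i> * of_real t) id_blinfun + x) v))\<^sup>2
        = t\<^sup>2 * (norm v)\<^sup>2 + (norm (blinfun_apply x v))\<^sup>2"
      by (simp add: blinfun.add_left op_scale_apply norm_add_sq norm_scaleC norm_mult cinner_simps real power_mult_distrib)
    also have "\<dots> \<le> t\<^sup>2 * (norm v)\<^sup>2 + (norm x * norm v)\<^sup>2"
      by (intro add_left_mono power_mono norm_blinfun) auto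
    also have "\<dots> = (sqrt ((norm x)\<^sup>2 + t\<^sup>2) * norm v)\<^sup>2"
      by (simp add: power_mult_distrib algebra_simps)
    finally show "norm (blinfun_apply (op_scale (\<i> * of_real t) id_blinfun + x) v) \<le> sqrt ((norm x)\<^sup>2 + t\<^sup>2) * norm v"
      by (rule power2_le_imp_le) simp
  qed simp
  have "0 \<le> 2 * t * (- Im (\<theta> x)) + t\<^sup>2 * 0 + ((norm x)\<^sup>2 - (cmod (\<theta> x))\<^sup>2)" for t
  proof -
    have "(cmod (\<i> * of_real t + \<theta> x))\<^sup>2 \<le> (sqrt ((norm x)\<^sup>2 + t\<^sup>2))\<^sup>2"
      using order_trans[OF cmod_add_chi_le[OF \<theta> x(1)] bound[of t]] by (intro power_mono) auto
    then show ?thesis by (simp add: cmod_power2) (simp add: power2_eq_square algebra_simps)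
  qed
  note ineq = this
  show ?thesis
  proof (rule ccontr)
    assume ne: "Im (\<theta> x) \<noteq> 0"
    \<comment> \<open>This t turns the right-hand side of \<open>ineq\<close> into -1.\<close>
    show False
      using ineq[of "((norm x)\<^sup>2 - (cmod (\<theta> x))\<^sup>2 + 1) / (2 * Im (\<theta> x))"] ne by simp
  qed
qed

lemma cartesian_decomposition:
  assumes a: "a \<in> A"
  obtains x y where "x \<in> A" "y \<in> A" "adjoint_op x = x" "adjoint_op y = y"
    "a = x + op_scale \<i> y" "adjoint_op a = x - op_scale \<i> y"
proof
  let ?x = "op_scale (1/2) (a + adjoint_op a)" and ?y = "op_scale (- \<i> / 2) (a + op_scale (- 1) (adjoint_op a))"
  have bo: "a \<in> bounded_operators" "adjoint_op a \<in> bounded_operators"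
    "a + adjoint_op a \<in> bounded_operators"
    "op_scale (- 1) (adjoint_op a) \<in> bounded_operators"
    "a + op_scale (- 1) (adjoint_op a) \<in> bounded_operators"
    using a by (intro A_bounded_operators A_intros; assumption)+
  show "?x \<in> A" "?y \<in> A" using a by (auto intro!: A_intros simp del: op_scale_minus_one)
  show "adjoint_op ?x = ?x"
    using bo by (simp add: adjoint_op_op_scale adjoint_op_add adjoint_op_adjoint_op add.commute)
  have "adjoint_op ?y = op_scale (\<i> / 2) (adjoint_op a + op_scale (- 1) a)"
    using bo by (simp add: adjoint_op_op_scale adjoint_op_add adjoint_op_adjoint_op del: op_scale_minus_one)
  also have "\<dots> = ?y"
    by (simp only: op_scale_add_right op_scale_op_scale) (simp add: add.commute)
  finally show "adjoint_op ?y = ?y" .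
  have half: "op_scale (1/2) T + op_scale (1/2) T = T" for T :: "'h oper"
    by (simp add: op_scale_add_left[symmetric])
  have "op_scale (- (1/2)) T = - op_scale (1/2) T" for T :: "'h oper"
    using op_scale_op_scale[of "-1" "1/2" T] by simp
  then have iy: "op_scale \<i> ?y = op_scale (1/2) a - op_scale (1/2) (adjoint_op a)"
    by (simp add: op_scale_add_right op_scale_op_scale del: op_scale_minus_one)
  show "a = ?x + op_scale \<i> ?y"
    unfolding iy using half[of a] by (simp add: op_scale_add_right)
  show "adjoint_op a = ?x - op_scale \<i> ?y"
    unfolding iy using half[of "adjoint_op a"] by (simp add: op_scale_add_right)
qed

lemma chi_adjoint:
  assumes \<theta>: "\<theta> \<in> chars" and a: "a \<in> A"
  shows "\<theta> (adjoint_op a) = cnj (\<theta> a)"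
proof -
  obtain x y where xy: "x \<in> A" "y \<in> A" "adjoint_op x = x" "adjoint_op y = y"
    "a = x + op_scale \<i> y" "adjoint_op a = x - op_scale \<i> y"
    using cartesian_decomposition[OF a] by metis
  then have "Im (\<theta> x) = 0" "Im (\<theta> y) = 0" using chi_selfadjoint_real \<theta> by blast+
  then show ?thesis
    using xy(1,2) \<theta> unfolding xy(6) unfolding xy(5) by (simp add: chi_simps A_intros complex_eq_iff)
qed

lemma chi_adjoint_compose:
  "\<theta> \<in> chars \<Longrightarrow> a \<in> A \<Longrightarrow> \<theta> (adjoint_op a o\<^sub>L a) = of_real ((cmod (\<theta> a))\<^sup>2)"
  by (simp add: chi_compose chi_adjoint A_adjoint complex_norm_square mult.commute del: of_real_power)

section \<open>Absolute values of self-adjoint contractions\<close>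

lemma norm_id_minus_square_le:
  assumes y: "y \<in> A" "adjoint_op y = y" "norm y \<le> 1"
  shows "norm (id_blinfun - (y o\<^sub>L y)) \<le> 1"
proof (rule norm_blinfun_bound)
  fix v :: 'h
  let ?w = "blinfun_apply y v"
  have "cinner v (blinfun_apply y ?w) = of_real ((norm ?w)\<^sup>2)"
    using adjoint_op_right[OF A_bounded_operators[OF y(1)], of v ?w] y(2) by (simp add: cinner_self)
  then have "(norm (v - blinfun_apply y ?w))\<^sup>2 = (norm v)\<^sup>2 - 2 * (norm ?w)\<^sup>2 + (norm (blinfun_apply y ?w))\<^sup>2"
    by (simp add: norm_diff_sq del: of_real_power)
  also have "(norm (blinfun_apply y ?w))\<^sup>2 \<le> (norm ?w)\<^sup>2"
    using order_trans[OF norm_blinfun[of y ?w] mult_right_mono[OF y(3), of "norm ?w"]]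
    by (intro power_mono) auto
  finally have "(norm (v - blinfun_apply y ?w))\<^sup>2 \<le> (norm v)\<^sup>2"
    by (smt (verit) zero_le_power2)
  then have "norm (v - blinfun_apply y ?w) \<le> norm v" by (rule power2_le_imp_le) simp
  then show "norm (blinfun_apply (id_blinfun - (y o\<^sub>L y)) v) \<le> 1 * norm v"
    by (simp add: blinfun.diff_left)
qed simp

text \<open>The square root of y^2, written as 1 - r with r the limit of the iteration for t = 1 -
  y^2.\<close>

definition op_abs :: "'h oper \<Rightarrow> 'h oper" where
  "op_abs y = id_blinfun - sqrt_lim (id_blinfun - (y o\<^sub>L y))"

lemma op_abs:
  assumes y: "y \<in> A" "adjoint_op y = y" "norm y \<le> 1"
  shows op_abs_in: "op_abs y \<in> A" and op_abs_square: "op_abs y o\<^sub>L op_abs y = y o\<^sub>L y"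
    and norm_id_minus_op_abs: "norm (id_blinfun - op_abs y) \<le> 1"
proof -
  define t where "t = id_blinfun - (y o\<^sub>L y)"
  have t: "norm t \<le> 1" unfolding t_def by (rule norm_id_minus_square_le[OF y])
  show "op_abs y o\<^sub>L op_abs y = y o\<^sub>L y"
    using sqrt_lim_eq[OF t] by (simp add: op_abs_def t_def)
  show "norm (id_blinfun - op_abs y) \<le> 1"
    using norm_sqrt_lim[OF t] by (simp add: op_abs_def t_def)
  \<comment> \<open>The iterates contain multiples of the identity, which A may lack. Subtracting
    them from the scalar iterates cancels these multiples, and since \<open>sqrt_bound\<close> tends
    to one the limit is still \<open>op_abs y\<close>.\<close>
  define a where "a n = sqrt_bound n *\<^sub>R id_blinfun - sqrt_iter t n" for n
  have "a n \<in> A" for n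
  proof (induction n)
    case 0 show ?case by (simp add: a_def A_zero)
  next
    case (Suc n)
    have r: "sqrt_iter t n = sqrt_bound n *\<^sub>R id_blinfun - a n" by (simp add: a_def)
    have "a (Suc n) = (1/2) *\<^sub>R ((y o\<^sub>L y) + (2 * sqrt_bound n) *\<^sub>R a n - (a n o\<^sub>L a n))"
    proof -
      have "2 *\<^sub>R a (Suc n) = (y o\<^sub>L y) + (2 * sqrt_bound n) *\<^sub>R a n - (a n o\<^sub>L a n)"
        unfolding a_def[of "Suc n"] sqrt_iter.simps sqrt_bound.simps r
        by (simp add: bcomp_simps t_def algebra_simps power2_eq_square add_divide_distrib scaleR_2[symmetric])
      then have "(1/2) *\<^sub>R (2 *\<^sub>R a (Suc n)) = (1/2) *\<^sub>R ((y o\<^sub>L y) + (2 * sqrt_bound n) *\<^sub>R a n - (a n o\<^sub>L a n))" by simp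
      then show ?thesis by simp
    qed
    then show ?case using Suc y(1) by (auto intro!: A_intros)
  qed
  moreover have "a \<longlonglongrightarrow> 1 *\<^sub>R id_blinfun - sqrt_lim t"
    unfolding a_def by (intro tendsto_intros sqrt_bound_tendsto sqrt_iter_tendsto t)
  ultimately show "op_abs y \<in> A"
    using A_limit[of a] by (simp add: op_abs_def t_def)
qed

text \<open>Equality of squares leaves two signs. The norm bound on 1 - |y| puts \<theta> |y| into
  the disc of radius one around one and so selects the nonnegative value.\<close>

lemma chi_op_abs:
  assumes \<theta>: "\<theta> \<in> chars" and y: "y \<in> A" "adjoint_op y = y" "norm y \<le> 1"
  shows "\<theta> (op_abs y) = of_real \<bar>Re (\<theta> y)\<bar>"
proof -
  let ?s = "op_abs y"
  have "\<theta> ?s * \<theta> ?s = \<theta> y * \<theta> y"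
    using op_abs_square[OF y] chi_compose[OF \<theta>] op_abs_in[OF y] y(1) by metis
  then have "\<theta> ?s = \<theta> y \<or> \<theta> ?s = - \<theta> y" by algebra
  moreover have "Im (\<theta> y) = 0" using chi_selfadjoint_real \<theta> y by blast
  moreover have "0 \<le> Re (\<theta> ?s)"
  proof -
    have "cmod (1 + \<theta> (- ?s)) \<le> norm (op_scale 1 id_blinfun + - ?s)"
      by (intro cmod_add_chi_le \<theta> A_minus op_abs_in y)
    then have "cmod (1 - \<theta> ?s) \<le> 1"
      using norm_id_minus_op_abs[OF y] by (simp add: chi_minus \<theta> op_abs_in y)
    then show ?thesis using complex_Re_le_cmod[of "1 - \<theta> ?s"] by simp
  qed
  ultimately show ?thesis by (auto simp: complex_eq_iff)
qed

end

section \<open>Maximal ideals of a unital algebra and their characters\<close>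

locale unital_comm_cstar = comm_cstar A for A :: "'h::complex_hilbert_space oper set" +
  assumes A_id: "id_blinfun \<in> A"
begin

definition op_ideal :: "'h oper set \<Rightarrow> bool" where
  "op_ideal I \<longleftrightarrow> I \<subseteq> A \<and> 0 \<in> I \<and> (\<forall>x\<in>I. \<forall>y\<in>I. x + y \<in> I) \<and> (\<forall>b\<in>A. \<forall>x\<in>I. b o\<^sub>L x \<in> I)"

definition maximal_ideal :: "'h oper set \<Rightarrow> bool" where
  "maximal_ideal M \<longleftrightarrow> op_ideal M \<and> id_blinfun \<notin> M \<and>
     (\<forall>I. op_ideal I \<and> id_blinfun \<notin> I \<and> M \<subseteq> I \<longrightarrow> I = M)"

lemma ex_maximal_ideal:
  assumes J: "op_ideal J" "id_blinfun \<notin> J"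
  obtains M where "maximal_ideal M" "J \<subseteq> M"
proof -
  define S where "S = {I. op_ideal I \<and> id_blinfun \<notin> I \<and> J \<subseteq> I}"
  have "\<exists>M\<in>S. \<forall>X\<in>S. M \<subseteq> X \<longrightarrow> X = M"
  proof (rule subset_Zorn_nonempty)
    show "S \<noteq> {}" using J by (auto simp: S_def)
    fix C assume C: "C \<noteq> {}" "subset.chain S C"
    then have CS: "\<And>X. X \<in> C \<Longrightarrow> X \<in> S" and tot: "\<And>X Y. X \<in> C \<Longrightarrow> Y \<in> C \<Longrightarrow> X \<subseteq> Y \<or> Y \<subseteq> X"
      by (auto simp: subset_chain_def)
    have id: "\<And>X. X \<in> C \<Longrightarrow> op_ideal X" using CS by (auto simp: S_def)
    have "op_ideal (\<Union>C)"
      unfolding op_ideal_def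
    proof (intro conjI ballI)
      show "\<Union>C \<subseteq> A" using id unfolding op_ideal_def by blast
      show "0 \<in> \<Union>C" using id C(1) by (auto simp: op_ideal_def)
      show "b o\<^sub>L x \<in> \<Union>C" if "b \<in> A" "x \<in> \<Union>C" for b x
        using that id unfolding op_ideal_def by blast
      fix x y assume "x \<in> \<Union>C" "y \<in> \<Union>C"
      then obtain X Y where XY: "X \<in> C" "Y \<in> C" "x \<in> X" "y \<in> Y" by blast
      then obtain Z where "Z \<in> C" "x \<in> Z" "y \<in> Z" using tot by blast
      then show "x + y \<in> \<Union>C" using id by (auto simp: op_ideal_def)
    qed
    then show "\<Union>C \<in> S" using CS C(1) by (auto simp: S_def)
  qed
  then obtain M where M: "M \<in> S" "\<And>X. X \<in> S \<Longrightarrow> M \<subseteq> X \<Longrightarrow> X = M" by blast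
  then have "maximal_ideal M" by (auto simp: maximal_ideal_def S_def)
  then show ?thesis using that M(1) by (auto simp: S_def)
qed

context
  fixes M
  assumes M: "maximal_ideal M"
begin

lemma M_sub: "x \<in> M \<Longrightarrow> x \<in> A" and M_zero: "0 \<in> M"
  and M_add: "x \<in> M \<Longrightarrow> y \<in> M \<Longrightarrow> x + y \<in> M"
  and M_compose: "b \<in> A \<Longrightarrow> x \<in> M \<Longrightarrow> b o\<^sub>L x \<in> M"
  and M_id: "id_blinfun \<notin> M"
  using M by (auto simp: maximal_ideal_def op_ideal_def)

lemma M_op_scale: "x \<in> M \<Longrightarrow> op_scale c x \<in> M"
  using M_compose[OF A_op_scale[OF A_id, of c], of x] by (simp add: op_scale_compose_left)

lemma M_scaleR: "x \<in> M \<Longrightarrow> r *\<^sub>R x \<in> M"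
  by (metis M_op_scale op_scale_of_real)

lemma M_diff: "x \<in> M \<Longrightarrow> y \<in> M \<Longrightarrow> x - y \<in> M"
  using M_add[of x "(-1) *\<^sub>R y"] M_scaleR[of y "-1"] by simp

text \<open>An element closer to the identity than one is invertible in A by
  \<open>neumann_series\<close>, and M contains no invertible element.\<close>

lemma M_norm_id_minus:
  assumes m: "m \<in> M"
  shows "1 \<le> norm (id_blinfun - m)"
proof (rule ccontr)
  assume "\<not> ?thesis"
  then obtain b where b: "b \<in> A" "b = id_blinfun + ((id_blinfun - m) o\<^sub>L b)"
    using neumann_series[of "id_blinfun - m" A id_blinfun] A_closed A_id M_sub[OF m] A_intros by auto
  then have "m o\<^sub>L b = id_blinfun"
    by (simp add: bcomp_simps)
  then have "id_blinfun \<in> M" using M_compose[OF b(1) m] A_commute[OF b(1) M_sub[OF m]] by simp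
  then show False using M_id by simp
qed

text \<open>The closure is again an ideal, and by \<open>M_norm_id_minus\<close> the identity stays
  away from it; maximality leaves only M.\<close>

lemma M_closed: "closed M"
proof -
  have cl: "\<exists>u. (\<forall>n. u n \<in> M) \<and> u \<longlonglongrightarrow> x" if "x \<in> closure M" for x
    using that by (simp add: closure_sequential)
  have lim: "l \<in> closure M" if "\<And>n. u n \<in> M" "u \<longlonglongrightarrow> l" for u l
    using that closure_sequential by blast
  have "op_ideal (closure M)"
    unfolding op_ideal_def
  proof (intro conjI ballI)
    show "closure M \<subseteq> A" by (rule closure_minimal) (use M_sub A_closed in auto)
    show "0 \<in> closure M" using M_zero closure_subset by blast
    fix x assume "x \<in> closure M"
    then obtain u where u: "\<And>n. u n \<in> M" "u \<longlonglongrightarrow> x" using cl by blast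
    show "b o\<^sub>L x \<in> closure M" if "b \<in> A" for b
      by (rule lim[of "\<lambda>n. b o\<^sub>L u n"]) (auto intro!: M_compose that u blinfun_compose.tendsto tendsto_const)
    fix y assume "y \<in> closure M"
    then obtain v where v: "\<And>n. v n \<in> M" "v \<longlonglongrightarrow> y" using cl by blast
    show "x + y \<in> closure M"
      by (rule lim[of "\<lambda>n. u n + v n"]) (auto intro!: M_add u v tendsto_add)
  qed
  moreover have "id_blinfun \<notin> closure M"
  proof
    assume "id_blinfun \<in> closure M"
    then obtain u where u: "\<And>n. u n \<in> M" "u \<longlonglongrightarrow> id_blinfun" using cl by blast
    have "(\<lambda>n. norm (id_blinfun - u n)) \<longlonglongrightarrow> norm (id_blinfun - id_blinfun :: 'h oper)"
      by (intro tendsto_intros u)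
    then have "(1::real) \<le> norm (id_blinfun - id_blinfun :: 'h oper)"
      by (rule LIMSEQ_le_const) (use M_norm_id_minus u(1) in blast)
    then show False by simp
  qed
  ultimately have "closure M = M" using M closure_subset unfolding maximal_ideal_def by blast
  then show ?thesis by (metis closed_closure)
qed

text \<open>If x is not in M, the ideal M + A x contains the identity. Multiplying 1 = m + b x by y
  exhibits y as an element of M.\<close>

lemma M_prime:
  assumes xy: "x \<in> A" "y \<in> A" "x o\<^sub>L y \<in> M"
  shows "x \<in> M \<or> y \<in> M"
proof (rule ccontr)
  assume n: "\<not> ?thesis"
  define I where "I = {m + (b o\<^sub>L x) | m b. m \<in> M \<and> b \<in> A}"
  have "op_ideal I"
    unfolding op_ideal_def
  proof (intro conjI ballI)
    show "I \<subseteq> A" using xy M_sub by (auto simp: I_def intro!: A_intros)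
    have "0 = 0 + (0 o\<^sub>L x)" by simp
    then show "0 \<in> I" using M_zero A_zero unfolding I_def by blast
    fix u assume "u \<in> I"
    then obtain m b where u: "u = m + (b o\<^sub>L x)" "m \<in> M" "b \<in> A" by (auto simp: I_def)
    show "c o\<^sub>L u \<in> I" if c: "c \<in> A" for c
    proof -
      have "c o\<^sub>L u = (c o\<^sub>L m) + ((c o\<^sub>L b) o\<^sub>L x)" by (simp add: u bcomp_simps blinfun_compose_assoc)
      then show ?thesis using c u M_compose A_compose unfolding I_def by blast
    qed
    fix v assume "v \<in> I"
    then obtain m' b' where v: "v = m' + (b' o\<^sub>L x)" "m' \<in> M" "b' \<in> A" by (auto simp: I_def)
    have "u + v = (m + m') + ((b + b') o\<^sub>L x)" by (simp add: u v bcomp_simps)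
    then show "u + v \<in> I" using u v M_add A_add unfolding I_def by blast
  qed
  moreover have "M \<subseteq> I"
  proof
    fix m assume "m \<in> M"
    moreover have "m = m + (0 o\<^sub>L x)" by simp
    ultimately show "m \<in> I" using A_zero unfolding I_def by blast
  qed
  moreover have "x \<in> I"
  proof -
    have "x = 0 + (id_blinfun o\<^sub>L x)" by simp
    then show ?thesis using A_id M_zero unfolding I_def by blast
  qed
  ultimately have "id_blinfun \<in> I" using M n unfolding maximal_ideal_def by metis
  then obtain m b where mb: "id_blinfun = m + (b o\<^sub>L x)" "m \<in> M" "b \<in> A" by (auto simp: I_def)
  have "y = (m + (b o\<^sub>L x)) o\<^sub>L y" by (simp add: mb(1)[symmetric])
  also have "\<dots> = (y o\<^sub>L m) + (b o\<^sub>L (x o\<^sub>L y))"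
    using A_commute[OF xy(2) M_sub[OF mb(2)]] by (simp add: bcomp_simps blinfun_compose_assoc)
  also have "\<dots> \<in> M" by (intro M_add M_compose mb xy)
  finally have "y \<in> M" .
  then show False using n by simp
qed

text \<open>The sets of those \<open>c\<close> for which \<open>(x - c)\<^sub>-\<close> or \<open>(x - c)\<^sub>+\<close> lies in \<open>M\<close> are closed and, \<open>M\<close> being
  prime, cover a large interval; by connectedness they meet.\<close>

lemma M_selfadjoint_scalar:
  assumes x: "x \<in> A" "adjoint_op x = x"
  shows "\<exists>c::real. x - c *\<^sub>R id_blinfun \<in> M"
proof -
  \<comment> \<open>The factor 1 / (2 K) makes \<open>y c\<close> a contraction for c in [-K, K];
    the strict inequality norm x < K decides the two endpoints below.\<close>
  define K where "K = norm x + 1"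
  have K: "K > 0" "norm x < K" by (simp_all add: K_def add_nonneg_pos)
  define y where "y c = (1 / (2 * K)) *\<^sub>R (x - c *\<^sub>R id_blinfun)" for c
  define s where "s c = op_abs (y c)" for c
  have yA: "y c \<in> A" for c unfolding y_def by (intro A_intros x A_id)
  have ysa: "adjoint_op (y c) = y c" for c
  proof -
    have "y c = op_scale (of_real (1 / (2 * K))) (x + op_scale (of_real (- c)) id_blinfun)"
      by (simp only: op_scale_of_real y_def) simp
    moreover have "x + op_scale (of_real (- c)) id_blinfun \<in> bounded_operators"
      "op_scale (of_real (- c)) (id_blinfun :: 'h oper) \<in> bounded_operators" "x \<in> bounded_operators"
      by (simp_all add: A_bounded_operators A_intros x A_id del: of_real_minus)
    ultimately show ?thesis
      by (simp only: adjoint_op_op_scale adjoint_op_add x id_blinfun_bounded_operators adjoint_op_id complex_cnj_complex_of_real)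
  qed
  have ynorm: "norm (y c) \<le> 1" if "c \<in> {- K..K}" for c
  proof -
    have "norm (x - c *\<^sub>R id_blinfun) \<le> norm x + \<bar>c\<bar> * norm (id_blinfun :: 'h oper)"
      using norm_triangle_ineq4[of x "c *\<^sub>R id_blinfun"] by simp
    also have "\<dots> \<le> K + K * 1"
      using that K norm_blinfun_id_le[where 'a='h] by (intro add_mono mult_mono) auto
    finally have "norm (x - c *\<^sub>R id_blinfun) / (2 * K) \<le> 1" using K by simp
    moreover have "norm (y c) = norm (x - c *\<^sub>R id_blinfun) / (2 * K)" using K unfolding y_def by simp
    ultimately show ?thesis by simp
  qed
  note ab = yA ysa ynorm
  have sA: "s c \<in> A" if "c \<in> {- K..K}" for c
    unfolding s_def using op_abs_in[OF yA ysa ynorm[OF that]] .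
  have prod: "(s c - y c) o\<^sub>L (s c + y c) = 0" if "c \<in> {- K..K}" for c
    using op_abs_square[OF yA ysa ynorm[OF that]] A_commute[OF sA[OF that] yA[of c]]
    by (simp add: bcomp_simps s_def)
  have cover: "s c - y c \<in> M \<or> s c + y c \<in> M" if "c \<in> {- K..K}" for c
  proof (rule M_prime)
    show "s c - y c \<in> A" "s c + y c \<in> A" using sA[OF that] yA[of c] by (simp_all add: A_add A_diff)
    show "(s c - y c) o\<^sub>L (s c + y c) \<in> M" by (simp only: prod[OF that] M_zero)
  qed
  have cy: "continuous_on {- K..K} y" unfolding y_def by (intro continuous_intros)
  have cs: "continuous_on {- K..K} s"
    unfolding s_def op_abs_def
    by (intro continuous_intros continuous_on_sqrt_lim blinfun_compose.continuous_on cy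
        norm_id_minus_square_le ab) auto
  define L where "L = {c \<in> {- K..K}. s c - y c \<in> M}"
  define U where "U = {c \<in> {- K..K}. s c + y c \<in> M}"
  have "closed L"
    unfolding L_def using continuous_closed_preimage[OF continuous_on_diff[OF cs cy] closed_atLeastAtMost M_closed]
    by (simp add: vimage_def Int_def)
  moreover have "closed U"
    unfolding U_def using continuous_closed_preimage[OF continuous_on_add[OF cs cy] closed_atLeastAtMost M_closed]
    by (simp add: vimage_def Int_def)
  moreover have "{- K..K} \<subseteq> L \<union> U" using cover unfolding L_def U_def by blast
  moreover have "L \<inter> {- K..K} \<noteq> {}" "U \<inter> {- K..K} \<noteq> {}"
  proof -
    \<comment> \<open>Both endpoints at once: P marks c = -K, and the coefficient is 1 there and -1
      at K. Since the chosen multiple of \<open>y c\<close> has half the identity as its scalar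
      part, the scaling by 2/3 leaves a distance to the identity below (2/3) (1 + 1/2) = 1, which
      \<open>M_norm_id_minus\<close> forbids in M.\<close>
    have far: "s c + (2 * of_bool P - 1) *\<^sub>R y c \<notin> M" if P: "c = (if P then - K else K)" for c P
    proof
      assume m: "s c + (2 * of_bool P - 1) *\<^sub>R y c \<in> M"
      have cK: "c \<in> {- K..K}" using that K by auto
      let ?g = "2 * of_bool P - 1 :: real"
      have g: "\<bar>?g\<bar> = 1" by auto
      have "?g *\<^sub>R y c = (1/2) *\<^sub>R id_blinfun + (?g / (2 * K)) *\<^sub>R x"
        using K by (cases P) (simp_all add: that y_def algebra_simps)
      then have "id_blinfun - (2/3) *\<^sub>R (s c + ?g *\<^sub>R y c) = (2/3) *\<^sub>R ((id_blinfun - s c) - (?g / (2 * K)) *\<^sub>R x)"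
      proof -
        assume *: "?g *\<^sub>R y c = (1/2) *\<^sub>R id_blinfun + (?g / (2 * K)) *\<^sub>R x"
        have i: "id_blinfun = (2/3) *\<^sub>R id_blinfun + (1/3) *\<^sub>R (id_blinfun :: 'h oper)"
          by (simp add: scaleR_add_left[symmetric])
        show ?thesis unfolding * by (subst i) (simp add: scaleR_add_right scaleR_diff_right)
      qed
      then have "norm (id_blinfun - (2/3) *\<^sub>R (s c + ?g *\<^sub>R y c)) = (2/3) * norm ((id_blinfun - s c) - (?g / (2 * K)) *\<^sub>R x)"
        by simp
      also have "\<dots> \<le> (2/3) * (norm (id_blinfun - s c) + norm ((?g / (2 * K)) *\<^sub>R x))"
        by (intro mult_left_mono norm_triangle_ineq4) auto
      also have "norm ((?g / (2 * K)) *\<^sub>R x) = norm x / (2 * K)" using g K by (simp add: abs_mult abs_divide)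
      also have "\<dots> < 1/2" using K by (simp add: field_simps)
      also have "norm (id_blinfun - s c) \<le> 1"
        unfolding s_def by (rule norm_id_minus_op_abs[OF yA ysa ynorm[OF cK]])
      finally have "norm (id_blinfun - (2/3) *\<^sub>R (s c + ?g *\<^sub>R y c)) < 1" by simp
      then show False using M_norm_id_minus[OF M_scaleR[OF m, of "2/3"]] by simp
    qed
    have "s (- K) + y (- K) \<notin> M" using far[of "- K" True] by simp
    then have "- K \<in> L" using cover[of "- K"] K by (auto simp: L_def)
    then show "L \<inter> {- K..K} \<noteq> {}" using K by auto
    have "s K - y K \<notin> M" using far[of K False] by simp
    then have "K \<in> U" using cover[of K] K by (auto simp: U_def)
    then show "U \<inter> {- K..K} \<noteq> {}" using K by auto
  qed
  ultimately have "L \<inter> U \<inter> {- K..K} \<noteq> {}"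
    using connected_closed[of "{- K..K}"] connected_Icc by blast
  then obtain c where c: "s c - y c \<in> M" "s c + y c \<in> M" by (auto simp: L_def U_def)
  then have "(s c + y c) - (s c - y c) \<in> M" using M_diff by blast
  then have "K *\<^sub>R ((s c + y c) - (s c - y c)) \<in> M" using M_scaleR by blast
  moreover have "K *\<^sub>R ((s c + y c) - (s c - y c)) = (2 * K) *\<^sub>R y c"
    by (simp add: scaleR_2[symmetric] algebra_simps)
  moreover have "\<dots> = x - c *\<^sub>R id_blinfun" using K by (simp add: y_def)
  ultimately show ?thesis by metis
qed

text \<open>The quotient by M consists of scalars. Existence reduces to real and imaginary parts;
  two different scalars would put a nonzero multiple of the identity into M.\<close>

lemma M_scalar:
  assumes a: "a \<in> A"
  shows "\<exists>!c. a - op_scale c id_blinfun \<in> M"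
proof -
  obtain x y where xy: "x \<in> A" "y \<in> A" "adjoint_op x = x" "adjoint_op y = y" "a = x + op_scale \<i> y"
    using cartesian_decomposition[OF a] by metis
  obtain c d :: real where cd: "x - c *\<^sub>R id_blinfun \<in> M" "y - d *\<^sub>R id_blinfun \<in> M"
    using M_selfadjoint_scalar xy by metis
  have "a - op_scale (of_real c + \<i> * of_real d) id_blinfun
      = (x - c *\<^sub>R id_blinfun) + op_scale \<i> (y - d *\<^sub>R id_blinfun)"
  proof -
    have "op_scale \<i> (y - d *\<^sub>R id_blinfun) = op_scale \<i> y - op_scale \<i> (op_scale (of_real d) id_blinfun)"
      using op_scale_add_right[of \<i> "y - d *\<^sub>R id_blinfun" "d *\<^sub>R id_blinfun"]
      by (simp add: op_scale_of_real[of d] eq_diff_eq)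
    then have "op_scale \<i> (y - d *\<^sub>R id_blinfun) = op_scale \<i> y - op_scale (\<i> * of_real d) id_blinfun"
      by (simp only: op_scale_op_scale)
    then show ?thesis
      by (simp add: xy(5) op_scale_add_left op_scale_op_scale) (simp add: op_scale_of_real)
  qed
  then have ex: "a - op_scale (of_real c + \<i> * of_real d) id_blinfun \<in> M"
    using M_add M_op_scale cd by simp
  have "c1 = c2" if "a - op_scale c1 id_blinfun \<in> M" "a - op_scale c2 id_blinfun \<in> M" for c1 c2
  proof (rule ccontr)
    assume ne: "c1 \<noteq> c2"
    have "(a - op_scale c2 id_blinfun) - (a - op_scale c1 id_blinfun) \<in> M" using that M_diff by blast
    moreover have "(a - op_scale c2 id_blinfun) - (a - op_scale c1 id_blinfun) = op_scale (c1 - c2) id_blinfun"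
      using op_scale_add_left[of "c1 - c2" c2 id_blinfun] by (simp add: algebra_simps)
    ultimately have "op_scale (inverse (c1 - c2)) (op_scale (c1 - c2) id_blinfun) \<in> M" using M_op_scale by metis
    then show False using ne M_id by (simp add: op_scale_op_scale)
  qed
  then show ?thesis using ex by blast
qed

lemma maximal_ideal_character:
  obtains \<theta> where "\<theta> \<in> chars" "\<And>a. a \<in> A \<Longrightarrow> a - op_scale (\<theta> a) id_blinfun \<in> M"
proof -
  define \<theta> where "\<theta> = (\<lambda>a\<in>A. THE c. a - op_scale c id_blinfun \<in> M)"
  have th: "a - op_scale (\<theta> a) id_blinfun \<in> M" if "a \<in> A" for a
    using theI'[OF M_scalar[OF that]] that by (simp add: \<theta>_def)
  have eqI: "\<theta> a = c" if "a \<in> A" "a - op_scale c id_blinfun \<in> M" for a c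
    using M_scalar th that by blast
  have "\<theta> (S + T) = \<theta> S + \<theta> T" if "S \<in> A" "T \<in> A" for S T
  proof (rule eqI)
    have "(S + T) - op_scale (\<theta> S + \<theta> T) id_blinfun
        = (S - op_scale (\<theta> S) id_blinfun) + (T - op_scale (\<theta> T) id_blinfun)"
      by (simp add: op_scale_add_left)
    then show "(S + T) - op_scale (\<theta> S + \<theta> T) id_blinfun \<in> M"
      using M_add[OF th[OF that(1)] th[OF that(2)]] by (simp only:)
  qed (use that A_add in blast)
  moreover have diff: "op_scale c (S - T) = op_scale c S - op_scale c T" for c and S T :: "'h oper"
    using op_scale_add_right[of c "S - T" T] by (simp add: eq_diff_eq)
  have "\<theta> (op_scale c T) = c * \<theta> T" if "T \<in> A" for c T
  proof (rule eqI)
    have "op_scale c T - op_scale (c * \<theta> T) id_blinfun = op_scale c (T - op_scale (\<theta> T) id_blinfun)"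
      by (simp add: diff op_scale_op_scale)
    then show "op_scale c T - op_scale (c * \<theta> T) id_blinfun \<in> M" using M_op_scale th that by simp
  qed (use that A_op_scale in blast)
  moreover have "\<theta> (S o\<^sub>L T) = \<theta> S * \<theta> T" if "S \<in> A" "T \<in> A" for S T
  proof (rule eqI)
    have "(S o\<^sub>L T) - op_scale (\<theta> S * \<theta> T) id_blinfun
        = (S o\<^sub>L (T - op_scale (\<theta> T) id_blinfun)) + op_scale (\<theta> T) (S - op_scale (\<theta> S) id_blinfun)"
      using that by (simp add: bcomp_simps diff op_scale_op_scale op_scale_compose_right A_bounded_operators mult.commute)
    then show "(S o\<^sub>L T) - op_scale (\<theta> S * \<theta> T) id_blinfun \<in> M"
      using M_add M_compose M_op_scale th that by simp
  qed (use that A_compose in blast)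
  moreover have "\<theta> id_blinfun = 1" by (rule eqI) (auto simp: A_id M_zero)
  ultimately have "\<theta> \<in> chars"
    using A_id unfolding chars_def characters_def linear_functional_def
    by (auto simp: \<theta>_def intro!: bexI[of _ id_blinfun])
  then show ?thesis using that th by blast
qed

end

text \<open>With N = \<open>(norm a)\<^sup>2\<close> and p the product of the adjoint of a with a,
  the element N - p is not invertible: an inverse would bound \<open>(norm (a v))\<^sup>2\<close> by
  a constant smaller than N for unit vectors v. So N - p lies in a maximal ideal, whose character
  sends p to N.\<close>

lemma ex_character_norm:
  assumes a: "a \<in> A" "a \<noteq> 0"
  obtains \<theta> where "\<theta> \<in> chars" "\<theta> (adjoint_op a o\<^sub>L a) = of_real ((norm a)\<^sup>2)"
proof -
  define p where "p = adjoint_op a o\<^sub>L a"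
  define N where "N = (norm a)\<^sup>2"
  have pA: "p \<in> A" using a by (auto simp: p_def intro!: A_intros)
  have pN: "norm p = N" unfolding p_def N_def by (rule norm_adjoint_op_compose[OF A_bounded_operators[OF a(1)]])
  have N0: "N > 0" using a by (simp add: N_def)
  define J where "J = {b o\<^sub>L (N *\<^sub>R id_blinfun - p) | b. b \<in> A}"
  have J1: "op_ideal J"
    unfolding op_ideal_def
  proof (intro conjI ballI)
    show "J \<subseteq> A" using pA A_id by (auto simp: J_def intro!: A_intros)
    have "0 = 0 o\<^sub>L (N *\<^sub>R id_blinfun - p)" by simp
    then show "0 \<in> J" using A_zero unfolding J_def by blast
    fix x assume "x \<in> J"
    then obtain b where x: "x = b o\<^sub>L (N *\<^sub>R id_blinfun - p)" "b \<in> A" by (auto simp: J_def)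
    show "c o\<^sub>L x \<in> J" if "c \<in> A" for c
      using x A_compose[OF that x(2)] unfolding J_def by (auto simp: blinfun_compose_assoc[symmetric])
    fix y assume "y \<in> J"
    then obtain b' where y: "y = b' o\<^sub>L (N *\<^sub>R id_blinfun - p)" "b' \<in> A" by (auto simp: J_def)
    have "x + y = (b + b') o\<^sub>L (N *\<^sub>R id_blinfun - p)" by (simp add: x y blinfun_compose.add_left)
    then show "x + y \<in> J" using A_add x y unfolding J_def by blast
  qed
  have "id_blinfun \<notin> J"
  proof
    assume "id_blinfun \<in> J"
    then obtain b where b: "id_blinfun = b o\<^sub>L (N *\<^sub>R id_blinfun - p)" "b \<in> A" by (auto simp: J_def)
    have low: "(norm v)\<^sup>2 \<le> (norm b)\<^sup>2 * (2 * N * (N * (norm v)\<^sup>2 - (norm (blinfun_apply a v))\<^sup>2))" for v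
    proof -
      let ?w = "N *\<^sub>R v - blinfun_apply p v"
      have "blinfun_apply id_blinfun v = blinfun_apply b ?w"
        using b(1) by (metis blinfun_apply_blinfun_compose blinfun.diff_left blinfun.scaleR_left blinfun_apply_id_blinfun id_apply)
      then have "norm v \<le> norm b * norm ?w" using norm_blinfun[of b ?w] by simp
      then have "(norm v)\<^sup>2 \<le> (norm b * norm ?w)\<^sup>2" by (intro power_mono) auto
      also have "\<dots> = (norm b)\<^sup>2 * (norm ?w)\<^sup>2" by (simp add: power_mult_distrib)
      finally have 1: "(norm v)\<^sup>2 \<le> (norm b)\<^sup>2 * (norm ?w)\<^sup>2" .
      have "cinner v (blinfun_apply p v) = of_real ((norm (blinfun_apply a v))\<^sup>2)"
        using adjoint_op_left[OF A_bounded_operators[OF a(1)], of v "blinfun_apply a v"]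
        by (simp add: p_def cinner_self)
      then have "(norm ?w)\<^sup>2 = N\<^sup>2 * (norm v)\<^sup>2 - 2 * N * (norm (blinfun_apply a v))\<^sup>2 + (norm (blinfun_apply p v))\<^sup>2"
        by (simp add: norm_diff_sq cinner_simps power_mult_distrib del: of_real_power)
      also have "(norm (blinfun_apply p v))\<^sup>2 \<le> (N * norm v)\<^sup>2"
        using norm_blinfun[of p v] by (intro power_mono) (auto simp: pN)
      finally have "(norm ?w)\<^sup>2 \<le> 2 * N * (N * (norm v)\<^sup>2 - (norm (blinfun_apply a v))\<^sup>2)"
        by (simp add: power2_eq_square algebra_simps)
      from order_trans[OF 1 mult_left_mono[OF this zero_le_power2]] show ?thesis .
    qed
    have b0: "norm b > 0"
    proof (rule ccontr)
      assume "\<not> ?thesis"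
      then have "id_blinfun = (0 :: 'h oper)" using b(1) by simp
      then have "a = 0" using blinfun_compose_id(1)[of a] by simp
      then show False using a(2) by simp
    qed
    \<comment> \<open>Dividing \<open>low\<close> by its coefficient isolates
      \<open>(norm (a v))\<^sup>2\<close>; d is the resulting gap below N.\<close>
    define d where "d = 1 / ((norm b)\<^sup>2 * (2 * N))"
    have d: "d > 0" using b0 N0 by (simp add: d_def)
    have up: "(norm (blinfun_apply a v))\<^sup>2 \<le> (N - d) * (norm v)\<^sup>2" for v
    proof -
      have "(norm v)\<^sup>2 * d \<le> ((norm b)\<^sup>2 * (2 * N) * (N * (norm v)\<^sup>2 - (norm (blinfun_apply a v))\<^sup>2)) * d"
        using low[of v] d by (intro mult_right_mono) (simp_all only: mult.assoc less_imp_le)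
      also have "\<dots> = N * (norm v)\<^sup>2 - (norm (blinfun_apply a v))\<^sup>2"
        using b0 N0 by (simp add: d_def)
      finally show ?thesis by (simp add: algebra_simps)
    qed
    \<comment> \<open>The maximum covers the case d > N, since an operator bound has to be
      nonnegative.\<close>
    have "norm a \<le> sqrt (max 0 (N - d))"
    proof (rule norm_blinfun_bound)
      fix v
      have "(norm (blinfun_apply a v))\<^sup>2 \<le> max 0 (N - d) * (norm v)\<^sup>2"
        by (rule order_trans[OF up]) (intro mult_right_mono, auto)
      also have "\<dots> = (sqrt (max 0 (N - d)) * norm v)\<^sup>2" by (simp add: power_mult_distrib)
      finally show "norm (blinfun_apply a v) \<le> sqrt (max 0 (N - d)) * norm v" by (rule power2_le_imp_le) simp
    qed simp
    then have "(norm a)\<^sup>2 \<le> (sqrt (max 0 (N - d)))\<^sup>2" by (intro power_mono) auto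
    then have "N \<le> max 0 (N - d)" by (simp add: N_def)
    then show False using N0 d by simp
  qed
  then obtain M where M: "maximal_ideal M" "J \<subseteq> M" using ex_maximal_ideal J1 by blast
  obtain \<theta> where th: "\<theta> \<in> chars" "\<And>a. a \<in> A \<Longrightarrow> a - op_scale (\<theta> a) id_blinfun \<in> M"
    using maximal_ideal_character[OF M(1)] by blast
  have "id_blinfun o\<^sub>L (N *\<^sub>R id_blinfun - p) \<in> J" using A_id unfolding J_def by blast
  then have "N *\<^sub>R id_blinfun - p \<in> M" using M(2) by auto
  from M_scaleR[OF M(1) this, of "-1"] have "p - op_scale (of_real N) id_blinfun \<in> M" by (simp add: op_scale_of_real)
  then have "\<theta> p = of_real N" using M_scalar[OF M(1) pA] th(2)[OF pA] by blast
  then show ?thesis using that th(1) by (simp add: p_def N_def)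
qed

end

section \<open>The bicommutant and the isometry of the Gelfand transform\<close>

text \<open>The bicommutant is a commutative C*-algebra that contains both the identity and \<open>A\<close>; it plays the
  role of the unitization.\<close>

context comm_cstar
begin

definition commutant :: "'h oper set" where
  "commutant = {S \<in> bounded_operators. \<forall>a\<in>A. S o\<^sub>L a = a o\<^sub>L S}"

definition bicommutant :: "'h oper set" where
  "bicommutant = {T \<in> bounded_operators. \<forall>S\<in>commutant. T o\<^sub>L S = S o\<^sub>L T}"

lemma commutant_adjoint:
  assumes S: "S \<in> commutant"
  shows "adjoint_op S \<in> commutant"
proof -
  have Sb: "S \<in> bounded_operators" using S by (simp add: commutant_def)
  have "adjoint_op S o\<^sub>L a = a o\<^sub>L adjoint_op S" if a: "a \<in> A" for a
  proof -
    have "S o\<^sub>L adjoint_op a = adjoint_op a o\<^sub>L S" using S A_adjoint[OF a] by (simp add: commutant_def)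
    then have "adjoint_op (S o\<^sub>L adjoint_op a) = adjoint_op (adjoint_op a o\<^sub>L S)" by simp
    then show ?thesis
      using Sb a A_bounded_operators A_adjoint by (simp add: adjoint_op_compose adjoint_op_adjoint_op)
  qed
  then show ?thesis using adjoint_op_bounded_operators[OF Sb] by (simp add: commutant_def)
qed

lemma closed_bounded_operators: "closed (bounded_operators :: 'h oper set)"
proof -
  have cont: "continuous_on UNIV (\<lambda>T::'h oper. c *\<^sub>C blinfun_apply T x)" for c x
    by (intro bounded_linear.continuous_on[OF bounded_linear_scaleC] continuous_intros)
  have "bounded_operators = (\<Inter>c. \<Inter>x. {T::'h oper. blinfun_apply T (c *\<^sub>C x) = c *\<^sub>C blinfun_apply T x})"
    by (auto simp: bounded_operators_def)
  also have "closed \<dots>"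
    by (intro closed_INT ballI closed_Collect_eq cont continuous_intros)
  finally show ?thesis .
qed

lemma A_subset_commutant: "A \<subseteq> commutant"
  using A_bounded_operators A_commute by (auto simp: commutant_def)

lemma A_subset_bicommutant: "A \<subseteq> bicommutant"
  using A_bounded_operators by (auto simp: bicommutant_def commutant_def)

lemma bicommutant_unital_comm_cstar: "unital_comm_cstar bicommutant"
proof
  note bo_defs = bounded_operators_def
  show "cstar_subalgebra bicommutant"
    unfolding cstar_subalgebra_def
  proof (intro conjI ballI allI)
    show "bicommutant \<subseteq> bounded_operators" by (auto simp: bicommutant_def)
    show "0 \<in> bicommutant" by (auto simp: bicommutant_def bo_defs)
    fix S T assume S: "S \<in> bicommutant"
    show "op_scale c S \<in> bicommutant" for c
      using S unfolding bicommutant_def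
      by (auto simp: op_scale_compose_left op_scale_compose_right commutant_def bo_defs op_scale_apply scaleC_scaleC mult.commute)
    show "adjoint_op S \<in> bicommutant"
      unfolding bicommutant_def
    proof safe
      have Sb: "S \<in> bounded_operators" using S by (simp add: bicommutant_def)
      show "adjoint_op S \<in> bounded_operators" by (rule adjoint_op_bounded_operators[OF Sb])
      fix R assume R: "R \<in> commutant"
      have Rb: "R \<in> bounded_operators" using R by (simp add: commutant_def)
      have "S o\<^sub>L adjoint_op R = adjoint_op R o\<^sub>L S" using S commutant_adjoint[OF R] by (simp add: bicommutant_def)
      then have "adjoint_op (S o\<^sub>L adjoint_op R) = adjoint_op (adjoint_op R o\<^sub>L S)" by simp
      moreover have "adjoint_op (S o\<^sub>L adjoint_op R) = R o\<^sub>L adjoint_op S"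
        "adjoint_op (adjoint_op R o\<^sub>L S) = adjoint_op S o\<^sub>L R"
        by (simp_all add: adjoint_op_compose adjoint_op_adjoint_op adjoint_op_bounded_operators Sb Rb)
      ultimately show "adjoint_op S o\<^sub>L R = R o\<^sub>L adjoint_op S" by simp
    qed
    assume T: "T \<in> bicommutant"
    show "S + T \<in> bicommutant"
      using S T by (auto simp: bicommutant_def bo_defs bcomp_simps blinfun.add_left scaleC_add_right)
    have "(S o\<^sub>L T) o\<^sub>L R = R o\<^sub>L (S o\<^sub>L T)" if "R \<in> commutant" for R
    proof -
      have "T o\<^sub>L R = R o\<^sub>L T" "S o\<^sub>L R = R o\<^sub>L S" using S T that by (auto simp: bicommutant_def)
      then show ?thesis by (metis blinfun_compose_assoc)
    qed
    then show "S o\<^sub>L T \<in> bicommutant"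
      using S T by (auto simp: bicommutant_def bo_defs)
  next
    have "bicommutant = bounded_operators \<inter> (\<Inter>R\<in>commutant. {T. T o\<^sub>L R = R o\<^sub>L T})"
      by (auto simp: bicommutant_def)
    also have "closed \<dots>"
      by (intro closed_Int closed_bounded_operators closed_INT ballI closed_Collect_eq
          blinfun_compose.continuous_on continuous_intros)
    finally show "closed bicommutant" .
  qed
  show "commutative_algebra bicommutant"
    unfolding commutative_algebra_def
  proof (intro ballI)
    fix S T assume ST: "S \<in> bicommutant" "T \<in> bicommutant"
    then have "T \<in> commutant" using A_subset_commutant unfolding bicommutant_def commutant_def by fastforce
    then show "S o\<^sub>L T = T o\<^sub>L S" using ST(1) by (simp add: bicommutant_def)
  qed
  show "id_blinfun \<in> bicommutant"
    by (simp add: bicommutant_def id_blinfun_bounded_operators)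
qed

text \<open>A character of the bicommutant that attains the norm of a is restricted to A; its value
  on the positive square of a keeps the restriction nonzero. In this form the isometry turns norm
  estimates and identities in A into statements about numbers.\<close>

theorem norm_le_of_characters:
  assumes a: "a \<in> A" and r: "r \<ge> 0" and bound: "\<And>\<theta>. \<theta> \<in> chars \<Longrightarrow> cmod (\<theta> a) \<le> r"
  shows "norm a \<le> r"
proof (cases "a = 0")
  case False
  interpret B: unital_comm_cstar bicommutant by (rule bicommutant_unital_comm_cstar)
  have aB: "a \<in> bicommutant" using a A_subset_bicommutant by blast
  obtain \<theta> where th: "\<theta> \<in> B.chars" "\<theta> (adjoint_op a o\<^sub>L a) = of_real ((norm a)\<^sup>2)"
    using B.ex_character_norm[OF aB False] by blast
  define \<eta> where "\<eta> = restrict \<theta> A"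
  have "\<eta> (adjoint_op a o\<^sub>L a) = of_real ((norm a)\<^sup>2)" using th a by (simp add: \<eta>_def A_intros)
  moreover have "\<eta> \<in> chars"
    unfolding chars_def characters_def linear_functional_def
  proof (intro CollectI conjI ballI allI)
    show "\<exists>T\<in>A. \<eta> T \<noteq> 0"
      using False th(2) a by (intro bexI[of _ "adjoint_op a o\<^sub>L a"]) (auto simp: \<eta>_def A_intros)
  qed (use A_subset_bicommutant th(1) in \<open>auto simp: \<eta>_def A_intros B.chi_add B.chi_op_scale B.chi_compose subset_iff\<close>)
  ultimately have "complex_of_real ((norm a)\<^sup>2) = of_real ((cmod (\<eta> a))\<^sup>2)" "cmod (\<eta> a) \<le> r"
    using chi_adjoint_compose[of \<eta> a] a bound by auto
  then have "(norm a)\<^sup>2 = (cmod (\<eta> a))\<^sup>2" using of_real_eq_iff by blast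
  then show ?thesis using \<open>cmod (\<eta> a) \<le> r\<close> by simp
qed (use r in simp)

lemma eq_of_characters:
  assumes "a \<in> A" "b \<in> A" "\<And>\<theta>. \<theta> \<in> chars \<Longrightarrow> \<theta> a = \<theta> b"
  shows "a = b"
  using norm_le_of_characters[of "a - b" 0] assms A_diff by (simp add: chi_diff)

end

section \<open>The topology of the spectrum\<close>

lemma closedin_Collect_ball:
  assumes "\<And>i. i \<in> I \<Longrightarrow> closedin X {x \<in> topspace X. P i x}"
  shows "closedin X {x \<in> topspace X. \<forall>i\<in>I. P i x}"
proof (cases "I = {}")
  case False
  then have "{x \<in> topspace X. \<forall>i\<in>I. P i x} = \<Inter>((\<lambda>i. {x \<in> topspace X. P i x}) ` I)" by auto
  then show ?thesis using False assms by (auto intro!: closedin_Inter)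
qed simp

lemma closedin_Collect_conj:
  assumes "closedin X {x \<in> topspace X. P x}" "closedin X {x \<in> topspace X. Q x}"
  shows "closedin X {x \<in> topspace X. P x \<and> Q x}"
proof -
  have "{x \<in> topspace X. P x \<and> Q x} = {x \<in> topspace X. P x} \<inter> {x \<in> topspace X. Q x}" by auto
  then show ?thesis using closedin_Int[OF assms] by simp
qed

lemma continuous_map_mult_field:
  fixes f g :: "'a \<Rightarrow> 'b::real_normed_field"
  shows "continuous_map X euclidean f \<Longrightarrow> continuous_map X euclidean g \<Longrightarrow>
    continuous_map X euclidean (\<lambda>x. f x * g x)"
  by (simp add: continuous_map_atin tendsto_mult)

lemma continuous_map_Re: "continuous_map X euclidean f \<Longrightarrow> continuous_map X euclideanreal (\<lambda>x. Re (f x))"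
  by (simp add: continuous_map_atin tendsto_Re)

context comm_cstar
begin

lemma topspace_spectrum [simp]: "topspace (spectrum A) = chars"
  by (auto simp: spectrum_def chars_def characters_def PiE_def)

lemma continuous_map_eval: "T \<in> A \<Longrightarrow> continuous_map (spectrum A) euclidean (\<lambda>\<theta>. \<theta> T)"
  unfolding spectrum_def by (intro continuous_map_from_subtopology continuous_map_product_projection)

lemma continuous_map_cmod_eval: "T \<in> A \<Longrightarrow> continuous_map (spectrum A) euclideanreal (\<lambda>\<theta>. cmod (\<theta> T))"
  by (intro continuous_map_norm continuous_map_eval)

lemma Hausdorff_space_spectrum: "Hausdorff_space (spectrum A)"
  unfolding spectrum_def by (intro Hausdorff_space_subtopology) (simp add: Hausdorff_space_product_topology)

lemma openin_cmod_greater: "T \<in> A \<Longrightarrow> openin (spectrum A) {\<theta> \<in> chars. e < cmod (\<theta> T)}"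
  using openin_continuous_map_preimage[OF continuous_map_cmod_eval, of T "{e<..}"] by simp

text \<open>Tychonoff in a product of discs. Additivity, homogeneity and multiplicativity are closed
  conditions, but being nonzero is not; the closed condition e \<le> |\<theta> T| takes its
  place.\<close>

lemma compactin_cmod_ge:
  assumes T: "T \<in> A" and e: "0 < e"
  shows "compactin (spectrum A) {\<theta> \<in> chars. e \<le> cmod (\<theta> T)}"
proof -
  let ?P = "product_topology (\<lambda>_. euclidean) A :: ('h oper \<Rightarrow> complex) topology"
  let ?K = "PiE A (\<lambda>S. cball 0 (norm S))"
  have ev: "continuous_map ?P euclidean (\<lambda>\<theta>. \<theta> S)" if "S \<in> A" for S
    using that by (intro continuous_map_product_projection)
  have K: "compactin ?P ?K" by (auto simp: compactin_PiE)
  let ?Q = "\<lambda>\<theta>::'h oper \<Rightarrow> complex. (\<forall>S\<in>A. \<forall>T\<in>A. \<theta> (S + T) = \<theta> S + \<theta> T) \<and> (\<forall>c\<in>UNIV. \<forall>T\<in>A. \<theta> (op_scale c T) = c * \<theta> T)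
     \<and> (\<forall>S\<in>A. \<forall>T\<in>A. \<theta> (S o\<^sub>L T) = \<theta> S * \<theta> T) \<and> e \<le> cmod (\<theta> T)"
  have "closedin ?P {\<theta> \<in> topspace ?P. ?Q \<theta>}"
  proof (intro closedin_Collect_conj closedin_Collect_ball)
    show "closedin ?P {\<theta> \<in> topspace ?P. e \<le> cmod (\<theta> T)}"
      using closedin_continuous_map_preimage[OF continuous_map_norm[OF ev[OF T]], of "{e..}"] by simp
  qed (intro closedin_continuous_maps_eq[OF Hausdorff_space_euclidean] continuous_map_add
       continuous_map_mult_field ev A_intros continuous_map_const[THEN iffD2] disjI2; simp)+
  then have "compactin ?P (?K \<inter> {\<theta> \<in> topspace ?P. ?Q \<theta>})" by (rule compact_Int_closedin[OF K])
  also have "?K \<inter> {\<theta> \<in> topspace ?P. ?Q \<theta>} = {\<theta> \<in> chars. e \<le> cmod (\<theta> T)}"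
  proof (intro equalityI subsetI)
    fix \<theta> assume "\<theta> \<in> ?K \<inter> {\<theta> \<in> topspace ?P. ?Q \<theta>}"
    then have "\<theta> \<in> extensional A" "?Q \<theta>" by (auto simp: PiE_def)
    moreover from this have "\<exists>T\<in>A. \<theta> T \<noteq> 0" using e T by (intro bexI[of _ T]) auto
    ultimately show "\<theta> \<in> {\<theta> \<in> chars. e \<le> cmod (\<theta> T)}"
      by (auto simp: chars_def characters_def linear_functional_def)
  next
    fix \<theta> assume th: "\<theta> \<in> {\<theta> \<in> chars. e \<le> cmod (\<theta> T)}"
    then have "\<theta> \<in> extensional A" "?Q \<theta>"
      by (auto simp: chars_def characters_def linear_functional_def)
    moreover have "\<theta> \<in> ?K" using th cmod_chi_le by (auto simp: chars_def characters_def PiE_def)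
    ultimately show "\<theta> \<in> ?K \<inter> {\<theta> \<in> topspace ?P. ?Q \<theta>}" by (auto simp: PiE_def)
  qed
  finally show ?thesis
    unfolding spectrum_def compactin_subtopology by (auto simp: chars_def)
qed

lemma selfadjoint_of_real_values:
  assumes a: "a \<in> A" "\<And>\<theta>. \<theta> \<in> chars \<Longrightarrow> Im (\<theta> a) = 0"
  shows "adjoint_op a = a"
  by (rule eq_of_characters) (use assms in \<open>auto simp: A_intros chi_adjoint complex_eq_iff\<close>)

lemma ex_chi_eq_one:
  assumes "\<theta> \<in> chars"
  obtains T where "T \<in> A" "\<theta> T = 1"
proof -
  obtain a where a: "a \<in> A" "\<theta> a \<noteq> 0" using chi_nonzero[OF assms] by blast
  show ?thesis
    by (rule that[of "op_scale (inverse (\<theta> a)) a"]) (use a assms in \<open>auto simp: A_intros chi_simps\<close>)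
qed

text \<open>A substitute for Urysohn functions. On a basic neighbourhood given by finitely many
  coordinates, \<epsilon>^2 minus the sum of squared deviations is positive at \<theta> and at most
  zero outside; b is a multiple of its positive part, cut down by a factor that keeps it in
  A.\<close>

lemma spectrum_regular:
  assumes U: "openin (spectrum A) U" and th: "\<theta> \<in> U"
  obtains b where "b \<in> A" "\<theta> b \<noteq> 0" "\<And>\<eta>. \<eta> \<in> chars \<Longrightarrow> \<eta> \<notin> U \<Longrightarrow> \<eta> b = 0"
proof -
  have thc: "\<theta> \<in> chars" using openin_subset[OF U] th by auto
  obtain W where W: "openin (product_topology (\<lambda>_. euclidean) A) W" "U = W \<inter> chars"
    using U unfolding spectrum_def openin_subtopology chars_def by blast
  then obtain V where V: "finite {i \<in> A. V i \<noteq> UNIV}" "\<And>i. i \<in> A \<Longrightarrow> open (V i)"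
    "\<theta> \<in> PiE A V" "PiE A V \<subseteq> W"
    using th by (force simp: openin_product_topology_alt)
  define F where "F = {i \<in> A. V i \<noteq> UNIV}"
  have F: "finite F" "F \<subseteq> A" using V(1) by (auto simp: F_def)
  have "\<exists>\<epsilon>>0. ball (\<theta> i) \<epsilon> \<subseteq> V i" if "i \<in> F" for i
    using that V(2)[of i] V(3) by (auto simp: F_def open_contains_ball PiE_def Pi_def)
  then obtain ep where ep: "\<And>i. i \<in> F \<Longrightarrow> ep i > 0 \<and> ball (\<theta> i) (ep i) \<subseteq> V i" by metis
  \<comment> \<open>Inserting 1 provides a minimum when there are no coordinates to
    restrict.\<close>
  define \<epsilon> where "\<epsilon> = Min (insert 1 (ep ` F))"
  have eps: "\<epsilon> > 0" "\<And>i. i \<in> F \<Longrightarrow> \<epsilon> \<le> ep i" using F ep by (auto simp: \<epsilon>_def)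
  obtain T where T: "T \<in> A" "\<theta> T = 1" using ex_chi_eq_one[OF thc] by blast
  \<comment> \<open>T stands in for the constant function one: after multiplication by T the
    deviation from \<theta> i belongs to A.\<close>
  define c where "c i = (i o\<^sub>L T) - op_scale (\<theta> i) T" for i
  have cA: "c i \<in> A" if "i \<in> F" for i using that F T by (auto simp: c_def intro!: A_intros)
  define D where "D = \<epsilon>\<^sup>2 *\<^sub>R (adjoint_op T o\<^sub>L T) - (\<Sum>i\<in>F. adjoint_op (c i) o\<^sub>L c i)"
  have DA: "D \<in> A" unfolding D_def by (intro A_intros T cA)
  have Dchi: "\<eta> D = of_real ((cmod (\<eta> T))\<^sup>2 * (\<epsilon>\<^sup>2 - (\<Sum>i\<in>F. (cmod (\<eta> i - \<theta> i))\<^sup>2)))" if "\<eta> \<in> chars" for \<eta>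
  proof -
    have "\<eta> (c i) = (\<eta> i - \<theta> i) * \<eta> T" if "i \<in> F" for i
      using that F T \<open>\<eta> \<in> chars\<close> by (auto simp: c_def chi_simps A_intros subset_iff algebra_simps)
    then have "\<eta> (adjoint_op (c i) o\<^sub>L c i) = of_real ((cmod (\<eta> T))\<^sup>2 * (cmod (\<eta> i - \<theta> i))\<^sup>2)" if "i \<in> F" for i
      using that \<open>\<eta> \<in> chars\<close> cA by (simp add: chi_adjoint_compose norm_mult power_mult_distrib mult.commute)
    then have "\<eta> (\<Sum>i\<in>F. adjoint_op (c i) o\<^sub>L c i) = (\<Sum>i\<in>F. of_real ((cmod (\<eta> T))\<^sup>2 * (cmod (\<eta> i - \<theta> i))\<^sup>2))"
      by (subst chi_sum[OF that]) (auto intro!: A_intros cA)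
    then show ?thesis
      unfolding D_def using that T cA
      by (simp add: chi_diff chi_scaleR chi_adjoint_compose A_intros right_diff_distrib sum_distrib_left mult.commute)
  qed
  define y where "y = (1 / (norm D + 1)) *\<^sub>R D"
  have yA: "y \<in> A" unfolding y_def by (intro A_intros DA)
  have ychi: "\<eta> y = of_real ((cmod (\<eta> T))\<^sup>2 * (\<epsilon>\<^sup>2 - (\<Sum>i\<in>F. (cmod (\<eta> i - \<theta> i))\<^sup>2)) / (norm D + 1))" if "\<eta> \<in> chars" for \<eta>
    unfolding y_def using that DA by (simp add: chi_scaleR Dchi)
  have ysa: "adjoint_op y = y" by (intro selfadjoint_of_real_values yA) (simp only: ychi Im_complex_of_real)
  have yn: "norm y \<le> 1" by (simp add: y_def divide_le_eq add_nonneg_pos)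
  show ?thesis
  proof
    \<comment> \<open>The sum |y| + y is twice the positive part of y.\<close>
    show bA: "op_abs y + y \<in> A" using op_abs_in[OF yA ysa yn] yA by (rule A_add)
    have bchi: "\<eta> (op_abs y + y) = of_real \<bar>Re (\<eta> y)\<bar> + \<eta> y" if "\<eta> \<in> chars" for \<eta>
      using chi_op_abs[OF that yA ysa yn] chi_add[OF that op_abs_in[OF yA ysa yn] yA] by simp
    have "\<theta> y = of_real (\<epsilon>\<^sup>2 / (norm D + 1))" using ychi[OF thc] T by simp
    moreover have "0 < \<epsilon>\<^sup>2 / (norm D + 1)" using eps by (intro divide_pos_pos) (auto intro: add_nonneg_pos)
    ultimately show "\<theta> (op_abs y + y) \<noteq> 0" using bchi[OF thc] eps(1) by (auto simp: complex_eq_iff)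
    fix \<eta> assume e: "\<eta> \<in> chars" "\<eta> \<notin> U"
    then have "\<eta> \<notin> PiE A V" using V(4) W(2) by blast
    then obtain i where i: "i \<in> F" "\<eta> i \<notin> V i"
      using e(1) by (auto simp: PiE_def F_def chars_def characters_def)
    then have "\<epsilon> \<le> cmod (\<eta> i - \<theta> i)" using ep[OF i(1)] eps(2)[OF i(1)] by (force simp: dist_norm norm_minus_commute)
    then have "\<epsilon>\<^sup>2 \<le> (cmod (\<eta> i - \<theta> i))\<^sup>2" using eps(1) by (intro power_mono) auto
    also have "\<dots> \<le> (\<Sum>i\<in>F. (cmod (\<eta> i - \<theta> i))\<^sup>2)" using i F by (intro member_le_sum) auto
    finally have "(cmod (\<eta> T))\<^sup>2 * (\<epsilon>\<^sup>2 - (\<Sum>i\<in>F. (cmod (\<eta> i - \<theta> i))\<^sup>2)) / (norm D + 1) \<le> 0"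
      by (intro divide_nonpos_nonneg mult_nonneg_nonpos) auto
    then show "\<eta> (op_abs y + y) = 0"
      unfolding bchi[OF e(1)] ychi[OF e(1)] Re_complex_of_real by (simp only: abs_of_nonpos of_real_minus) simp
  qed
qed

section \<open>Consequences of the separability of H\<close>

lemma separable_dense_sequence:
  assumes "separable_space (euclidean :: 'h topology)"
  obtains x :: "nat \<Rightarrow> 'h" where "\<And>v e. 0 < e \<Longrightarrow> \<exists>n. norm (v - x n) < e"
proof -
  obtain C :: "'h set" where C: "countable C" "closure C = UNIV"
    using assms by (auto simp: separable_space_def)
  have ne: "C \<noteq> {}" using C(2) by auto
  show ?thesis
  proof (rule that)
    fix v :: 'h and e :: real assume "0 < e"
    moreover have "v \<in> closure C" using C by simp
    ultimately obtain y where "y \<in> C" "dist y v < e" by (auto simp: closure_approachable)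
    then show "\<exists>n. norm (v - from_nat_into C n) < e"
      using from_nat_into_surj[OF C(1)] by (metis dist_norm norm_minus_commute)
  qed
qed

text \<open>A may be nonseparable in norm, so the countable choice is made through vectors: for
  dense \<open>x k\<close>, \<open>x m\<close> and each precision, one element of A sends
  \<open>x k\<close> close to \<open>x m\<close> whenever some element does. If b annihilates all of
  these, then b c vanishes at every \<open>x k\<close> for all c in A; the choice of c as the
  adjoint of b gives b = 0.\<close>

lemma ex_separating_sequence:
  assumes "separable_space (euclidean :: 'h topology)"
  obtains a :: "nat \<Rightarrow> 'h oper" where "\<And>n. a n \<in> A" "\<And>b. b \<in> A \<Longrightarrow> (\<And>n. b o\<^sub>L a n = 0) \<Longrightarrow> b = 0"
proof -
  obtain x :: "nat \<Rightarrow> 'h" where x: "\<And>v e. 0 < e \<Longrightarrow> \<exists>n. norm (v - x n) < e"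
    using separable_dense_sequence[OF assms] by blast
  define g where "g k m n = (SOME a. a \<in> A \<and>
    ((\<exists>a\<in>A. norm (blinfun_apply a (x k) - x m) < 1 / real (Suc n)) \<longrightarrow> norm (blinfun_apply a (x k) - x m) < 1 / real (Suc n)))" for k m n
  have "\<exists>a. a \<in> A \<and> ((\<exists>a\<in>A. norm (blinfun_apply a (x k) - x m) < 1 / real (Suc n)) \<longrightarrow> norm (blinfun_apply a (x k) - x m) < 1 / real (Suc n))" for k m n
    using A_zero by blast
  then have g: "g k m n \<in> A" "(\<exists>a\<in>A. norm (blinfun_apply a (x k) - x m) < 1 / real (Suc n)) \<Longrightarrow> norm (blinfun_apply (g k m n) (x k) - x m) < 1 / real (Suc n)" for k m n
    unfolding g_def by (metis (mono_tags, lifting) someI_ex)+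
  define a where "a i = (case from_nat i of (k, m, n) \<Rightarrow> g k m n)" for i :: nat
  have a_eq: "a (to_nat (k, m, n)) = g k m n" for k m n by (simp add: a_def)
  show ?thesis
  proof (rule that)
    show "a n \<in> A" for n using g(1) by (auto simp: a_def split: prod.split)
    fix b assume b: "b \<in> A" "\<And>n. b o\<^sub>L a n = 0"
    have b0: "blinfun_apply b (blinfun_apply (g k m n) v) = 0" for k m n v
      using b(2)[of "to_nat (k, m, n)"] unfolding a_eq by (metis blinfun_apply_blinfun_compose blinfun.zero_left)
    have small: "norm (blinfun_apply b (blinfun_apply c (x k))) \<le> norm b * e" if c: "c \<in> A" and e: "e > 0" for c k e
    proof -
      obtain n where n: "2 / real (Suc n) < e"
        using reals_Archimedean[of "e / 2"] e by (auto simp: field_simps)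
      obtain m where m: "norm (blinfun_apply c (x k) - x m) < 1 / real (Suc n)" using x[of "1 / real (Suc n)"] by auto
      then have "norm (blinfun_apply (g k m n) (x k) - x m) < 1 / real (Suc n)" using g(2) c by blast
      then have "norm ((blinfun_apply c (x k) - x m) - (blinfun_apply (g k m n) (x k) - x m)) < 2 / real (Suc n)"
        using m norm_triangle_ineq4[of "blinfun_apply c (x k) - x m" "blinfun_apply (g k m n) (x k) - x m"] by linarith
      then have d: "norm (blinfun_apply c (x k) - blinfun_apply (g k m n) (x k)) < e" using n by simp
      have "blinfun_apply b (blinfun_apply c (x k)) = blinfun_apply b (blinfun_apply c (x k) - blinfun_apply (g k m n) (x k))"
        by (simp add: blinfun.diff_right b0)
      also have "norm \<dots> \<le> norm b * norm (blinfun_apply c (x k) - blinfun_apply (g k m n) (x k))" by (rule norm_blinfun)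
      also have "\<dots> \<le> norm b * e" using d by (intro mult_left_mono) auto
      finally show ?thesis .
    qed
    have zero_x: "blinfun_apply b (blinfun_apply c (x k)) = 0" if c: "c \<in> A" for c k
    proof (rule ccontr)
      assume ne: "\<not> ?thesis"
      then have bn: "norm b > 0" by auto
      define z where "z = norm (blinfun_apply b (blinfun_apply c (x k)))"
      have "z > 0" using ne by (simp add: z_def)
      then have "z \<le> norm b * (z / (2 * norm b))"
        unfolding z_def using bn by (intro small[OF c]) (auto intro!: divide_pos_pos)
      then show False using \<open>z > 0\<close> bn by simp
    qed
    have "b o\<^sub>L adjoint_op b = 0"
    proof (rule blinfun_eqI)
      fix v
      show "blinfun_apply (b o\<^sub>L adjoint_op b) v = blinfun_apply 0 v"
      proof (rule ccontr)
        let ?T = "b o\<^sub>L adjoint_op b"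
        assume ne: "\<not> ?thesis"
        then have "norm (blinfun_apply ?T v) > 0" by simp
        moreover have "norm ?T > 0" using ne by (metis zero_less_norm_iff)
        ultimately have pos: "norm (blinfun_apply ?T v) > 0" "norm ?T > 0" by simp_all
        then obtain k where "norm (v - x k) < norm (blinfun_apply ?T v) / norm ?T" using x[of "norm (blinfun_apply ?T v) / norm ?T" v] by (auto intro: divide_pos_pos)
        then have "norm ?T * norm (v - x k) < norm (blinfun_apply ?T v)" using pos by (simp add: field_simps)
        moreover have "blinfun_apply ?T v = blinfun_apply ?T (v - x k)"
          using zero_x[OF A_adjoint[OF b(1)], of k] by (simp add: blinfun.diff_right)
        ultimately show False using norm_blinfun[of ?T "v - x k"] by simp
      qed
    qed
    then have "adjoint_op b o\<^sub>L b = 0" using A_commute[OF A_adjoint[OF b(1)] b(1)] by simp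
    then show "b = 0" using norm_adjoint_op_compose[OF A_bounded_operators[OF b(1)]] by simp
  qed
qed

text \<open>On an open set where the whole sequence vanishes, regularity provides a nonzero b
  supported there, and b annihilates the sequence.\<close>

lemma separating_sequence_dense_support:
  assumes a: "\<And>n. a n \<in> A" "\<And>b. b \<in> A \<Longrightarrow> (\<And>n. b o\<^sub>L a n = 0) \<Longrightarrow> b = 0"
    and U: "openin (spectrum A) U" "U \<noteq> {}"
  shows "\<exists>n. \<exists>\<theta>\<in>U. \<theta> (a n) \<noteq> 0"
proof (rule ccontr)
  assume n: "\<not> ?thesis"
  obtain \<theta> where th: "\<theta> \<in> U" using U(2) by blast
  obtain b where b: "b \<in> A" "\<theta> b \<noteq> 0" "\<And>\<eta>. \<eta> \<in> chars \<Longrightarrow> \<eta> \<notin> U \<Longrightarrow> \<eta> b = 0"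
    using spectrum_regular[OF U(1) th] by blast
  have "b o\<^sub>L a n = 0" for n
  proof (rule eq_of_characters)
    fix \<eta> assume e: "\<eta> \<in> chars"
    show "\<eta> (b o\<^sub>L a n) = \<eta> 0"
      using n b(3)[OF e] e a(1)[of n] b(1) by (cases "\<eta> \<in> U") (auto simp: chi_simps)
  qed (use a b in \<open>auto intro: A_intros\<close>)
  then have "b = 0" using a(2) b(1) by blast
  moreover have "\<theta> \<in> chars" using openin_subset[OF U(1)] th by auto
  ultimately show False using b(2) chi_zero by simp
qed

end

section \<open>Sigma-compactness, paracompactness and approximate identities\<close>

lemma sigma_compact_spaceI:
  assumes "countable \<K>" "\<And>K. K \<in> \<K> \<Longrightarrow> compactin X K" "topspace X \<subseteq> \<Union>\<K>"
  shows "sigma_compact_space X"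
proof -
  \<comment> \<open>The empty set is added because an enumeration by all natural numbers presupposes
    a nonempty family.\<close>
  have c: "countable (insert {} \<K>)" using assms by simp
  have r: "range (from_nat_into (insert {} \<K>)) = insert {} \<K>" using c by (intro range_from_nat_into) auto
  have "compactin X (from_nat_into (insert {} \<K>) n)" for n
    using from_nat_into[of "insert {} \<K>" n] assms(2) by auto
  moreover have "(\<Union>n. from_nat_into (insert {} \<K>) n) = topspace X"
  proof -
    have "\<Union>\<K> \<subseteq> topspace X" using compactin_subset_topspace[OF assms(2)] by (rule Union_least)
    then show ?thesis unfolding r using assms(3) by simp
  qed
  ultimately show ?thesis unfolding sigma_compact_space_def by blast
qed

lemma sigma_compact_imp_Lindelof_space:
  assumes "sigma_compact_space X"
  shows "Lindelof_space X"
  unfolding Lindelof_space_def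
proof (intro allI impI)
  fix \<U> assume U: "(\<forall>U\<in>\<U>. openin X U) \<and> \<Union>\<U> = topspace X"
  obtain K :: "nat \<Rightarrow> 'a set" where K: "\<And>n. compactin X (K n)" "(\<Union>n. K n) = topspace X"
    using assms by (auto simp: sigma_compact_space_def)
  have "\<exists>F. finite F \<and> F \<subseteq> \<U> \<and> K n \<subseteq> \<Union>F" for n
  proof -
    have "(\<forall>V\<in>\<U>. openin X V) \<and> K n \<subseteq> \<Union>\<U>" using U compactin_subset_topspace[OF K(1)[of n]] by simp
    then show ?thesis using K(1)[of n] unfolding compactin_def by meson
  qed
  then obtain F where F: "\<And>n. finite (F n)" "\<And>n. F n \<subseteq> \<U>" "\<And>n. K n \<subseteq> \<Union>(F n)" by metis
  have "countable (\<Union>n. F n)" using F(1) by (auto intro: countable_finite)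
  moreover have "\<Union>(\<Union>n. F n) = topspace X"
  proof
    show "\<Union>(\<Union>n. F n) \<subseteq> topspace X" using U F(2) by blast
    show "topspace X \<subseteq> \<Union>(\<Union>n. F n)" unfolding K(2)[symmetric] using F(3) by blast
  qed
  ultimately show "\<exists>\<V>. countable \<V> \<and> \<V> \<subseteq> \<U> \<and> \<Union>\<V> = topspace X"
    using F(2) by (intro exI[of _ "\<Union>n. F n"]) blast
qed

text \<open>Sublevel sets of p are compact, so each is covered by finitely many members of the given
  cover. Cutting these down to overlapping shells of p gives the refinement: a bounded sublevel set
  meets only finitely many shells.\<close>

lemma paracompact_space_of_exhaustion:
  assumes X: "Hausdorff_space X" and cont: "continuous_map X euclideanreal p"
    and pos: "\<And>x. x \<in> topspace X \<Longrightarrow> 0 \<le> p x"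
    and cpt: "\<And>r. compactin X {x \<in> topspace X. p x \<le> r}"
  shows "paracompact_space X"
  unfolding paracompact_space_def
proof (intro conjI X allI impI)
  fix \<U> assume U: "(\<forall>U\<in>\<U>. openin X U) \<and> \<Union>\<U> = topspace X"
  have "\<exists>F. finite F \<and> F \<subseteq> \<U> \<and> {x \<in> topspace X. p x \<le> r} \<subseteq> \<Union>F" for r
  proof -
    have "(\<forall>V\<in>\<U>. openin X V) \<and> {x \<in> topspace X. p x \<le> r} \<subseteq> \<Union>\<U>" using U by auto
    then show ?thesis using cpt[of r] unfolding compactin_def by meson
  qed
  then obtain F where F: "\<And>r. finite (F r)" "\<And>r. F r \<subseteq> \<U>" "\<And>r. {x \<in> topspace X. p x \<le> r} \<subseteq> \<Union>(F r)" by metis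
  \<comment> \<open>Open shells: a point with n \<le> p x < n + 1 lies in \<open>W n\<close>, and
    also in the sublevel set at n + 1 whose finite subcover is cut down to
    \<open>W n\<close>.\<close>
  define W where "W n = {x \<in> topspace X. p x \<in> {real n - 1<..<real n + 2}}" for n
  have W: "openin X (W n)" for n unfolding W_def by (rule openin_continuous_map_preimage[OF cont]) simp
  define G where "G n = (\<lambda>U. U \<inter> W n) ` F (real n + 1)" for n
  have G: "finite (G n)" for n using F(1) by (simp add: G_def)
  show "\<exists>\<V>. (\<forall>V\<in>\<V>. openin X V) \<and> \<Union>\<V> = topspace X \<and> (\<forall>V\<in>\<V>. \<exists>U\<in>\<U>. V \<subseteq> U) \<and> locally_finite_in X \<V>"
  proof (intro exI[of _ "\<Union>n. G n"] conjI ballI)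
    show open': "openin X V" if Vin: "V \<in> (\<Union>n. G n)" for V
    proof -
      obtain n U' where "V = U' \<inter> W n" "U' \<in> F (real n + 1)" using Vin by (auto simp: G_def)
      then show ?thesis using F(2)[of "real n + 1"] U W[of n] by auto
    qed
    show "\<exists>U\<in>\<U>. V \<subseteq> U" if "V \<in> (\<Union>n. G n)" for V
      using that F(2) by (auto simp: G_def)
    have sup: "x \<in> \<Union>(\<Union>n. G n)" if x: "x \<in> topspace X" for x
    proof -
      define n where "n = nat \<lfloor>p x\<rfloor>"
      have n: "real n \<le> p x" "p x < real n + 1" using pos[OF x] by (auto simp: n_def)
      then obtain U where "U \<in> F (real n + 1)" "x \<in> U" using F(3)[of "real n + 1"] x by auto
      moreover have "x \<in> W n" using n x by (auto simp: W_def)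
      ultimately show ?thesis by (auto simp: G_def)
    qed
    show un: "\<Union>(\<Union>n. G n) = topspace X"
      by (intro subset_antisym Union_least subsetI sup) (rule subsetD[OF openin_subset[OF open']])
    show "locally_finite_in X (\<Union>n. G n)"
      unfolding locally_finite_in_def
    proof (intro conjI ballI)
      fix x assume x: "x \<in> topspace X"
      let ?N = "{y \<in> topspace X. p y \<in> {..<p x + 1}}"
      have "{V \<in> \<Union>n. G n. V \<inter> ?N \<noteq> {}} \<subseteq> (\<Union>n\<in>{n. real n \<le> p x + 2}. G n)"
        by (force simp: G_def W_def)
      moreover have "finite {n. real n \<le> p x + 2}"
      proof -
        obtain m :: nat where "p x + 2 \<le> real m" using real_arch_simple by blast
        then have "{n. real n \<le> p x + 2} \<subseteq> {..m}" by auto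
        then show ?thesis by (rule finite_subset) simp
      qed
      ultimately have "finite {V \<in> \<Union>n. G n. V \<inter> ?N \<noteq> {}}"
        using G by (meson finite_UN_I finite_subset)
      moreover have "openin X ?N" by (rule openin_continuous_map_preimage[OF cont]) simp
      ultimately show "\<exists>V. openin X V \<and> x \<in> V \<and> finite {U \<in> \<Union>n. G n. U \<inter> V \<noteq> {}}"
        using x by (intro exI[of _ ?N]) auto
    qed (use un in simp)
  qed
qed

lemma locally_finite_in_compactin:
  assumes "locally_finite_in X \<V>" "compactin X K"
  shows "finite {V \<in> \<V>. V \<inter> K \<noteq> {}}"
proof -
  have "\<forall>x\<in>K. \<exists>N. openin X N \<and> x \<in> N \<and> finite {V \<in> \<V>. V \<inter> N \<noteq> {}}"
    using assms compactin_subset_topspace unfolding locally_finite_in_def by blast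
  then obtain N where N: "\<And>x. x \<in> K \<Longrightarrow> openin X (N x) \<and> x \<in> N x \<and> finite {V \<in> \<V>. V \<inter> N x \<noteq> {}}" by metis
  then have "(\<forall>U\<in>N ` K. openin X U) \<and> K \<subseteq> \<Union>(N ` K)" by auto
  then obtain \<F> where F: "finite \<F>" "\<F> \<subseteq> N ` K" "K \<subseteq> \<Union>\<F>"
    using assms(2) unfolding compactin_def by meson
  have "{V \<in> \<V>. V \<inter> K \<noteq> {}} \<subseteq> (\<Union>U\<in>\<F>. {V \<in> \<V>. V \<inter> U \<noteq> {}})" using F(3) by blast
  moreover have "finite \<dots>" using F N by auto
  ultimately show ?thesis by (rule finite_subset)
qed

context comm_cstar
begin

text \<open>The test cover for both covering properties: each member is open and contained in the
  compact set where |\<theta> T| is at least one.\<close>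

lemma Union_cmod_greater: "(\<Union>T\<in>A. {\<theta> \<in> chars. 1 < cmod (\<theta> T)}) = chars"
proof (intro equalityI subsetI)
  fix \<theta> assume th: "\<theta> \<in> chars"
  obtain T where "T \<in> A" "\<theta> T = 1" using ex_chi_eq_one[OF th] by blast
  then have "2 *\<^sub>R T \<in> A" "1 < cmod (\<theta> (2 *\<^sub>R T))" using th by (auto simp: A_intros chi_scaleR)
  then show "\<theta> \<in> (\<Union>T\<in>A. {\<theta> \<in> chars. 1 < cmod (\<theta> T)})" using th by blast
qed auto

lemma Lindelof_imp_sigma_compact_spectrum:
  assumes "Lindelof_space (spectrum A)"
  shows "sigma_compact_space (spectrum A)"
proof -
  define U where "U T = {\<theta> \<in> chars. 1 < cmod (\<theta> T)}" for T
  have "\<Union>(U ` A) = topspace (spectrum A)" unfolding U_def by (simp add: Union_cmod_greater)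
  moreover have "\<forall>V\<in>U ` A. openin (spectrum A) V" unfolding U_def using openin_cmod_greater by blast
  ultimately obtain \<V> where V: "countable \<V>" "\<V> \<subseteq> U ` A" "\<Union>\<V> = topspace (spectrum A)"
    using assms unfolding Lindelof_space_def by metis
  obtain B where B: "countable B" "B \<subseteq> A" "\<V> = U ` B" using V(1,2) by (metis countable_subset_image)
  show ?thesis
  proof (rule sigma_compact_spaceI)
    show "countable ((\<lambda>T. {\<theta> \<in> chars. 1 \<le> cmod (\<theta> T)}) ` B)" using B by simp
    show "topspace (spectrum A) \<subseteq> \<Union>((\<lambda>T. {\<theta> \<in> chars. 1 \<le> cmod (\<theta> T)}) ` B)"
      unfolding V(3)[symmetric] B(3) by (force simp: U_def)
  qed (use B compactin_cmod_ge in auto)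
qed

text \<open>At each character the values of e n tend to one, so the compact sets where |\<theta> (e
  n)| is at least 1/2 exhaust the spectrum.\<close>

lemma approximate_identity_imp_sigma_compact:
  assumes e: "sequential_approximate_identity A e"
  shows "sigma_compact_space (spectrum A)"
proof (rule sigma_compact_spaceI)
  let ?K = "\<lambda>n. {\<theta> \<in> chars. 1/2 \<le> cmod (\<theta> (e n))}"
  have eA: "e n \<in> A" for n using e by (simp add: sequential_approximate_identity_def)
  show "countable (range ?K)" by simp
  show "compactin (spectrum A) K" if K: "K \<in> range ?K" for K
  proof -
    obtain n where "K = ?K n" using K by blast
    then show ?thesis using compactin_cmod_ge[OF eA, of "1/2" n] by simp
  qed
  show "topspace (spectrum A) \<subseteq> \<Union>(range ?K)"
  proof
    fix \<theta> assume "\<theta> \<in> topspace (spectrum A)"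
    then have th: "\<theta> \<in> chars" by simp
    obtain T where T: "T \<in> A" "\<theta> T = 1" using ex_chi_eq_one[OF th] by blast
    have "(\<lambda>n. e n o\<^sub>L T) \<longlonglongrightarrow> T" using e T by (simp add: sequential_approximate_identity_def)
    then obtain n where n: "norm ((e n o\<^sub>L T) - T) < 1/2"
      using LIMSEQ_D[of _ T "1/2"] by (metis half_gt_zero_iff order_refl zero_less_one)
    have "cmod (\<theta> (e n) - 1) = cmod (\<theta> ((e n o\<^sub>L T) - T))"
      using th T eA by (simp add: chi_simps A_intros)
    also have "\<dots> \<le> norm ((e n o\<^sub>L T) - T)" by (intro cmod_chi_le th A_intros eA T)
    finally have "cmod (\<theta> (e n) - 1) < 1/2" using n by simp
    then have "1/2 \<le> cmod (\<theta> (e n))" using norm_triangle_ineq2[of 1 "1 - \<theta> (e n)"] by (simp add: norm_minus_commute)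
    then show "\<theta> \<in> \<Union>(range ?K)" using th by blast
  qed
qed

lemma paracompact_imp_sigma_compact:
  assumes sep: "separable_space (euclidean :: 'h topology)" and pc: "paracompact_space (spectrum A)"
  shows "sigma_compact_space (spectrum A)"
proof -
  obtain a :: "nat \<Rightarrow> 'h oper" where a: "\<And>n. a n \<in> A" "\<And>b. b \<in> A \<Longrightarrow> (\<And>n. b o\<^sub>L a n = 0) \<Longrightarrow> b = 0"
    using ex_separating_sequence[OF sep] by blast
  define U where "U T = {\<theta> \<in> chars. 1 < cmod (\<theta> T)}" for T
  have "\<Union>(U ` A) = topspace (spectrum A)" unfolding U_def by (simp add: Union_cmod_greater)
  moreover have "\<forall>V\<in>U ` A. openin (spectrum A) V" unfolding U_def using openin_cmod_greater by blast
  ultimately have "\<exists>\<V>. (\<forall>V\<in>\<V>. openin (spectrum A) V) \<and> \<Union>\<V> = topspace (spectrum A) \<and>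
      (\<forall>V\<in>\<V>. \<exists>W\<in>U ` A. V \<subseteq> W) \<and> locally_finite_in (spectrum A) \<V>"
    using pc[unfolded paracompact_space_def, THEN conjunct2, THEN spec[of _ "U ` A"]] by simp
  then obtain \<V> where V0: "(\<forall>V\<in>\<V>. openin (spectrum A) V) \<and> \<Union>\<V> = topspace (spectrum A) \<and>
      (\<forall>V\<in>\<V>. \<exists>W\<in>U ` A. V \<subseteq> W) \<and> locally_finite_in (spectrum A) \<V>" ..
  then have V: "V \<in> \<V> \<Longrightarrow> openin (spectrum A) V" "\<Union>\<V> = topspace (spectrum A)"
    "locally_finite_in (spectrum A) \<V>" for V by simp_all
  define T where "T V = (SOME T. T \<in> A \<and> V \<subseteq> U T)" for V
  have T: "T V \<in> A \<and> V \<subseteq> U (T V)" if "V \<in> \<V>" for V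
  proof -
    have "\<exists>W\<in>U ` A. V \<subseteq> W" using V0 that by simp
    then have "\<exists>T. T \<in> A \<and> V \<subseteq> U T" by auto
    then show ?thesis unfolding T_def by (rule someI_ex)
  qed
  \<comment> \<open>Every nonempty open V meets some of these compact sets, since for fixed n they
    exhaust the set where a n does not vanish. Each of them meets finitely many members of the
    locally finite family.\<close>
  define S where "S n k = {\<theta> \<in> chars. 1 / real (Suc k) \<le> cmod (\<theta> (a n))}" for n k
  have S: "finite {V \<in> \<V>. V \<inter> S n k \<noteq> {}}" for n k
    unfolding S_def by (rule locally_finite_in_compactin[OF V(3) compactin_cmod_ge[OF a(1)]]) simp
  have "V \<in> insert {} (\<Union>n. \<Union>k. {V \<in> \<V>. V \<inter> S n k \<noteq> {}})" if Vin: "V \<in> \<V>" for V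
  proof (cases "V = {}")
    case False
    then obtain n \<theta> where n: "\<theta> \<in> V" "\<theta> (a n) \<noteq> 0"
      using separating_sequence_dense_support[of a V, OF a(1) a(2) V(1)[OF Vin]] by blast
    then obtain k where "1 / real (Suc k) < cmod (\<theta> (a n))"
      using reals_Archimedean[of "cmod (\<theta> (a n))"] by (auto simp: inverse_eq_divide)
    then have "\<theta> \<in> S n k" using openin_subset[OF V(1)[OF Vin]] n(1) by (auto simp: S_def)
    then show ?thesis using n(1) Vin by blast
  qed simp
  then have "\<V> \<subseteq> insert {} (\<Union>n. \<Union>k. {V \<in> \<V>. V \<inter> S n k \<noteq> {}})" by blast
  moreover have "countable (insert {} (\<Union>n. \<Union>k. {V \<in> \<V>. V \<inter> S n k \<noteq> {}}))"
    by (rule countable_insert, rule countable_UN, simp, rule countable_UN, simp, rule countable_finite, rule S)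
  ultimately have cV: "countable \<V>" by (rule countable_subset)
  show ?thesis
  proof (rule sigma_compact_spaceI)
    show "countable ((\<lambda>V. {\<theta> \<in> chars. 1 \<le> cmod (\<theta> (T V))}) ` \<V>)" using cV by simp
    show "topspace (spectrum A) \<subseteq> \<Union>((\<lambda>V. {\<theta> \<in> chars. 1 \<le> cmod (\<theta> (T V))}) ` \<V>)"
      unfolding V(2)[symmetric] using T by (fastforce simp: U_def)
  qed (use T compactin_cmod_ge in auto)
qed

section \<open>Approximate identities from strictly positive elements\<close>

definition unit_positive :: "'h oper \<Rightarrow> bool" where
  "unit_positive h \<longleftrightarrow> h \<in> A \<and> (\<forall>\<theta>\<in>chars. \<exists>t. 0 \<le> t \<and> t \<le> 1 \<and> \<theta> h = of_real t)"

definition unit_strictly_positive :: "'h oper \<Rightarrow> bool" where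
  "unit_strictly_positive h \<longleftrightarrow> h \<in> A \<and> (\<forall>\<theta>\<in>chars. \<exists>t. 0 < t \<and> t \<le> 1 \<and> \<theta> h = of_real t)"

lemma unit_strictly_positive_imp: "unit_strictly_positive h \<Longrightarrow> unit_positive h"
  unfolding unit_strictly_positive_def unit_positive_def by (meson less_imp_le)

text \<open>The map w \<mapsto> 2w - w^2 squares 1 - w. The recursion thus expresses 1 - (1 -
  h)^(2^n) inside an algebra that may lack an identity.\<close>

fun approx_unit :: "'h oper \<Rightarrow> nat \<Rightarrow> 'h oper" where
  "approx_unit h 0 = h"
| "approx_unit h (Suc n) = 2 *\<^sub>R approx_unit h n - (approx_unit h n o\<^sub>L approx_unit h n)"

lemma approx_unit_in: "h \<in> A \<Longrightarrow> approx_unit h n \<in> A"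
  by (induction n) (auto intro!: A_intros)

lemma chi_approx_unit:
  assumes "h \<in> A" "\<theta> \<in> chars" "\<theta> h = of_real t"
  shows "\<theta> (approx_unit h n) = of_real (1 - (1 - t) ^ (2 ^ n))"
proof (induction n)
  case (Suc n)
  have "\<theta> (approx_unit h (Suc n)) = of_real (2 * (1 - (1 - t) ^ (2 ^ n)) - (1 - (1 - t) ^ (2 ^ n)) * (1 - (1 - t) ^ (2 ^ n)))"
    using assms by (simp add: chi_simps A_intros approx_unit_in Suc)
  also have "2 * (1 - (1 - t) ^ (2 ^ n)) - (1 - (1 - t) ^ (2 ^ n)) * (1 - (1 - t) ^ (2 ^ n)) = 1 - ((1 - t) ^ (2 ^ n)) ^ 2"
    by (simp add: power2_eq_square algebra_simps)
  also have "((1 - t) ^ (2 ^ n)) ^ 2 = (1 - t) ^ (2 ^ Suc n)" by (simp add: power_mult[symmetric] mult.commute)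
  finally show ?case .
qed (use assms in simp)

lemma norm_approx_unit_le:
  assumes h: "unit_positive h"
  shows "norm (approx_unit h n) \<le> 1"
proof (rule norm_le_of_characters)
  show "approx_unit h n \<in> A" using h approx_unit_in by (simp add: unit_positive_def)
  fix \<theta> assume th: "\<theta> \<in> chars"
  then obtain t where t: "0 \<le> t" "t \<le> 1" "\<theta> h = of_real t" using h by (auto simp: unit_positive_def)
  have "0 \<le> (1 - t) ^ (2 ^ n)" "(1 - t) ^ (2 ^ n) \<le> 1" using t by (auto intro: power_le_one)
  then show "cmod (\<theta> (approx_unit h n)) \<le> 1"
    using h th t chi_approx_unit[of h \<theta> t n] by (simp add: unit_positive_def norm_of_real del: of_real_diff)
qed simp

lemma unit_strictly_positive_bound_below:
  assumes h: "unit_strictly_positive h" and a: "a \<in> A" and e: "0 < e"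
  obtains \<delta> where "0 < \<delta>" "\<delta> \<le> 1" "\<And>\<theta>. \<theta> \<in> chars \<Longrightarrow> e \<le> cmod (\<theta> a) \<Longrightarrow> \<delta> \<le> Re (\<theta> h)"
proof -
  let ?K = "{\<theta> \<in> chars. e \<le> cmod (\<theta> a)}"
  have hA: "h \<in> A" using h by (simp add: unit_strictly_positive_def)
  have "compactin euclideanreal ((\<lambda>\<theta>. Re (\<theta> h)) ` ?K)"
    by (intro image_compactin[OF compactin_cmod_ge[OF a e]] continuous_map_Re continuous_map_eval hA)
  then have c: "compact ((\<lambda>\<theta>. Re (\<theta> h)) ` ?K)" by simp
  have pos: "0 < Re (\<theta> h)" "Re (\<theta> h) \<le> 1" if "\<theta> \<in> chars" for \<theta>
    using h that by (force simp: unit_strictly_positive_def)+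
  show ?thesis
  proof (cases "?K = {}")
    case True
    then show ?thesis using that[of 1] by auto
  next
    case False
    then obtain s where "s \<in> (\<lambda>\<theta>. Re (\<theta> h)) ` ?K" "\<And>t. t \<in> (\<lambda>\<theta>. Re (\<theta> h)) ` ?K \<Longrightarrow> s \<le> t"
      using compact_attains_inf[OF c] by blast
    then show ?thesis using that[of s] pos by auto
  qed
qed

text \<open>Where |\<theta> a| is small, a factor of modulus at most one suffices. On the compact
  remainder h is bounded below by some \<delta> > 0, and (1 - \<delta>)^(2^n) tends to zero
  uniformly there.\<close>

lemma approx_unit_tendsto:
  assumes h: "unit_strictly_positive h" and a: "a \<in> A"
  shows "(\<lambda>n. approx_unit h n o\<^sub>L a) \<longlonglongrightarrow> a"
proof (rule LIMSEQ_I)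
  fix r :: real assume r: "0 < r"
  have hA: "h \<in> A" using h by (simp add: unit_strictly_positive_def)
  obtain \<delta> where d: "0 < \<delta>" "\<delta> \<le> 1" "\<And>\<theta>. \<theta> \<in> chars \<Longrightarrow> r / 2 \<le> cmod (\<theta> a) \<Longrightarrow> \<delta> \<le> Re (\<theta> h)"
    using unit_strictly_positive_bound_below[OF h a, of "r / 2"] r by auto
  have "(\<lambda>n. (1 - \<delta>) ^ (2 ^ n)) \<longlonglongrightarrow> 0"
    using LIMSEQ_subseq_LIMSEQ[OF LIMSEQ_realpow_zero[of "1 - \<delta>"], of "\<lambda>n. 2 ^ n"] d
    by (auto simp: strict_mono_def o_def)
  then have "(\<lambda>n. norm a * (1 - \<delta>) ^ (2 ^ n)) \<longlonglongrightarrow> 0" using tendsto_mult_right_zero by blast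
  then obtain N where N: "\<And>n. n \<ge> N \<Longrightarrow> norm a * (1 - \<delta>) ^ (2 ^ n) < r / 2"
    using LIMSEQ_D[of "\<lambda>n. norm a * (1 - \<delta>) ^ (2 ^ n)" 0 "r / 2"] r d by (auto simp: abs_mult)
  have "norm ((approx_unit h n o\<^sub>L a) - a) \<le> r / 2" if "n \<ge> N" for n
  proof (rule norm_le_of_characters)
    show "(approx_unit h n o\<^sub>L a) - a \<in> A" by (intro A_intros approx_unit_in hA a)
    show "0 \<le> r / 2" using r by simp
    fix \<theta> assume th: "\<theta> \<in> chars"
    obtain t where t: "0 < t" "t \<le> 1" "\<theta> h = of_real t" using h th by (auto simp: unit_strictly_positive_def)
    have "\<theta> ((approx_unit h n o\<^sub>L a) - a) = - of_real ((1 - t) ^ (2 ^ n)) * \<theta> a"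
      using th a hA by (simp add: chi_simps A_intros approx_unit_in chi_approx_unit[OF hA th t(3)] algebra_simps)
    then have eq: "cmod (\<theta> ((approx_unit h n o\<^sub>L a) - a)) = (1 - t) ^ (2 ^ n) * cmod (\<theta> a)"
      using t by (simp add: norm_mult del: of_real_power)
    show "cmod (\<theta> ((approx_unit h n o\<^sub>L a) - a)) \<le> r / 2"
    proof (cases "r / 2 \<le> cmod (\<theta> a)")
      case True
      then have "(1 - t) ^ (2 ^ n) \<le> (1 - \<delta>) ^ (2 ^ n)" using d(3)[OF th True] t by (intro power_mono) auto
      then have "(1 - t) ^ (2 ^ n) * cmod (\<theta> a) \<le> (1 - \<delta>) ^ (2 ^ n) * norm a"
        using d(2) by (intro mult_mono cmod_chi_le th a) auto
      then show ?thesis using N[OF that] eq by (simp add: mult.commute)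
    next
      case False
      have "(1 - t) ^ (2 ^ n) * cmod (\<theta> a) \<le> 1 * cmod (\<theta> a)" using t by (intro mult_right_mono power_le_one) auto
      then show ?thesis using False eq by simp
    qed
  qed
  then show "\<exists>no. \<forall>n\<ge>no. norm ((approx_unit h n o\<^sub>L a) - a) < r" using r by (intro exI[of _ N]) (fastforce intro: le_less_trans)
qed

lemma unit_strictly_positive_imp_approximate_identity:
  assumes h: "unit_strictly_positive h"
  shows "sequential_approximate_identity A (approx_unit h)" "norm (approx_unit h n) \<le> 1"
proof -
  have hA: "h \<in> A" using h by (simp add: unit_strictly_positive_def)
  have "a o\<^sub>L approx_unit h n = approx_unit h n o\<^sub>L a" if "a \<in> A" for a n
    using A_commute[OF that approx_unit_in[OF hA]] .
  then show "sequential_approximate_identity A (approx_unit h)"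
    using approx_unit_tendsto[OF h] approx_unit_in[OF hA] by (auto simp: sequential_approximate_identity_def)
  show "norm (approx_unit h n) \<le> 1" by (rule norm_approx_unit_le[OF unit_strictly_positive_imp[OF h]])
qed

lemma unit_strictly_positive_imp_paracompact:
  assumes h: "unit_strictly_positive h"
  shows "paracompact_space (spectrum A)"
proof (rule paracompact_space_of_exhaustion[OF Hausdorff_space_spectrum])
  let ?p = "\<lambda>\<theta>. inverse (Re (\<theta> h))"
  have hA: "h \<in> A" using h by (simp add: unit_strictly_positive_def)
  have pos: "0 < Re (\<theta> h)" "cmod (\<theta> h) = Re (\<theta> h)" if "\<theta> \<in> chars" for \<theta>
    using h that by (force simp: unit_strictly_positive_def)+
  have "continuous_map (spectrum A) euclideanreal (\<lambda>\<theta>. Re (\<theta> h))"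
    by (intro continuous_map_Re continuous_map_eval hA)
  then show "continuous_map (spectrum A) euclideanreal ?p"
    using pos(1) by (fastforce simp: continuous_map_atin intro!: tendsto_inverse)
  show "0 \<le> ?p \<theta>" if "\<theta> \<in> topspace (spectrum A)" for \<theta> using that pos[of \<theta>] by simp
  fix r
  have "{\<theta> \<in> chars. ?p \<theta> \<le> r} = (if r \<le> 0 then {} else {\<theta> \<in> chars. inverse r \<le> cmod (\<theta> h)})"
  proof (cases "r \<le> 0")
    case True
    have "\<not> ?p \<theta> \<le> r" if "\<theta> \<in> chars" for \<theta>
      using True pos(1)[OF that] positive_imp_inverse_positive[of "Re (\<theta> h)"] by linarith
    then show ?thesis using True by auto
  next
    case False
    have "?p \<theta> \<le> r \<longleftrightarrow> inverse r \<le> cmod (\<theta> h)" if "\<theta> \<in> chars" for \<theta>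
      using False pos[OF that] inverse_le_iff_le[of "Re (\<theta> h)" "inverse r"] by simp
    then show ?thesis using False by auto
  qed
  then show "compactin (spectrum A) {\<theta> \<in> topspace (spectrum A). ?p \<theta> \<le> r}"
    using compactin_cmod_ge[OF hA, of "inverse r"] by (simp split: if_splits)
qed

lemma sum_scaled_adjoint_square:
  assumes F: "finite F" "F \<subseteq> A"
  obtains c where "unit_positive c" "\<And>\<theta>. \<theta> \<in> chars \<Longrightarrow> (\<exists>T\<in>F. \<theta> T \<noteq> 0) \<Longrightarrow> \<theta> c \<noteq> 0"
proof -
  define s where "s = (\<Sum>T\<in>F. adjoint_op T o\<^sub>L T)"
  \<comment> \<open>The values of s are at most norm s, so this scaling brings them into [0, 1]; the
    added one keeps the denominator positive.\<close>
  define c where "c = (1 / (norm s + 1)) *\<^sub>R s"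
  have sA: "s \<in> A" unfolding s_def using F by (auto intro!: A_intros)
  have s: "\<theta> s = of_real (\<Sum>T\<in>F. (cmod (\<theta> T))\<^sup>2)" if "\<theta> \<in> chars" for \<theta>
  proof -
    have "\<theta> s = (\<Sum>T\<in>F. \<theta> (adjoint_op T o\<^sub>L T))" unfolding s_def using F by (intro chi_sum that) (auto intro!: A_intros)
    also have "\<dots> = (\<Sum>T\<in>F. of_real ((cmod (\<theta> T))\<^sup>2))" using F that by (intro sum.cong) (auto simp: chi_adjoint_compose)
    finally show ?thesis by simp
  qed
  have N: "norm s + 1 > 0" by (simp add: add_nonneg_pos)
  have c: "\<theta> c = of_real ((\<Sum>T\<in>F. (cmod (\<theta> T))\<^sup>2) / (norm s + 1))" if "\<theta> \<in> chars" for \<theta>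
    using that sA by (simp add: c_def chi_scaleR s)
  show ?thesis
  proof
    show "unit_positive c"
      unfolding unit_positive_def
    proof (intro conjI ballI)
      show "c \<in> A" unfolding c_def by (intro A_intros sA)
      fix \<theta> assume th: "\<theta> \<in> chars"
      have "(\<Sum>T\<in>F. (cmod (\<theta> T))\<^sup>2) = cmod (\<theta> s)" unfolding s[OF th] by (simp add: sum_nonneg del: of_real_sum)
      also have "\<dots> \<le> norm s" by (rule cmod_chi_le[OF th sA])
      finally have "(\<Sum>T\<in>F. (cmod (\<theta> T))\<^sup>2) / (norm s + 1) \<le> 1" using N by simp
      moreover have "0 \<le> (\<Sum>T\<in>F. (cmod (\<theta> T))\<^sup>2) / (norm s + 1)" using N by (intro divide_nonneg_pos sum_nonneg) auto
      ultimately show "\<exists>t. 0 \<le> t \<and> t \<le> 1 \<and> \<theta> c = of_real t" using c[OF th] by blast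
    qed
    fix \<theta> assume th: "\<theta> \<in> chars" and "\<exists>T\<in>F. \<theta> T \<noteq> 0"
    then obtain T where T: "T \<in> F" "\<theta> T \<noteq> 0" by blast
    have "0 < (cmod (\<theta> T))\<^sup>2" using T by simp
    also have "\<dots> \<le> (\<Sum>T\<in>F. (cmod (\<theta> T))\<^sup>2)" using T F by (intro member_le_sum) auto
    finally show "\<theta> c \<noteq> 0" unfolding c[OF th] of_real_eq_0_iff using N by simp
  qed
qed

text \<open>For each compact K n there is a positive c n nonvanishing on it, a sum of squares over a
  finite subcover. The weights 2^(-n-1) make the series converge in norm with values at most one,
  and every character lies in some K m.\<close>

lemma sigma_compact_imp_unit_strictly_positive:
  assumes "sigma_compact_space (spectrum A)"
  obtains h where "unit_strictly_positive h"
proof -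
  obtain K :: "nat \<Rightarrow> _" where K: "\<And>n. compactin (spectrum A) (K n)" "(\<Union>n. K n) = chars"
    using assms by (auto simp: sigma_compact_space_def)
  have "\<exists>c. unit_positive c \<and> (\<forall>\<theta>\<in>K n. \<theta> c \<noteq> 0)" for n
  proof -
    let ?U = "\<lambda>T. {\<theta> \<in> chars. 0 < cmod (\<theta> T)}"
    have sub: "K n \<subseteq> chars" using K(2) by blast
    have "K n \<subseteq> \<Union>(?U ` A)"
    proof
      fix \<theta> assume "\<theta> \<in> K n"
      then have "\<theta> \<in> chars" using sub by blast
      then show "\<theta> \<in> \<Union>(?U ` A)" using chi_nonzero by fastforce
    qed
    moreover have "\<forall>U\<in>?U ` A. openin (spectrum A) U" using openin_cmod_greater by blast
    ultimately obtain \<F> where F: "finite \<F>" "\<F> \<subseteq> ?U ` A" "K n \<subseteq> \<Union>\<F>"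
      using K(1)[of n] unfolding compactin_def by meson
    then obtain F where F: "finite F" "F \<subseteq> A" "K n \<subseteq> \<Union>(?U ` F)"
      using finite_subset_image[OF F(1,2)] by blast
    obtain c where "unit_positive c" "\<And>\<theta>. \<theta> \<in> chars \<Longrightarrow> (\<exists>T\<in>F. \<theta> T \<noteq> 0) \<Longrightarrow> \<theta> c \<noteq> 0"
      using sum_scaled_adjoint_square[OF F(1,2)] by blast
    moreover have "\<exists>T\<in>F. \<theta> T \<noteq> 0" if "\<theta> \<in> K n" for \<theta> using F(3) that by auto
    ultimately show ?thesis using sub by blast
  qed
  then obtain c where c: "\<And>n. unit_positive (c n)" "\<And>n \<theta>. \<theta> \<in> K n \<Longrightarrow> \<theta> (c n) \<noteq> 0" by metis
  have cA: "c n \<in> A" for n using c(1) by (simp add: unit_positive_def)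
  have cn: "norm (c n) \<le> 1" for n
    using norm_approx_unit_le[OF c(1), of n 0] by simp
  define f where "f n = (1/2) ^ Suc n *\<^sub>R c n" for n
  have "norm (f n) \<le> (1/2) ^ Suc n" for n using mult_left_mono[OF cn, of "(1/2) ^ Suc n" n] by (simp add: f_def)
  then have sf: "summable f"
    by (intro summable_comparison_test'[of "\<lambda>n. (1/2) ^ Suc n" 0 f]) (auto simp: summable_Suc_iff)
  define h where "h = suminf f"
  have lim: "(\<lambda>N. \<Sum>n<N. f n) \<longlonglongrightarrow> h" unfolding h_def by (rule summable_LIMSEQ[OF sf])
  have fA: "f n \<in> A" for n unfolding f_def by (intro A_intros cA)
  have hA: "h \<in> A" by (rule A_limit[OF _ lim]) (intro A_sum fA)
  have "\<exists>t. 0 < t \<and> t \<le> 1 \<and> \<theta> h = of_real t" if th: "\<theta> \<in> chars" for \<theta>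
  proof -
    have "\<forall>n. \<exists>t. 0 \<le> t \<and> t \<le> 1 \<and> \<theta> (c n) = of_real t" using c(1) th by (auto simp: unit_positive_def)
    then obtain t where t: "\<And>n. 0 \<le> t n" "\<And>n. t n \<le> 1" "\<And>n. \<theta> (c n) = of_real (t n)" by metis
    define S where "S N = (\<Sum>n<N. (1/2) ^ Suc n * t n)" for N
    have S: "\<theta> (\<Sum>n<N. f n) = of_real (S N)" for N
      using chi_sum[OF th, of "{..<N}" f] fA th cA t by (simp add: f_def chi_scaleR S_def)
    have "(\<lambda>N. \<theta> (\<Sum>n<N. f n)) \<longlonglongrightarrow> \<theta> h"
    proof (rule metric_tendsto_imp_tendsto[OF lim], intro always_eventually allI)
      fix N
      have "cmod (\<theta> ((\<Sum>n<N. f n) - h)) \<le> norm ((\<Sum>n<N. f n) - h)" by (intro cmod_chi_le th A_intros fA hA)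
      then show "dist (\<theta> (\<Sum>n<N. f n)) (\<theta> h) \<le> dist (\<Sum>n<N. f n) h"
        by (simp add: dist_norm chi_diff th hA A_sum fA)
    qed
    then have SL: "(\<lambda>N. complex_of_real (S N)) \<longlonglongrightarrow> \<theta> h" by (simp only: S)
    from tendsto_Re[OF this] have re: "S \<longlonglongrightarrow> Re (\<theta> h)" by simp
    have im: "Im (\<theta> h) = 0" using tendsto_Im[OF SL] by (simp add: LIMSEQ_const_iff)
    have "S N \<le> 1" for N
    proof -
      have "S N \<le> (\<Sum>n<N. (1/2) ^ Suc n * 1)" unfolding S_def by (intro sum_mono mult_left_mono t) auto
      also have "\<dots> \<le> 1"
      proof -
        have "(\<Sum>n<N. (1/2) ^ Suc n * 1) = 1 - (1/2 :: real) ^ N" by (induction N) auto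
        then show ?thesis by simp
      qed
      finally show ?thesis .
    qed
    then have le1: "Re (\<theta> h) \<le> 1" using LIMSEQ_le_const2[OF re] by blast
    obtain m where m: "\<theta> \<in> K m" using th K(2) by blast
    have tm: "t m > 0" using c(2)[OF m] t(1)[of m] t(3)[of m] by (cases "t m = 0") auto
    have "(1/2) ^ Suc m * t m \<le> S N" if "N \<ge> Suc m" for N
      unfolding S_def using that t(1) by (intro member_le_sum[of m "{..<N}" "\<lambda>n. (1/2) ^ Suc n * t n"]) auto
    then have "(1/2) ^ Suc m * t m \<le> Re (\<theta> h)" using LIMSEQ_le_const[OF re] by blast
    then have "0 < Re (\<theta> h)" using tm by (smt (verit) mult_pos_pos zero_less_power half_gt_zero_iff)
    then show ?thesis using le1 im by (intro exI[of _ "Re (\<theta> h)"]) (auto simp: complex_eq_iff)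
  qed
  then show ?thesis using that hA by (auto simp: unit_strictly_positive_def)
qed

section \<open>States and strictly positive elements\<close>

lemma character_state:
  assumes th: "\<theta> \<in> chars"
  shows "state_on A \<theta>"
  unfolding state_on_def
proof (intro conjI allI impI)
  let ?S = "(\<lambda>a. cmod (\<theta> a)) ` {a \<in> A. norm a \<le> 1}"
  show "linear_functional A \<theta>" using th by (auto simp: chars_def characters_def)
  show "0 \<le> \<theta> h" if "positive_element A h" for h
    using that th by (auto simp: positive_element_def chi_adjoint_compose less_eq_complex_def simp del: of_real_power)
  have le: "x \<le> 1" if "x \<in> ?S" for x using that cmod_chi_le[OF th] by fastforce
  then show bdd: "bdd_above ?S" by (rule bdd_aboveI)
  obtain T where T: "T \<in> A" "\<theta> T = 1" using ex_chi_eq_one[OF th] by blast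
  \<comment> \<open>To reach the norm one where A may have no identity, the contractions
    \<open>approx_unit p n\<close> are used: p is positive at \<theta>, so their values there tend
    to one.\<close>
  obtain p where p: "unit_positive p" "\<And>\<eta>. \<eta> \<in> chars \<Longrightarrow> (\<exists>T\<in>{T}. \<eta> T \<noteq> 0) \<Longrightarrow> \<eta> p \<noteq> 0"
    using sum_scaled_adjoint_square[of "{T}"] T by auto
  obtain t where t: "0 \<le> t" "t \<le> 1" "\<theta> p = of_real t" using p(1) th by (auto simp: unit_positive_def)
  have "t > 0" using p(2)[OF th] T t by (cases "t = 0") auto
  have pA: "p \<in> A" using p(1) by (simp add: unit_positive_def)
  have "1 - (1 - t) ^ (2 ^ n) \<le> Sup ?S" for n
  proof (rule cSup_upper[OF _ bdd])
    have "(1 - t) ^ (2 ^ n) \<le> 1" using t by (intro power_le_one) auto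
    then have "cmod (\<theta> (approx_unit p n)) = 1 - (1 - t) ^ (2 ^ n)"
      unfolding chi_approx_unit[OF pA th t(3)] norm_of_real by simp
    then show "1 - (1 - t) ^ (2 ^ n) \<in> ?S"
      using approx_unit_in[OF pA] norm_approx_unit_le[OF p(1)] by (intro image_eqI[of _ _ "approx_unit p n"]) auto
  qed
  note upper = this
  have lim: "(\<lambda>n. 1 - (1 - t) ^ (2 ^ n)) \<longlonglongrightarrow> 1 - 0"
    using LIMSEQ_subseq_LIMSEQ[OF LIMSEQ_realpow_zero[of "1 - t"], of "\<lambda>n. 2 ^ n"] t \<open>t > 0\<close>
    by (intro tendsto_intros) (auto simp: strict_mono_def o_def)
  have "1 - 0 \<le> Sup ?S" by (rule LIMSEQ_le_const2[OF lim]) (use upper in blast)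
  moreover have "Sup ?S \<le> 1"
  proof (rule cSup_least)
    have "0 \<in> {a \<in> A. norm a \<le> 1}" using A_zero by simp
    then show "?S \<noteq> {}" by blast
  qed (rule le)
  ultimately show "Sup ?S = 1" by simp
qed

lemma strictly_positive_imp_sigma_compact:
  assumes h: "h \<in> A" "strictly_positive A h"
  shows "sigma_compact_space (spectrum A)"
proof (rule sigma_compact_spaceI)
  let ?K = "\<lambda>n. {\<theta> \<in> chars. 1 / real (Suc n) \<le> cmod (\<theta> h)}"
  show "countable (range ?K)" by simp
  show "compactin (spectrum A) K" if K: "K \<in> range ?K" for K
  proof -
    obtain n where "K = ?K n" using K by blast
    then show ?thesis using compactin_cmod_ge[OF h(1), of "1 / real (Suc n)"] by simp
  qed
  show "topspace (spectrum A) \<subseteq> \<Union>(range ?K)"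
  proof
    fix \<theta> assume "\<theta> \<in> topspace (spectrum A)"
    then have th: "\<theta> \<in> chars" by simp
    then have "\<theta> h \<noteq> 0" using h(2) character_state unfolding strictly_positive_def by fastforce
    then obtain n where "1 / real (Suc n) < cmod (\<theta> h)"
      using reals_Archimedean[of "cmod (\<theta> h)"] by (auto simp: inverse_eq_divide)
    then show "\<theta> \<in> \<Union>(range ?K)" using th by (auto intro: less_imp_le)
  qed
qed

text \<open>A state that vanishes on the square of h vanishes on h a for every a by a Cauchy-Schwarz
  argument, hence on products with the approximate unit, which is built from h. Continuity makes it
  zero, contrary to its norm being one. The square of h is taken because positive elements are by
  definition of this form.\<close>

lemma unit_strictly_positive_imp_strictly_positive:
  assumes h: "unit_strictly_positive h"
  shows "strictly_positive A (adjoint_op h o\<^sub>L h)"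
  unfolding strictly_positive_def
proof (intro conjI allI impI)
  have hA: "h \<in> A" using h by (simp add: unit_strictly_positive_def)
  have hsa: "adjoint_op h = h"
    by (rule selfadjoint_of_real_values[OF hA]) (use h in \<open>auto simp: unit_strictly_positive_def\<close>)
  show pos: "positive_element A (adjoint_op h o\<^sub>L h)" using hA by (auto simp: positive_element_def)
  fix \<phi> assume s: "state_on A \<phi>"
  then have lin: "\<And>S T. S \<in> A \<Longrightarrow> T \<in> A \<Longrightarrow> \<phi> (S + T) = \<phi> S + \<phi> T" "\<And>c T. T \<in> A \<Longrightarrow> \<phi> (op_scale c T) = c * \<phi> T"
    and ge: "\<And>b. b \<in> A \<Longrightarrow> 0 \<le> \<phi> (adjoint_op b o\<^sub>L b)"
    and bdd: "bdd_above ((\<lambda>a. cmod (\<phi> a)) ` {a \<in> A. norm a \<le> 1})"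
    and sup: "(SUP a\<in>{a \<in> A. norm a \<le> 1}. cmod (\<phi> a)) = 1"
    by (auto simp: state_on_def linear_functional_def positive_element_def)
  show "0 < \<phi> (adjoint_op h o\<^sub>L h)"
  proof (rule ccontr)
    assume "\<not> ?thesis"
    then have z: "\<phi> (adjoint_op h o\<^sub>L h) = 0" using ge[OF hA] by (auto simp: order_less_le)
    have hz: "\<phi> (h o\<^sub>L a) = 0" if a: "a \<in> A" for a
    proof -
      let ?X = "\<phi> (h o\<^sub>L a)" and ?Y = "\<phi> (adjoint_op a o\<^sub>L h)" and ?Z = "\<phi> (adjoint_op a o\<^sub>L a)"
      \<comment> \<open>Positivity on h + r c a. The term of order zero is gone, so the term linear
        in r must vanish as well.\<close>
      have ge0: "0 \<le> of_real r * (c * ?X + cnj c * ?Y) + of_real (r\<^sup>2 * (cmod c)\<^sup>2) * ?Z" for c r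
      proof -
        let ?b = "h + op_scale (of_real r * c) a"
        have bA: "?b \<in> A" by (intro A_intros hA a)
        have bo: "h \<in> bounded_operators" "a \<in> bounded_operators" "adjoint_op a \<in> bounded_operators" "op_scale (of_real r * c) a \<in> bounded_operators"
          by (intro A_bounded_operators A_intros hA a)+
        have "adjoint_op ?b o\<^sub>L ?b = (adjoint_op h o\<^sub>L h) + op_scale (of_real r * c) (h o\<^sub>L a)
            + (op_scale (cnj (of_real r * c)) (adjoint_op a o\<^sub>L h)
            + op_scale (cnj (of_real r * c) * (of_real r * c)) (adjoint_op a o\<^sub>L a))"
          using bo by (simp add: adjoint_op_add adjoint_op_op_scale hsa bcomp_simps op_scale_compose_left
              op_scale_compose_right op_scale_op_scale)
        then have "\<phi> (adjoint_op ?b o\<^sub>L ?b) = of_real r * c * ?X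
            + (cnj (of_real r * c) * ?Y + cnj (of_real r * c) * (of_real r * c) * ?Z)"
          using z by (simp add: lin A_intros hA a)
        also have "\<dots> = of_real r * (c * ?X + cnj c * ?Y) + of_real (r\<^sup>2) * (c * cnj c) * ?Z"
          by (simp add: power2_eq_square algebra_simps)
        also have "\<dots> = of_real r * (c * ?X + cnj c * ?Y) + of_real (r\<^sup>2 * (cmod c)\<^sup>2) * ?Z"
          by (simp only: complex_norm_square[symmetric] of_real_mult)
        finally show ?thesis using ge[OF bA] by simp
      qed
      have Z: "Im ?Z = 0" using ge[OF a] by (simp add: less_eq_complex_def)
      have Re0: "Re (c * ?X + cnj c * ?Y) = 0" for c
      proof (rule quadratic_nonneg_imp_zero)
        fix r :: real
        show "0 \<le> 2 * r * Re (c * ?X + cnj c * ?Y) + r\<^sup>2 * (2 * ((cmod c)\<^sup>2 * Re ?Z))"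
          using ge0[of r c] by (simp add: less_eq_complex_def algebra_simps del: of_real_mult of_real_power)
      qed
      have Im0: "Im (c * ?X + cnj c * ?Y) = 0" for c
        using ge0[of 1 c] Z by (simp add: less_eq_complex_def del: of_real_mult of_real_power)
      \<comment> \<open>The case c = 1 gives X + Y = 0 and the case c = i gives X = Y. The complex
        order supplies the imaginary parts, as a nonnegative number is real.\<close>
      have "Re ?X = 0" using Re0[of 1] Im0[of \<i>] by simp
      moreover have "Im ?X = 0" using Im0[of 1] Re0[of \<i>] by simp
      ultimately show "?X = 0" by (simp add: complex_eq_iff)
    qed
    \<comment> \<open>The induction varies a, because the square of the previous element acts on a
      as that element applied to another member of A.\<close>
    have wz: "a \<in> A \<Longrightarrow> \<phi> (approx_unit h n o\<^sub>L a) = 0" for n a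
    proof (induction n arbitrary: a)
      case (Suc n)
      have "approx_unit h (Suc n) o\<^sub>L a = op_scale 2 (approx_unit h n o\<^sub>L a) + op_scale (- 1) (approx_unit h n o\<^sub>L (approx_unit h n o\<^sub>L a))"
        using op_scale_of_real[of 2 "approx_unit h n o\<^sub>L a"] by (simp add: bcomp_simps blinfun_compose_assoc)
      then show ?case using Suc.IH Suc.prems approx_unit_in[OF hA] by (simp add: lin A_intros del: op_scale_minus_one)
    qed (use hz in simp)
    have bnd: "cmod (\<phi> a) \<le> norm a" if a: "a \<in> A" for a
    proof (cases "a = 0")
      case True
      then show ?thesis using lin(2)[OF A_zero, of 0] by simp
    next
      case False
      then have "op_scale (of_real (1 / norm a)) a \<in> {a \<in> A. norm a \<le> 1}"
        using a by (auto simp: A_intros norm_op_scale simp del: of_real_divide)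
      from cSUP_upper[OF this bdd] have "cmod (\<phi> (op_scale (of_real (1 / norm a)) a)) \<le> 1"
        unfolding sup .
      then show ?thesis using False a by (simp add: lin norm_mult norm_divide field_simps)
    qed
    have "\<phi> a = 0" if a: "a \<in> A" for a
    proof (rule ccontr)
      assume n: "\<phi> a \<noteq> 0"
      then obtain n where "norm ((approx_unit h n o\<^sub>L a) - a) < cmod (\<phi> a)"
        using LIMSEQ_D[OF approx_unit_tendsto[OF h a], of "cmod (\<phi> a)"] by auto
      moreover have "\<phi> ((approx_unit h n o\<^sub>L a) - a) = - \<phi> a"
      proof -
        have "\<phi> ((approx_unit h n o\<^sub>L a) - a) = \<phi> ((approx_unit h n o\<^sub>L a) + op_scale (- 1) a)" by simp
        also have "\<dots> = - \<phi> a"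
          using a wz[OF a] by (simp add: lin A_intros approx_unit_in hA del: op_scale_minus_one)
        finally show ?thesis .
      qed
      ultimately show False using bnd[of "(approx_unit h n o\<^sub>L a) - a"] a by (simp add: A_intros approx_unit_in hA)
    qed
    then have "(\<lambda>a. cmod (\<phi> a)) ` {a \<in> A. norm a \<le> 1} = {0}" using A_zero by force
    then show False using sup by simp
  qed
qed

end

section \<open>Banach spaces with explicit carriers\<close>

definition tends_in :: "('x, 'm) normed_struct_scheme \<Rightarrow> (nat \<Rightarrow> 'x) \<Rightarrow> 'x \<Rightarrow> bool" where
  "tends_in E u l \<longleftrightarrow> (\<lambda>n. nrm E (sub E (u n) l)) \<longlonglongrightarrow> 0"

locale carrier_banach =
  fixes E :: "('x, 'm) normed_struct_scheme"
  assumes E: "complex_banach_space E"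
begin

lemma zer_car [simp]: "zer E \<in> car E"
  and add_car [simp]: "x \<in> car E \<Longrightarrow> y \<in> car E \<Longrightarrow> add E x y \<in> car E"
  and scl_car [simp]: "x \<in> car E \<Longrightarrow> scl E c x \<in> car E"
  and add_comm: "x \<in> car E \<Longrightarrow> y \<in> car E \<Longrightarrow> add E x y = add E y x"
  and add_zer [simp]: "x \<in> car E \<Longrightarrow> add E x (zer E) = x"
  and sub_self [simp]: "x \<in> car E \<Longrightarrow> sub E x x = zer E"
  and scl_add_right: "x \<in> car E \<Longrightarrow> y \<in> car E \<Longrightarrow> scl E c (add E x y) = add E (scl E c x) (scl E c y)"
  and scl_add_left: "x \<in> car E \<Longrightarrow> scl E (c + d) x = add E (scl E c x) (scl E d x)"
  and scl_scl: "x \<in> car E \<Longrightarrow> scl E c (scl E d x) = scl E (c * d) x"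
  and scl_one [simp]: "x \<in> car E \<Longrightarrow> scl E 1 x = x"
  and nrm_ge_0 [simp]: "x \<in> car E \<Longrightarrow> 0 \<le> nrm E x"
  and nrm_eq_0: "x \<in> car E \<Longrightarrow> nrm E x = 0 \<longleftrightarrow> x = zer E"
  and nrm_add_le: "x \<in> car E \<Longrightarrow> y \<in> car E \<Longrightarrow> nrm E (add E x y) \<le> nrm E x + nrm E y"
  and nrm_scl: "x \<in> car E \<Longrightarrow> nrm E (scl E c x) = cmod c * nrm E x"
  using E by (simp_all add: complex_banach_space_def complex_vector_space_def)

lemma add_assoc:
  assumes "x \<in> car E" "y \<in> car E" "z \<in> car E"
  shows "add E (add E x y) z = add E x (add E y z)"
proof -
  have "\<forall>x\<in>car E. \<forall>y\<in>car E. \<forall>z\<in>car E. add E (add E x y) z = add E x (add E y z)"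
    using E unfolding complex_banach_space_def complex_vector_space_def by (elim conjE)
  then show ?thesis using assms by blast
qed

lemma complete:
  "(\<And>n. u n \<in> car E) \<Longrightarrow> \<forall>e>0. \<exists>N. \<forall>m\<ge>N. \<forall>n\<ge>N. nrm E (sub E (u m) (u n)) < e \<Longrightarrow>
    \<exists>l\<in>car E. tends_in E u l"
  using E by (simp add: complex_banach_space_def tends_in_def)

lemma sub_car [simp]: "x \<in> car E \<Longrightarrow> y \<in> car E \<Longrightarrow> sub E x y \<in> car E"
  by (simp add: sub_def)

lemma zer_add [simp]: "x \<in> car E \<Longrightarrow> add E (zer E) x = x"
  by (metis add_comm add_zer zer_car)

lemma add_left_comm:
  "x \<in> car E \<Longrightarrow> y \<in> car E \<Longrightarrow> z \<in> car E \<Longrightarrow> add E x (add E y z) = add E y (add E x z)"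
  by (metis add_assoc add_comm)

lemmas add_ac_car = add_assoc add_comm add_left_comm

lemma scl_zero_left [simp]: "x \<in> car E \<Longrightarrow> scl E 0 x = zer E"
  using scl_add_left[of x 1 "-1"] sub_self[of x] by (simp add: sub_def)

lemma scl_zer [simp]: "scl E c (zer E) = zer E"
  using scl_scl[of "zer E" c 0] by simp

lemma add_neg [simp]: "x \<in> car E \<Longrightarrow> add E x (scl E (- 1) x) = zer E"
  using sub_self[of x] by (simp add: sub_def)

lemma add_neg_cancel:
  "x \<in> car E \<Longrightarrow> z \<in> car E \<Longrightarrow> add E x (add E (scl E (- 1) x) z) = z"
  by (simp add: add_assoc[symmetric])

lemma scl_sub: "x \<in> car E \<Longrightarrow> y \<in> car E \<Longrightarrow> scl E c (sub E x y) = sub E (scl E c x) (scl E c y)"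
  by (simp add: sub_def scl_add_right scl_scl)

lemma sub_add_sub:
  "a \<in> car E \<Longrightarrow> b \<in> car E \<Longrightarrow> c \<in> car E \<Longrightarrow> d \<in> car E \<Longrightarrow>
    sub E (add E a b) (add E c d) = add E (sub E a c) (sub E b d)"
  by (simp add: sub_def scl_add_right add_ac_car)

lemma sub_add_cancel: "x \<in> car E \<Longrightarrow> y \<in> car E \<Longrightarrow> add E (sub E x y) y = x"
  by (simp add: sub_def add_assoc add_comm[of "scl E (- 1) y" y])

lemma sub_eq_zer: "x \<in> car E \<Longrightarrow> y \<in> car E \<Longrightarrow> sub E x y = zer E \<longleftrightarrow> x = y"
  by (metis sub_add_cancel sub_self zer_add)

lemma sub_zer [simp]: "x \<in> car E \<Longrightarrow> sub E x (zer E) = x"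
  by (simp add: sub_def)

lemma sub_eq_iff: "x \<in> car E \<Longrightarrow> y \<in> car E \<Longrightarrow> z \<in> car E \<Longrightarrow> sub E x y = z \<longleftrightarrow> x = add E z y"
  by (metis add_neg_cancel add_comm add_assoc add_zer add_neg sub_add_cancel sub_def scl_car)

lemma nrm_zer [simp]: "nrm E (zer E) = 0"
  by (simp add: nrm_eq_0)

lemma nrm_sub_commute: "x \<in> car E \<Longrightarrow> y \<in> car E \<Longrightarrow> nrm E (sub E x y) = nrm E (sub E y x)"
proof -
  assume xy: "x \<in> car E" "y \<in> car E"
  have "sub E y x = scl E (- 1) (sub E x y)"
    using xy by (simp add: sub_def scl_add_right scl_scl add_comm)
  then show ?thesis using xy by (simp add: nrm_scl)
qed

lemma nrm_sub_triangle:
  assumes "x \<in> car E" "y \<in> car E" "z \<in> car E"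
  shows "nrm E (sub E x z) \<le> nrm E (sub E x y) + nrm E (sub E y z)"
proof -
  have "sub E x z = add E (sub E x y) (sub E y z)"
    using assms by (simp add: sub_def add_assoc add_comm[of "scl E (- 1) y"]) (simp add: add_ac_car add_neg_cancel)
  then show ?thesis using assms nrm_add_le[of "sub E x y" "sub E y z"] by simp
qed

lemma tends_in_unique:
  assumes "\<And>n. u n \<in> car E" "l \<in> car E" "l' \<in> car E" "tends_in E u l" "tends_in E u l'"
  shows "l = l'"
proof -
  have "(\<lambda>n. nrm E (sub E (u n) l) + nrm E (sub E (u n) l')) \<longlonglongrightarrow> 0 + 0"
    using assms(4,5) unfolding tends_in_def by (intro tendsto_add)
  then have "nrm E (sub E l l') \<le> 0 + 0"
  proof (rule LIMSEQ_le_const, intro exI allI impI)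
    fix n :: nat
    show "nrm E (sub E l l') \<le> nrm E (sub E (u n) l) + nrm E (sub E (u n) l')"
      using nrm_sub_triangle[of l "u n" l'] assms by (simp add: nrm_sub_commute[of l])
  qed
  then have "nrm E (sub E l l') = 0" using assms by (intro antisym) auto
  then show ?thesis using assms by (simp add: nrm_eq_0 sub_eq_zer)
qed

lemma tends_in_add:
  assumes "\<And>n. u n \<in> car E" "\<And>n. v n \<in> car E" "l \<in> car E" "k \<in> car E" "tends_in E u l" "tends_in E v k"
  shows "tends_in E (\<lambda>n. add E (u n) (v n)) (add E l k)"
proof -
  have "(\<lambda>n. nrm E (sub E (u n) l) + nrm E (sub E (v n) k)) \<longlonglongrightarrow> 0"
    using tendsto_add[of _ 0 sequentially _ 0] assms(5,6) unfolding tends_in_def by fastforce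
  then show ?thesis
    unfolding tends_in_def
    by (rule Lim_null_comparison[rotated]) (use assms in \<open>auto intro!: always_eventually nrm_add_le simp: sub_add_sub\<close>)
qed

lemma nrm_tends_in_le:
  assumes "\<And>n. u n \<in> car E" "l \<in> car E" "tends_in E u l" "\<And>n. nrm E (u n) \<le> C"
  shows "nrm E l \<le> C"
proof -
  have "(\<lambda>n. nrm E (sub E (u n) l) + C) \<longlonglongrightarrow> 0 + C"
    using assms(3) unfolding tends_in_def by (intro tendsto_intros)
  then have "nrm E l \<le> 0 + C"
  proof (rule LIMSEQ_le_const, intro exI allI impI)
    fix n :: nat
    have "nrm E (sub E l (zer E)) \<le> nrm E (sub E l (u n)) + nrm E (sub E (u n) (zer E))"
      using assms by (intro nrm_sub_triangle) auto
    then show "nrm E l \<le> nrm E (sub E (u n) l) + C"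
      using assms(1,2) assms(4)[of n] by (simp add: nrm_sub_commute[of l])
  qed
  then show ?thesis by simp
qed

end

lemma clinear_on_zer:
  assumes "complex_banach_space E" "complex_banach_space F" "clinear_on E F f"
  shows "f (zer E) = zer F"
proof -
  interpret E: carrier_banach E by standard fact
  interpret F: carrier_banach F by standard fact
  have "f (scl E 0 (zer E)) = scl F 0 (f (zer E))" using assms(3) E.zer_car unfolding clinear_on_def by blast
  moreover have "f (zer E) \<in> car F" using assms(3) E.zer_car unfolding clinear_on_def by blast
  ultimately show ?thesis by simp
qed

lemma clinear_on_sub:
  assumes "complex_banach_space E" "clinear_on E F f" "x \<in> car E" "y \<in> car E"
  shows "f (sub E x y) = sub F (f x) (f y)"
proof -
  interpret E: carrier_banach E by standard fact
  show ?thesis using assms(2-4) by (simp add: sub_def clinear_on_def)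
qed

lemma bounded_clinear_tends_in:
  assumes EF: "complex_banach_space E" "complex_banach_space F" and f: "bounded_clinear_on E F f"
    and u: "\<And>n. u n \<in> car E" "l \<in> car E" "tends_in E u l"
  shows "tends_in F (\<lambda>n. f (u n)) (f l)"
proof -
  interpret E: carrier_banach E by standard fact
  interpret F: carrier_banach F by standard fact
  obtain K where K: "clinear_on E F f" "\<And>x. x \<in> car E \<Longrightarrow> nrm F (f x) \<le> K * nrm E x"
    using f by (auto simp: bounded_clinear_on_def)
  have fc: "f x \<in> car F" if "x \<in> car E" for x using K(1) that by (auto simp: clinear_on_def)
  have "(\<lambda>n. K * nrm E (sub E (u n) l)) \<longlonglongrightarrow> 0"
    using tendsto_mult_right_zero u(3) unfolding tends_in_def by blast
  then show ?thesis
    unfolding tends_in_def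
    by (rule Lim_null_comparison[rotated])
      (use u K fc in \<open>auto intro!: always_eventually simp: clinear_on_sub[OF EF(1) K(1), symmetric]\<close>)
qed

lemma bounded_clinear_on_sub:
  assumes F: "complex_banach_space F" and f: "bounded_clinear_on E F f" and g: "bounded_clinear_on E F g"
  shows "bounded_clinear_on E F (\<lambda>x. sub F (f x) (g x))"
proof -
  interpret F: carrier_banach F by standard fact
  obtain K L where K: "clinear_on E F f" "\<forall>x\<in>car E. nrm F (f x) \<le> K * nrm E x"
    and L: "clinear_on E F g" "\<forall>x\<in>car E. nrm F (g x) \<le> L * nrm E x"
    using f g unfolding bounded_clinear_on_def by blast
  have c: "f x \<in> car F" "g x \<in> car F" if "x \<in> car E" for x
    using K(1) L(1) that by (auto simp: clinear_on_def)
  have "nrm F (sub F (f x) (g x)) \<le> (K + L) * nrm E x" if x: "x \<in> car E" for x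
  proof -
    have "nrm F (sub F (f x) (g x)) \<le> nrm F (f x) + nrm F (scl F (- 1) (g x))"
      using c[OF x] by (simp add: sub_def F.nrm_add_le)
    also have "nrm F (scl F (- 1) (g x)) = nrm F (g x)" using c[OF x] by (simp add: F.nrm_scl)
    also have "nrm F (f x) + nrm F (g x) \<le> K * nrm E x + L * nrm E x"
      using K(2) L(2) x by (intro add_mono) auto
    finally show ?thesis by (simp add: algebra_simps)
  qed
  moreover have "clinear_on E F (\<lambda>x. sub F (f x) (g x))"
    using K(1) L(1) c unfolding clinear_on_def by (auto simp: F.sub_add_sub F.scl_sub)
  ultimately show ?thesis unfolding bounded_clinear_on_def by blast
qed

context comm_cstar
begin

abbreviation AA where "AA \<equiv> regular_module A"

lemma regular_module_simps [simp]:
  "car AA = A" "zer AA = 0" "add AA = (+)" "scl AA = op_scale" "nrm AA = norm" "lact AA = (o\<^sub>L)"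
  "sub AA x y = x - y"
  by (auto simp: regular_module_def sub_def)

lemma complex_banach_space_AA: "complex_banach_space AA"
  unfolding complex_banach_space_def complex_vector_space_def
proof (intro conjI ballI allI impI)
  fix u :: "nat \<Rightarrow> 'h oper"
  assume u: "(\<forall>n. u n \<in> car AA) \<and> (\<forall>e>0. \<exists>N. \<forall>m\<ge>N. \<forall>n\<ge>N. nrm AA (sub AA (u m) (u n)) < e)"
  then have "Cauchy u" by (auto simp: Cauchy_def dist_norm)
  then obtain l where l: "u \<longlonglongrightarrow> l" using Cauchy_convergent_iff convergent_def by blast
  then have "l \<in> A" using u A_limit by auto
  moreover have "(\<lambda>n. norm (u n - l)) \<longlonglongrightarrow> 0" using l by (simp add: LIM_zero tendsto_norm_zero)
  ultimately show "\<exists>l\<in>car AA. (\<lambda>n. nrm AA (sub AA (u n) l)) \<longlonglongrightarrow> 0" by auto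
qed (auto simp: A_intros op_scale_add_right op_scale_add_left op_scale_op_scale norm_op_scale norm_triangle_ineq)

lemma left_banach_module_AA: "left_banach_module A AA"
  unfolding left_banach_module_def
proof (intro conjI ballI complex_banach_space_AA)
  show "\<exists>K. \<forall>a\<in>A. \<forall>x\<in>car AA. nrm AA (lact AA a x) \<le> K * norm a * nrm AA x"
    by (intro exI[of _ 1]) (auto simp: norm_blinfun_compose)
qed (auto simp: clinear_on_def A_intros bcomp_simps op_scale_compose_left op_scale_compose_right
    A_bounded_operators blinfun_compose_assoc)

lemma tends_in_AA: "tends_in AA u l \<longleftrightarrow> u \<longlonglongrightarrow> l"
  by (simp add: tends_in_def tendsto_norm_zero_iff LIM_zero_iff)

section \<open>Diagonal sums\<close>

text \<open>From index one on these are the consecutive differences of the approximate unit. At a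
  character they are nonnegative and sum to at most one.\<close>

fun left_factor :: "'h oper \<Rightarrow> nat \<Rightarrow> 'h oper" where
  "left_factor h 0 = h"
| "left_factor h (Suc n) = approx_unit h n - (approx_unit h n o\<^sub>L approx_unit h n)"

text \<open>With \<open>P w = 3w\<^sup>2 - 2w\<^sup>3\<close>, the difference \<open>P (2w - w\<^sup>2) - P w\<close> is divisible by \<open>(w - w\<^sup>2)\<^sup>2\<close>, the quotient
  being \<open>9 - 8w + 2w\<^sup>2\<close>. Hence the partial sums of \<open>left_factor h n * right_factor h n\<close> are the values
  of \<open>P\<close> at the approximate unit, while both factors remain absolutely summable.\<close>

fun right_factor :: "'h oper \<Rightarrow> nat \<Rightarrow> 'h oper" where
  "right_factor h 0 = 3 *\<^sub>R h - 2 *\<^sub>R (h o\<^sub>L h)"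
| "right_factor h (Suc n) = 9 *\<^sub>R left_factor h (Suc n) - 8 *\<^sub>R (approx_unit h n o\<^sub>L left_factor h (Suc n))
     + 2 *\<^sub>R (approx_unit h n o\<^sub>L (approx_unit h n o\<^sub>L left_factor h (Suc n)))"

lemma left_factor_in: "h \<in> A \<Longrightarrow> left_factor h n \<in> A"
  by (cases n) (auto intro!: A_intros approx_unit_in)

lemma right_factor_in: "h \<in> A \<Longrightarrow> right_factor h n \<in> A"
  by (cases n) (auto intro!: A_intros approx_unit_in left_factor_in simp del: left_factor.simps(2))

lemma approx_unit_range:
  assumes h: "unit_positive h" and th: "\<theta> \<in> chars"
  obtains r where "0 \<le> r" "r \<le> 1" "\<theta> (approx_unit h n) = of_real r"
proof -
  obtain t where t: "0 \<le> t" "t \<le> 1" "\<theta> h = of_real t" "h \<in> A" using h th by (auto simp: unit_positive_def)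
  have "0 \<le> (1 - t) ^ (2 ^ n)" "(1 - t) ^ (2 ^ n) \<le> 1" using t by (auto intro: power_le_one)
  then show ?thesis using that[of "1 - (1 - t) ^ (2 ^ n)"] chi_approx_unit[OF t(4) th t(3)] by simp
qed

text \<open>On [0, 1] the quotients 3 - 2t and 9 - 8w + 2w^2 both lie between 0 and 9. The right
  factors thus inherit summability from the left ones.\<close>

lemma factor_values:
  assumes h: "unit_positive h" and th: "\<theta> \<in> chars"
  obtains r where "0 \<le> r" "r \<le> 1" "\<theta> (left_factor h n) = of_real r" "cmod (\<theta> (right_factor h n)) \<le> 9 * r"
proof (cases n)
  case 0
  obtain t where t: "0 \<le> t" "t \<le> 1" "\<theta> h = of_real t" "h \<in> A" using h th by (auto simp: unit_positive_def)
  have "\<theta> (right_factor h 0) = of_real (t * (3 - 2 * t))"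
    using th t by (simp add: chi_simps A_intros algebra_simps)
  then have "cmod (\<theta> (right_factor h 0)) = t * (3 - 2 * t)" using t by (simp add: norm_mult del: of_real_mult of_real_diff)
  also have "\<dots> \<le> t * 9" using t by (intro mult_left_mono) auto
  finally show ?thesis using that[of t] t 0 by (simp add: mult.commute)
next
  case (Suc m)
  have hA: "h \<in> A" using h by (simp add: unit_positive_def)
  obtain w where w: "0 \<le> w" "w \<le> 1" "\<theta> (approx_unit h m) = of_real w" using approx_unit_range[OF h th] by blast
  have l: "\<theta> (left_factor h n) = of_real (w - w * w)"
    using th hA w by (simp add: Suc chi_simps A_intros approx_unit_in)
  have r: "\<theta> (right_factor h n) = of_real ((w - w * w) * (9 - 8 * w + 2 * w * w))"
  proof -
    have "\<theta> (right_factor h n) = 9 * \<theta> (left_factor h n) - 8 * (of_real w * \<theta> (left_factor h n))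
        + 2 * (of_real w * (of_real w * \<theta> (left_factor h n)))"
      using th hA w by (simp add: Suc chi_simps A_intros approx_unit_in left_factor_in del: left_factor.simps)
    then show ?thesis unfolding l by (simp add: algebra_simps)
  qed
  have ww: "0 \<le> w * w" "w * w \<le> w" using w mult_left_le[of w w] by auto
  then have "w * w \<le> 4 * w" using w by linarith
  have "cmod (\<theta> (right_factor h n)) = \<bar>w - w * w\<bar> * \<bar>9 - 8 * w + 2 * w * w\<bar>"
    unfolding r norm_of_real abs_mult ..
  also have "\<dots> \<le> (w - w * w) * 9"
    using w ww \<open>w * w \<le> 4 * w\<close> by (intro mult_mono) (auto simp: abs_le_iff mult.assoc)
  finally show ?thesis using that[of "w - w * w"] l w ww by (simp add: mult.commute)
qed

lemma left_factor_telescope: "(\<Sum>n<Suc N. left_factor h n) = approx_unit h N"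
  by (induction N) (simp_all add: scaleR_2)

lemma factor_product_sum:
  assumes h: "h \<in> A"
  shows "(\<Sum>n<Suc N. left_factor h n o\<^sub>L right_factor h n) =
    3 *\<^sub>R (approx_unit h N o\<^sub>L approx_unit h N) - 2 *\<^sub>R (approx_unit h N o\<^sub>L (approx_unit h N o\<^sub>L approx_unit h N))"
proof (induction N)
  case 0
  show ?case by (simp add: bcomp_simps)
next
  case (Suc N)
  let ?w = "approx_unit h N"
  have w: "?w \<in> A" by (rule approx_unit_in[OF h])
  have "(3 *\<^sub>R (?w o\<^sub>L ?w) - 2 *\<^sub>R (?w o\<^sub>L (?w o\<^sub>L ?w))) + (left_factor h (Suc N) o\<^sub>L right_factor h (Suc N)) =
    3 *\<^sub>R (approx_unit h (Suc N) o\<^sub>L approx_unit h (Suc N)) -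
    2 *\<^sub>R (approx_unit h (Suc N) o\<^sub>L (approx_unit h (Suc N) o\<^sub>L approx_unit h (Suc N)))"
    (is "?L = ?R")
  \<comment> \<open>At a character the claim is the polynomial identity P (2z - z^2) - P z = (z -
    z^2)^2 (9 - 8z + 2z^2) with P z = 3z^2 - 2z^3.\<close>
  proof (rule eq_of_characters)
    fix \<theta> assume th: "\<theta> \<in> chars"
    define z where "z = \<theta> ?w"
    have "\<theta> ?L = (3 * (z * z) - 2 * (z * (z * z))) + (z - z * z) * (9 * (z - z * z) - 8 * (z * (z - z * z)) + 2 * (z * (z * (z - z * z))))"
      using th w by (simp add: chi_simps A_intros z_def)
    moreover have "\<theta> ?R = 3 * ((2 * z - z * z) * (2 * z - z * z)) - 2 * ((2 * z - z * z) * ((2 * z - z * z) * (2 * z - z * z)))"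
      using th w by (simp add: chi_simps A_intros z_def)
    moreover have "(3 * (z * z) - 2 * (z * (z * z))) + (z - z * z) * (9 * (z - z * z) - 8 * (z * (z - z * z)) + 2 * (z * (z * (z - z * z))))
        = 3 * ((2 * z - z * z) * (2 * z - z * z)) - 2 * ((2 * z - z * z) * ((2 * z - z * z) * (2 * z - z * z)))"
      by algebra
    ultimately show "\<theta> ?L = \<theta> ?R" by simp
  next
    have f: "left_factor h (Suc N) \<in> A" "right_factor h (Suc N) \<in> A" "approx_unit h (Suc N) \<in> A"
      by (rule left_factor_in[OF h], rule right_factor_in[OF h], rule approx_unit_in[OF h])
    show "?L \<in> A" "?R \<in> A" by (intro A_intros f w)+
  qed
  then show ?case by (simp only: sum.lessThan_Suc[of _ "Suc N"] Suc.IH)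
qed

lemma factor_product_sum_tendsto:
  assumes h: "unit_strictly_positive h" and a: "a \<in> A"
  shows "(\<lambda>N. \<Sum>n<N. (a o\<^sub>L left_factor h n) o\<^sub>L right_factor h n) \<longlonglongrightarrow> a"
proof -
  have hA: "h \<in> A" using h by (simp add: unit_strictly_positive_def)
  let ?w = "approx_unit h"
  have wA: "?w N \<in> A" for N by (rule approx_unit_in[OF hA])
  \<comment> \<open>The approximate unit is bounded by one, so it may act on a sequence converging
    to a as well as on a; this allows its powers to be treated one factor at a time.\<close>
  have step: "(\<lambda>N. ?w N o\<^sub>L c N) \<longlonglongrightarrow> a" if c: "c \<longlonglongrightarrow> a" for c
  proof -
    have lim: "(\<lambda>N. norm (c N - a) + norm ((?w N o\<^sub>L a) - a)) \<longlonglongrightarrow> 0"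
      using tendsto_add[OF tendsto_norm_zero[OF LIM_zero[OF c]] tendsto_norm_zero[OF LIM_zero[OF approx_unit_tendsto[OF h a]]]] by simp
    have le: "norm ((?w N o\<^sub>L c N) - a) \<le> norm (c N - a) + norm ((?w N o\<^sub>L a) - a)" for N
    proof -
      have "(?w N o\<^sub>L c N) - a = (?w N o\<^sub>L (c N - a)) + ((?w N o\<^sub>L a) - a)" by (simp add: bcomp_simps)
      then have "norm ((?w N o\<^sub>L c N) - a) \<le> norm (?w N o\<^sub>L (c N - a)) + norm ((?w N o\<^sub>L a) - a)"
        by (metis norm_triangle_ineq)
      moreover have "norm (?w N o\<^sub>L (c N - a)) \<le> 1 * norm (c N - a)"
        using norm_approx_unit_le[OF unit_strictly_positive_imp[OF h], of N]
        by (intro order_trans[OF norm_blinfun_compose] mult_right_mono) auto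
      ultimately show ?thesis by linarith
    qed
    have "(\<lambda>N. (?w N o\<^sub>L c N) - a) \<longlonglongrightarrow> 0"
      by (rule Lim_null_comparison[OF always_eventually[OF allI[OF le]] lim])
    then show ?thesis by (rule LIM_zero_cancel)
  qed
  have eq: "(\<Sum>n<Suc N. (a o\<^sub>L left_factor h n) o\<^sub>L right_factor h n) =
      3 *\<^sub>R (?w N o\<^sub>L (?w N o\<^sub>L a)) - 2 *\<^sub>R (?w N o\<^sub>L (?w N o\<^sub>L (?w N o\<^sub>L a)))" for N
  proof -
    have "(\<Sum>n<Suc N. (a o\<^sub>L left_factor h n) o\<^sub>L right_factor h n) = (\<Sum>n<Suc N. a o\<^sub>L (left_factor h n o\<^sub>L right_factor h n))"
      by (simp only: blinfun_compose_assoc)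
    also have "\<dots> = a o\<^sub>L (\<Sum>n<Suc N. left_factor h n o\<^sub>L right_factor h n)"
      by (simp only: blinfun_compose.sum_right)
    also have "\<dots> = (\<Sum>n<Suc N. left_factor h n o\<^sub>L right_factor h n) o\<^sub>L a"
      by (intro A_commute a A_sum A_compose left_factor_in right_factor_in hA)
    also have "\<dots> = 3 *\<^sub>R (?w N o\<^sub>L (?w N o\<^sub>L a)) - 2 *\<^sub>R (?w N o\<^sub>L (?w N o\<^sub>L (?w N o\<^sub>L a)))"
      by (simp only: factor_product_sum[OF hA] bcomp_simps blinfun_compose_assoc)
    finally show ?thesis .
  qed
  have "(\<lambda>N. \<Sum>n<Suc N. (a o\<^sub>L left_factor h n) o\<^sub>L right_factor h n) \<longlonglongrightarrow> 3 *\<^sub>R a - 2 *\<^sub>R a"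
    unfolding eq by (intro tendsto_intros step tendsto_const)
  also have "3 *\<^sub>R a - 2 *\<^sub>R a = a" by (simp add: scaleR_left_diff_distrib[symmetric])
  finally show ?thesis by (rule LIMSEQ_imp_Suc)
qed

end

text \<open>Convergence of the diagonal series is a matter of bounded bilinear maps into a Banach
  space; module structure and cocycle identity enter only when the limit is evaluated on
  products.\<close>

locale diagonal_sum = comm_cstar A + carrier_banach E
  for A :: "'h::complex_hilbert_space oper set" and E :: "('x, 'm) normed_struct_scheme" +
  fixes \<beta> :: "'h oper \<Rightarrow> 'h oper \<Rightarrow> 'x" and K :: real and h :: "'h oper"
  assumes beta_right: "a \<in> A \<Longrightarrow> clinear_on (regular_module A) E (\<beta> a)"
    and beta_left: "b \<in> A \<Longrightarrow> clinear_on (regular_module A) E (\<lambda>a. \<beta> a b)"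
    and beta_bound: "a \<in> A \<Longrightarrow> b \<in> A \<Longrightarrow> nrm E (\<beta> a b) \<le> K * norm a * norm b"
    and K: "0 \<le> K" and h: "unit_strictly_positive h"
begin

lemma h_in: "h \<in> A"
  using h by (simp add: unit_strictly_positive_def)

lemma beta_car [simp]: "a \<in> A \<Longrightarrow> b \<in> A \<Longrightarrow> \<beta> a b \<in> car E"
  using beta_right by (auto simp: clinear_on_def)

lemma beta_add_right: "a \<in> A \<Longrightarrow> b \<in> A \<Longrightarrow> c \<in> A \<Longrightarrow> \<beta> a (b + c) = add E (\<beta> a b) (\<beta> a c)"
  using beta_right[of a] by (simp add: clinear_on_def)

lemma beta_scale_right: "a \<in> A \<Longrightarrow> b \<in> A \<Longrightarrow> \<beta> a (op_scale z b) = scl E z (\<beta> a b)"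
  using beta_right[of a] by (simp add: clinear_on_def)

lemma beta_add_left: "a \<in> A \<Longrightarrow> b \<in> A \<Longrightarrow> c \<in> A \<Longrightarrow> \<beta> (a + b) c = add E (\<beta> a c) (\<beta> b c)"
  using beta_left[of c] by (simp add: clinear_on_def)

lemma beta_scale_left: "a \<in> A \<Longrightarrow> b \<in> A \<Longrightarrow> \<beta> (op_scale z a) b = scl E z (\<beta> a b)"
  using beta_left[of b] by (simp add: clinear_on_def)

lemma add_interchange:
  "p \<in> car E \<Longrightarrow> q \<in> car E \<Longrightarrow> r \<in> car E \<Longrightarrow> s \<in> car E \<Longrightarrow>
    add E (add E p q) (add E r s) = add E (add E p r) (add E q s)"
  by (simp add: add_ac_car)

lemma half_double: "p \<in> car E \<Longrightarrow> scl E (1/2) (add E p p) = p"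
  by (simp add: scl_add_right scl_add_left[symmetric])

lemma beta_expand:
  "x \<in> A \<Longrightarrow> y \<in> A \<Longrightarrow> x' \<in> A \<Longrightarrow> y' \<in> A \<Longrightarrow>
    \<beta> (x + x') (y + y') = add E (add E (\<beta> x y) (\<beta> x y')) (add E (\<beta> x' y) (\<beta> x' y'))"
  by (simp add: beta_add_left beta_add_right A_intros) (rule add_interchange; simp)

text \<open>One step of averaging over signs: the mixed terms occur with opposite signs and
  cancel.\<close>

lemma beta_polarization:
  assumes "x \<in> A" "y \<in> A" "x' \<in> A" "y' \<in> A"
  shows "add E (\<beta> x y) (\<beta> x' y') =
    scl E (1/2) (add E (\<beta> (x + x') (y + y')) (\<beta> (x - x') (y - y')))"
proof -
  define p q r s where "p = \<beta> x y" and "q = \<beta> x y'" and "r = \<beta> x' y" and "s = \<beta> x' y'"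
  define q' r' where "q' = scl E (- 1) q" and "r' = scl E (- 1) r"
  have c [simp]: "p \<in> car E" "q \<in> car E" "r \<in> car E" "s \<in> car E" "q' \<in> car E" "r' \<in> car E"
    using assms by (simp_all add: p_def q_def r_def s_def q'_def r'_def)
  have qq: "add E q q' = zer E" "add E r r' = zer E" by (simp_all add: q'_def r'_def del: c(5,6))
  have plus: "\<beta> (x + x') (y + y') = add E (add E p q) (add E r s)"
    unfolding p_def q_def r_def s_def by (rule beta_expand[OF assms])
  have "x - x' = x + op_scale (- 1) x'" "y - y' = y + op_scale (- 1) y'" by simp_all
  then have "\<beta> (x - x') (y - y') = \<beta> (x + op_scale (- 1) x') (y + op_scale (- 1) y')" by simp
  also have "\<dots> = add E (add E p q') (add E r' (scl E (- 1) (scl E (- 1) s)))"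
    using assms by (subst beta_expand) (simp_all add: beta_scale_left beta_scale_right A_op_scale
        p_def q_def r_def s_def q'_def r'_def del: op_scale_minus_one)
  also have "scl E (- 1) (scl E (- 1) s) = s" by (simp add: scl_scl)
  finally have minus: "\<beta> (x - x') (y - y') = add E (add E p q') (add E r' s)" .
  have "add E (\<beta> (x + x') (y + y')) (\<beta> (x - x') (y - y')) =
      add E (add E (add E p q) (add E p q')) (add E (add E r s) (add E r' s))"
    unfolding plus minus by (rule add_interchange) simp_all
  also have "add E (add E p q) (add E p q') = add E p p"
    by (subst add_interchange) (simp_all add: qq)
  also have "add E (add E r s) (add E r' s) = add E s s"
    by (subst add_interchange) (simp_all add: qq)
  finally show ?thesis
    unfolding p_def[symmetric] s_def[symmetric] by (simp add: scl_add_right half_double[unfolded scl_add_right] scl_add_left[symmetric])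
qed

fun psum :: "(nat \<Rightarrow> 'h oper) \<Rightarrow> (nat \<Rightarrow> 'h oper) \<Rightarrow> nat \<Rightarrow> 'x" where
  "psum X Y 0 = zer E"
| "psum X Y (Suc n) = add E (psum X Y n) (\<beta> (X n) (Y n))"

lemma psum_car [simp]: "(\<And>n. X n \<in> A) \<Longrightarrow> (\<And>n. Y n \<in> A) \<Longrightarrow> psum X Y n \<in> car E"
  by (induction n) auto

definition signs :: "(nat \<Rightarrow> real) set" where
  "signs = {s. \<forall>n. s n = 1 \<or> s n = - 1}"

text \<open>The sum of \<beta> (X n) (Y n) is the mean over all signs s of \<beta> evaluated at the
  two s-signed sums, so uniform bounds on signed sums suffice where the sum of the products of norms
  may be large. In the induction x and y collect the terms whose sign has been fixed; each step
  fixes the sign of the last index in both ways.\<close>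

lemma psum_block_bound:
  assumes XY: "\<And>n. X n \<in> A" "\<And>n. Y n \<in> A" and "M \<le> N"
    and "x \<in> A" "y \<in> A"
    and "\<And>s. s \<in> signs \<Longrightarrow> norm (x + (\<Sum>n\<in>{M..<N}. s n *\<^sub>R X n)) \<le> P"
    and "\<And>s. s \<in> signs \<Longrightarrow> norm (y + (\<Sum>n\<in>{M..<N}. s n *\<^sub>R Y n)) \<le> Q"
  shows "nrm E (add E (\<beta> x y) (sub E (psum X Y N) (psum X Y M))) \<le> K * P * Q"
  using \<open>M \<le> N\<close> assms(4-)
proof (induction N arbitrary: x y rule: dec_induct)
  case base
  have "(\<lambda>_. 1) \<in> signs" by (simp add: signs_def)
  then have xy: "norm x \<le> P" "norm y \<le> Q" using base(3)[of "\<lambda>_. 1"] base(4)[of "\<lambda>_. 1"] by auto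
  have "nrm E (\<beta> x y) \<le> K * norm x * norm y" using base by (intro beta_bound)
  also have "\<dots> \<le> K * P * Q"
    using xy K by (intro mult_mono mult_nonneg_nonneg) (auto intro: order_trans[OF norm_ge_zero])
  finally show ?case using base XY by simp
next
  case (step N)
  let ?Z = "sub E (psum X Y N) (psum X Y M)"
  have Z: "?Z \<in> car E" using XY by simp
  have xyA: "x + X N \<in> A" "y + Y N \<in> A" "x - X N \<in> A" "y - Y N \<in> A"
    using step.prems XY by (auto intro: A_intros)
  have sg: "norm (x + e *\<^sub>R X N + (\<Sum>n\<in>{M..<N}. s n *\<^sub>R X n)) \<le> P"
    "norm (y + e *\<^sub>R Y N + (\<Sum>n\<in>{M..<N}. s n *\<^sub>R Y n)) \<le> Q" if "s \<in> signs" "e = 1 \<or> e = - 1" for s e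
  proof -
    let ?s = "s(N := e)"
    have s: "?s \<in> signs" using that by (auto simp: signs_def)
    have "(\<Sum>n\<in>{M..<Suc N}. ?s n *\<^sub>R V n) = (\<Sum>n\<in>{M..<N}. s n *\<^sub>R V n) + e *\<^sub>R V N" for V :: "nat \<Rightarrow> 'h oper"
      using step.hyps by simp
    then show "norm (x + e *\<^sub>R X N + (\<Sum>n\<in>{M..<N}. s n *\<^sub>R X n)) \<le> P"
      "norm (y + e *\<^sub>R Y N + (\<Sum>n\<in>{M..<N}. s n *\<^sub>R Y n)) \<le> Q"
      using step.prems(3)[OF s] step.prems(4)[OF s] by (simp_all only: add_ac)
  qed
  have plus: "nrm E (add E (\<beta> (x + X N) (y + Y N)) ?Z) \<le> K * P * Q"
    by (rule step.IH[OF xyA(1,2)]) (use sg[of _ 1] in auto)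
  have minus: "nrm E (add E (\<beta> (x - X N) (y - Y N)) ?Z) \<le> K * P * Q"
    by (rule step.IH[OF xyA(3,4)]) (use sg[of _ "- 1"] in auto)
  have c: "\<beta> x y \<in> car E" "\<beta> (X N) (Y N) \<in> car E" "\<beta> (x + X N) (y + Y N) \<in> car E" "\<beta> (x - X N) (y - Y N) \<in> car E"
    using step.prems XY xyA by auto
  have "sub E (psum X Y (Suc N)) (psum X Y M) = add E (\<beta> (X N) (Y N)) ?Z"
    using c XY by (simp add: sub_def add_ac_car)
  then have "add E (\<beta> x y) (sub E (psum X Y (Suc N)) (psum X Y M)) = add E (add E (\<beta> x y) (\<beta> (X N) (Y N))) ?Z"
    using c Z by (simp add: add_assoc)
  also have "\<dots> = add E (scl E (1/2) (add E (\<beta> (x + X N) (y + Y N)) (\<beta> (x - X N) (y - Y N)))) (scl E (1/2) (add E ?Z ?Z))"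
    unfolding beta_polarization[OF step.prems(1,2) XY] using Z by (simp add: half_double)
  also have "\<dots> = scl E (1/2) (add E (add E (\<beta> (x + X N) (y + Y N)) (\<beta> (x - X N) (y - Y N))) (add E ?Z ?Z))"
    using c Z by (simp add: scl_add_right)
  also have "\<dots> = scl E (1/2) (add E (add E (\<beta> (x + X N) (y + Y N)) ?Z) (add E (\<beta> (x - X N) (y - Y N)) ?Z))"
    using c Z by (subst add_interchange) simp_all
  finally have "nrm E (add E (\<beta> x y) (sub E (psum X Y (Suc N)) (psum X Y M))) =
      (1/2) * nrm E (add E (add E (\<beta> (x + X N) (y + Y N)) ?Z) (add E (\<beta> (x - X N) (y - Y N)) ?Z))"
    using c Z by (simp add: nrm_scl)
  also have "\<dots> \<le> (1/2) * (nrm E (add E (\<beta> (x + X N) (y + Y N)) ?Z) + nrm E (add E (\<beta> (x - X N) (y - Y N)) ?Z))"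
    using c Z by (intro mult_left_mono nrm_add_le) auto
  also have "\<dots> \<le> K * P * Q" using plus minus by simp
  finally show ?case .
qed

definition partial_sum :: "'h oper \<Rightarrow> nat \<Rightarrow> 'x" where
  "partial_sum a = psum (\<lambda>n. a o\<^sub>L left_factor h n) (right_factor h)"

lemma partial_sum_car [simp]: "a \<in> A \<Longrightarrow> partial_sum a N \<in> car E"
  unfolding partial_sum_def by (intro psum_car A_compose left_factor_in right_factor_in h_in)

definition left_sum :: "nat \<Rightarrow> 'h oper" where
  "left_sum N = (\<Sum>n<N. left_factor h n)"

lemma left_sum_in: "left_sum N \<in> A"
  unfolding left_sum_def by (intro A_sum left_factor_in h_in)

lemma norm_left_sum: "norm (left_sum N) \<le> 1"
  using norm_approx_unit_le[OF unit_strictly_positive_imp[OF h]]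
  by (cases N) (auto simp: left_sum_def left_factor_telescope simp del: sum.lessThan_Suc)

lemma left_sum_tendsto: "a \<in> A \<Longrightarrow> (\<lambda>N. left_sum N o\<^sub>L a) \<longlonglongrightarrow> a"
  by (rule LIMSEQ_imp_Suc) (simp only: left_sum_def left_factor_telescope approx_unit_tendsto[OF h])

text \<open>Left factors are nonnegative at characters, so signs cannot increase the modulus of
  their sum, which telescopes to a difference of the approximate unit; right factors are dominated
  by nine times the left ones. The first bound becomes small by convergence and the second stays
  bounded, which is enough for a bilinear estimate.\<close>

lemma signed_sum_bounds:
  assumes s: "s \<in> signs" and a: "a \<in> A" and "M \<le> N"
  shows "norm (\<Sum>n\<in>{M..<N}. s n *\<^sub>R (a o\<^sub>L left_factor h n)) \<le> norm ((left_sum N o\<^sub>L a) - (left_sum M o\<^sub>L a))"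
    and "norm (\<Sum>n\<in>{M..<N}. s n *\<^sub>R right_factor h n) \<le> 9"
proof -
  have f: "left_factor h n \<in> A" "right_factor h n \<in> A" for n
    by (rule left_factor_in[OF h_in], rule right_factor_in[OF h_in])
  have left_sum_diff: "left_sum N - left_sum M = (\<Sum>n\<in>{M..<N}. left_factor h n)"
    using \<open>M \<le> N\<close> unfolding left_sum_def lessThan_atLeast0 by (simp add: sum_diff_nat_ivl)
  have s1: "\<bar>s n\<bar> = 1" for n
  proof -
    have "s n = 1 \<or> s n = - 1" using s by (simp add: signs_def)
    then show ?thesis by auto
  qed
  have vals: "\<exists>r. 0 \<le> r \<and> \<theta> (left_factor h n) = of_real r \<and> cmod (\<theta> (right_factor h n)) \<le> 9 * r"
    if "\<theta> \<in> chars" for \<theta> n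
    using factor_values[OF unit_strictly_positive_imp[OF h] that, of n] by metis
  show "norm (\<Sum>n\<in>{M..<N}. s n *\<^sub>R (a o\<^sub>L left_factor h n)) \<le> norm ((left_sum N o\<^sub>L a) - (left_sum M o\<^sub>L a))"
  proof (rule norm_le_of_characters)
    fix \<theta> assume th: "\<theta> \<in> chars"
    obtain r where r: "\<And>n. 0 \<le> r n" "\<And>n. \<theta> (left_factor h n) = of_real (r n)" using vals[OF th] by metis
    have "\<theta> (\<Sum>n\<in>{M..<N}. s n *\<^sub>R (a o\<^sub>L left_factor h n)) = (\<Sum>n\<in>{M..<N}. of_real (s n * r n) * \<theta> a)"
      using th a f r by (subst chi_sum) (auto simp: chi_simps A_intros mult_ac)
    then have "cmod (\<theta> (\<Sum>n\<in>{M..<N}. s n *\<^sub>R (a o\<^sub>L left_factor h n))) \<le> (\<Sum>n\<in>{M..<N}. r n * cmod (\<theta> a))"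
      using r s1 by (auto intro!: sum_norm_le simp: norm_mult abs_mult simp del: of_real_mult)
    also have "\<dots> = \<bar>\<Sum>n\<in>{M..<N}. r n\<bar> * cmod (\<theta> a)" using r by (simp add: sum_distrib_right sum_nonneg)
    also have "\<dots> = cmod (\<theta> ((left_sum N - left_sum M) o\<^sub>L a))"
    proof -
      have "\<theta> (left_sum N - left_sum M) = of_real (\<Sum>n\<in>{M..<N}. r n)"
        unfolding left_sum_diff using th f r by (subst chi_sum) auto
      then show ?thesis
        using chi_compose[OF th A_diff[OF left_sum_in left_sum_in] a, of N M] by (simp add: norm_mult del: of_real_sum)
    qed
    also have "\<dots> \<le> norm ((left_sum N - left_sum M) o\<^sub>L a)" by (intro cmod_chi_le th A_intros left_sum_in a)
    finally show "cmod (\<theta> (\<Sum>n\<in>{M..<N}. s n *\<^sub>R (a o\<^sub>L left_factor h n))) \<le> norm ((left_sum N o\<^sub>L a) - (left_sum M o\<^sub>L a))"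
      by (simp add: bcomp_simps)
  qed (use a f in \<open>auto intro!: A_intros\<close>)
  show "norm (\<Sum>n\<in>{M..<N}. s n *\<^sub>R right_factor h n) \<le> 9"
  proof (rule norm_le_of_characters)
    fix \<theta> assume th: "\<theta> \<in> chars"
    obtain r where r: "\<And>n. 0 \<le> r n" "\<And>n. \<theta> (left_factor h n) = of_real (r n)"
      "\<And>n. cmod (\<theta> (right_factor h n)) \<le> 9 * r n" using vals[OF th] by metis
    have "\<theta> (\<Sum>n\<in>{M..<N}. s n *\<^sub>R right_factor h n) = (\<Sum>n\<in>{M..<N}. of_real (s n) * \<theta> (right_factor h n))"
      using th f by (subst chi_sum) (auto simp: chi_simps A_intros)
    then have "cmod (\<theta> (\<Sum>n\<in>{M..<N}. s n *\<^sub>R right_factor h n)) \<le> (\<Sum>n\<in>{M..<N}. 9 * r n)"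
      using r(3) s1 by (auto intro!: sum_norm_le simp: norm_mult)
    also have "\<dots> \<le> (\<Sum>n<N. 9 * r n)" using r(1) by (intro sum_mono2) auto
    also have "\<dots> = 9 * \<bar>\<Sum>n<N. r n\<bar>" using r(1) by (simp add: sum_distrib_left sum_nonneg)
    also have "\<bar>\<Sum>n<N. r n\<bar> = cmod (\<theta> (left_sum N))"
    proof -
      have "\<theta> (left_sum N) = of_real (\<Sum>n<N. r n)"
        unfolding left_sum_def using th f r by (subst chi_sum) auto
      then show ?thesis by (simp del: of_real_sum)
    qed
    also have "9 * \<dots> \<le> 9 * 1"
      using order_trans[OF cmod_chi_le[OF th left_sum_in] norm_left_sum] by simp
    finally show "cmod (\<theta> (\<Sum>n\<in>{M..<N}. s n *\<^sub>R right_factor h n)) \<le> 9" by simp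
  qed (use f in \<open>auto intro!: A_intros\<close>)
qed

lemma beta_zero: "\<beta> 0 0 = zer E"
  using beta_scale_left[of 0 0 0] by (simp add: A_zero)

lemma partial_sum_diff_bound:
  assumes a: "a \<in> A" and "M \<le> N"
  shows "nrm E (sub E (partial_sum a N) (partial_sum a M)) \<le> K * norm ((left_sum N o\<^sub>L a) - (left_sum M o\<^sub>L a)) * 9"
proof -
  have "nrm E (add E (\<beta> 0 0) (sub E (partial_sum a N) (partial_sum a M))) \<le> K * norm ((left_sum N o\<^sub>L a) - (left_sum M o\<^sub>L a)) * 9"
    unfolding partial_sum_def
    by (rule psum_block_bound)
      (use assms signed_sum_bounds[OF _ a \<open>M \<le> N\<close>] in \<open>auto intro!: A_intros left_factor_in right_factor_in h_in\<close>)
  then show ?thesis using a by (simp add: beta_zero)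
qed

lemma nrm_partial_sum: "a \<in> A \<Longrightarrow> nrm E (partial_sum a N) \<le> 9 * K * norm a"
proof -
  assume a: "a \<in> A"
  have "nrm E (sub E (partial_sum a N) (partial_sum a 0)) \<le> K * norm ((left_sum N o\<^sub>L a) - (left_sum 0 o\<^sub>L a)) * 9" by (rule partial_sum_diff_bound[OF a]) simp
  then have "nrm E (partial_sum a N) \<le> K * norm (left_sum N o\<^sub>L a) * 9"
    using a partial_sum_car[OF a, of N] by (simp add: partial_sum_def left_sum_def)
  also have "\<dots> \<le> K * (1 * norm a) * 9"
    using norm_left_sum[of N] K by (intro mult_right_mono mult_left_mono order_trans[OF norm_blinfun_compose]) auto
  finally show ?thesis by (simp add: mult_ac)
qed

lemma ex_partial_sum_limit:
  assumes a: "a \<in> A"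
  shows "\<exists>l\<in>car E. tends_in E (partial_sum a) l"
proof (rule complete)
  show "\<forall>e>0. \<exists>N. \<forall>m\<ge>N. \<forall>n\<ge>N. nrm E (sub E (partial_sum a m) (partial_sum a n)) < e"
  proof (intro allI impI)
    fix e :: real assume e: "e > 0"
    have "Cauchy (\<lambda>N. left_sum N o\<^sub>L a)" using left_sum_tendsto[OF a] LIMSEQ_imp_Cauchy by blast
    \<comment> \<open>Adding one allows K = 0.\<close>
    moreover have pos: "e / (9 * K + 1) > 0" using e K by (intro divide_pos_pos) auto
    ultimately obtain N where N: "\<And>m n. m \<ge> N \<Longrightarrow> n \<ge> N \<Longrightarrow> norm ((left_sum m o\<^sub>L a) - (left_sum n o\<^sub>L a)) < e / (9 * K + 1)"
      unfolding Cauchy_def dist_norm by meson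
    have small: "nrm E (sub E (partial_sum a m) (partial_sum a n)) < e" if "m \<ge> N" "n \<ge> N" "n \<le> m" for m n
    proof -
      have "nrm E (sub E (partial_sum a m) (partial_sum a n)) \<le> 9 * K * norm ((left_sum m o\<^sub>L a) - (left_sum n o\<^sub>L a))"
        using partial_sum_diff_bound[OF a that(3)] by (simp add: mult_ac)
      also have "\<dots> \<le> 9 * K * (e / (9 * K + 1))" using N[OF that(1,2)] K by (intro mult_left_mono) auto
      also have "\<dots> < e" using e K by (simp add: field_simps)
      finally show ?thesis .
    qed
    have "nrm E (sub E (partial_sum a m) (partial_sum a n)) < e" if "m \<ge> N" "n \<ge> N" for m n
      using small[OF that] small[OF that(2,1)] nrm_sub_commute[OF partial_sum_car[OF a] partial_sum_car[OF a], of m n] by (cases "n \<le> m") auto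
    then show "\<exists>N. \<forall>m\<ge>N. \<forall>n\<ge>N. nrm E (sub E (partial_sum a m) (partial_sum a n)) < e" by blast
  qed
qed (simp add: a)

definition diagonal_limit :: "'h oper \<Rightarrow> 'x" where
  "diagonal_limit a = (SOME l. l \<in> car E \<and> tends_in E (partial_sum a) l)"

lemma
  assumes "a \<in> A"
  shows diagonal_limit_car [simp]: "diagonal_limit a \<in> car E" and diagonal_limit_tends: "tends_in E (partial_sum a) (diagonal_limit a)"
proof -
  have "\<exists>l. l \<in> car E \<and> tends_in E (partial_sum a) l" using ex_partial_sum_limit[OF assms] by blast
  then have "diagonal_limit a \<in> car E \<and> tends_in E (partial_sum a) (diagonal_limit a)" unfolding diagonal_limit_def by (rule someI_ex)
  then show "diagonal_limit a \<in> car E" "tends_in E (partial_sum a) (diagonal_limit a)" by auto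
qed

lemma diagonal_limit_eqI: "a \<in> A \<Longrightarrow> l \<in> car E \<Longrightarrow> tends_in E (partial_sum a) l \<Longrightarrow> diagonal_limit a = l"
  using tends_in_unique[of "partial_sum a" "diagonal_limit a" l] diagonal_limit_tends by simp

lemma partial_sum_Suc: "partial_sum a (Suc n) = add E (partial_sum a n) (\<beta> (a o\<^sub>L left_factor h n) (right_factor h n))"
  by (simp add: partial_sum_def)

lemma partial_sum_0 [simp]: "partial_sum a 0 = zer E"
  by (simp add: partial_sum_def)

lemma partial_sum_add: "a \<in> A \<Longrightarrow> b \<in> A \<Longrightarrow> partial_sum (a + b) N = add E (partial_sum a N) (partial_sum b N)"
proof (induction N)
  case (Suc N)
  have f: "left_factor h N \<in> A" "right_factor h N \<in> A" by (rule left_factor_in[OF h_in], rule right_factor_in[OF h_in])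
  have "partial_sum (a + b) (Suc N) = add E (add E (partial_sum a N) (partial_sum b N))
      (add E (\<beta> (a o\<^sub>L left_factor h N) (right_factor h N)) (\<beta> (b o\<^sub>L left_factor h N) (right_factor h N)))"
    using Suc f by (simp add: partial_sum_Suc blinfun_compose.add_left beta_add_left A_compose)
  then show ?case using Suc.prems f unfolding partial_sum_Suc by (subst add_interchange) (auto simp: A_compose)
qed simp

lemma partial_sum_scale: "a \<in> A \<Longrightarrow> partial_sum (op_scale c a) N = scl E c (partial_sum a N)"
proof (induction N)
  case (Suc N)
  have f: "left_factor h N \<in> A" "right_factor h N \<in> A" by (rule left_factor_in[OF h_in], rule right_factor_in[OF h_in])
  show ?case using Suc f by (simp add: partial_sum_Suc op_scale_compose_left beta_scale_left A_compose scl_add_right)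
qed simp

lemma bounded_clinear_scl: "bounded_clinear_on E E (scl E c)"
  unfolding bounded_clinear_on_def clinear_on_def
  by (auto simp: scl_add_right scl_scl mult.commute nrm_scl intro!: exI[of _ "cmod c"])

lemma bounded_clinear_diagonal_limit: "bounded_clinear_on (regular_module A) E diagonal_limit"
  unfolding bounded_clinear_on_def clinear_on_def
proof (intro conjI ballI allI exI)
  fix a assume "a \<in> car (regular_module A)"
  then have a: "a \<in> A" by simp
  show "diagonal_limit a \<in> car E" using a by simp
  show "nrm E (diagonal_limit a) \<le> (9 * K) * nrm (regular_module A) a"
    using nrm_tends_in_le[OF partial_sum_car[OF a] diagonal_limit_car[OF a] diagonal_limit_tends[OF a] nrm_partial_sum[OF a]] by simp
  show "diagonal_limit (scl (regular_module A) c a) = scl E c (diagonal_limit a)" for c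
  proof -
    have "tends_in E (\<lambda>n. scl E c (partial_sum a n)) (scl E c (diagonal_limit a))"
      by (rule bounded_clinear_tends_in[OF E E bounded_clinear_scl]) (simp_all add: a diagonal_limit_tends)
    then have "tends_in E (partial_sum (op_scale c a)) (scl E c (diagonal_limit a))" using a by (simp add: tends_in_def partial_sum_scale)
    then show ?thesis using a by (simp add: diagonal_limit_eqI A_intros)
  qed
  fix b assume "b \<in> car (regular_module A)"
  then have b: "b \<in> A" by simp
  have "tends_in E (\<lambda>n. add E (partial_sum a n) (partial_sum b n)) (add E (diagonal_limit a) (diagonal_limit b))"
    by (rule tends_in_add) (simp_all add: a b diagonal_limit_tends)
  then have "tends_in E (partial_sum (a + b)) (add E (diagonal_limit a) (diagonal_limit b))" using a b by (simp add: tends_in_def partial_sum_add)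
  then show "diagonal_limit (add (regular_module A) a b) = add E (diagonal_limit a) (diagonal_limit b)" using a b by (simp add: diagonal_limit_eqI A_intros)
qed

end

context comm_cstar
begin

section \<open>Vanishing of the second cohomology group\<close>

text \<open>With zero right action the cocycle identity reads f (a b, c) = a f (b, c) + f (a, b c).
  Summed over b times a left factor in the second place and the matching right factor in the third,
  it becomes G (a b) = a G b + f (a, b) in the limit, since the products of the factors sum to one
  on b. Hence f is the coboundary of -G.\<close>

lemma unit_strictly_positive_imp_cocycle_splits:
  assumes h: "unit_strictly_positive h"
    and X: "banach_bimodule A X" "right_annihilator A X"
    and f: "f \<in> cocycles2 A X"
  shows "f \<in> coboundaries2 A X"
proof -
  have E: "complex_banach_space X" using X by (simp add: banach_bimodule_def left_banach_module_def)
  obtain K where fr: "\<forall>a\<in>A. clinear_on AA X (\<lambda>b. f (a, b))" and fl: "\<forall>b\<in>A. clinear_on AA X (\<lambda>a. f (a, b))"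
    and fb: "\<forall>a\<in>A. \<forall>b\<in>A. nrm X (f (a, b)) \<le> K * norm a * norm b"
    and fext: "f \<in> extensional (A \<times> A)" and cob: "coboundary2 A X f = (\<lambda>_\<in>A \<times> A \<times> A. zer X)"
    using f unfolding cocycles2_def cochains2_def by blast
  have fb': "nrm X (f (a, b)) \<le> \<bar>K\<bar> * norm a * norm b" if "a \<in> A" "b \<in> A" for a b
  proof -
    have "K * norm a * norm b \<le> \<bar>K\<bar> * norm a * norm b" by (intro mult_right_mono) auto
    then show ?thesis using fb that by (meson order_trans)
  qed
  interpret D: diagonal_sum A X "\<lambda>a b. f (a, b)" "\<bar>K\<bar>" h
    by unfold_locales (use E fr fl fb' h in auto)
  have lact: "clinear_on X X (lact X a)" "\<And>x. x \<in> car X \<Longrightarrow> lact X a x \<in> car X" if "a \<in> A" for a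
    using X that unfolding banach_bimodule_def left_banach_module_def clinear_on_def by auto
  have lact_b: "bounded_clinear_on X X (lact X a)" if "a \<in> A" for a
  proof -
    obtain C where "\<forall>a\<in>A. \<forall>x\<in>car X. nrm X (lact X a x) \<le> C * norm a * nrm X x"
      using X unfolding banach_bimodule_def left_banach_module_def by blast
    then show ?thesis using lact(1)[OF that] that unfolding bounded_clinear_on_def by blast
  qed
  have fcar: "f (a, b) \<in> car X" if "a \<in> A" "b \<in> A" for a b using D.beta_car that by blast
  have cocycle: "f (a o\<^sub>L b, c) = add X (lact X a (f (b, c))) (f (a, b o\<^sub>L c))"
    if abc: "a \<in> A" "b \<in> A" "c \<in> A" for a b c
  proof -
    have "coboundary2 A X f (a, b, c) = zer X" using cob abc by simp
    then have "sub X (add X (sub X (lact X a (f (b, c))) (f (a o\<^sub>L b, c))) (f (a, b o\<^sub>L c))) (zer X) = zer X"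
      using abc X(2) fcar[OF abc(1,2)] by (simp add: coboundary2_def right_annihilator_def)
    then have "add X (sub X (lact X a (f (b, c))) (f (a o\<^sub>L b, c))) (f (a, b o\<^sub>L c)) = zer X"
      using abc fcar lact(2) by (simp add: A_intros)
    moreover have "add X (sub X (lact X a (f (b, c))) (f (a o\<^sub>L b, c))) (f (a, b o\<^sub>L c))
        = sub X (add X (lact X a (f (b, c))) (f (a, b o\<^sub>L c))) (f (a o\<^sub>L b, c))"
      using abc fcar lact(2) by (simp add: sub_def D.add_ac_car A_intros)
    ultimately show ?thesis using abc fcar lact(2) by (simp add: D.sub_eq_zer A_intros)
  qed
  have partial_sum_cocycle: "D.partial_sum (a o\<^sub>L b) N = add X (lact X a (D.partial_sum b N)) (f (a, \<Sum>n<N. (b o\<^sub>L left_factor h n) o\<^sub>L right_factor h n))"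
    if ab: "a \<in> A" "b \<in> A" for a b N
  proof (induction N)
    case 0
    have "f (a, 0) = zer X" using clinear_on_zer[OF complex_banach_space_AA E bspec[OF fr ab(1)]] by simp
    moreover have "lact X a (zer X) = zer X" using clinear_on_zer[OF E E lact(1)[OF ab(1)]] .
    ultimately show ?case by simp
  next
    case (Suc N)
    let ?l = "b o\<^sub>L left_factor h N" and ?r = "right_factor h N"
    let ?s = "\<Sum>n<N. (b o\<^sub>L left_factor h n) o\<^sub>L right_factor h n"
    have m: "?l \<in> A" "?r \<in> A" "?s \<in> A" "?l o\<^sub>L ?r \<in> A"
      using ab by (auto intro!: A_intros left_factor_in right_factor_in D.h_in)
    have "f ((a o\<^sub>L b) o\<^sub>L left_factor h N, ?r) = add X (lact X a (f (?l, ?r))) (f (a, ?l o\<^sub>L ?r))"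
      using cocycle[OF ab(1) m(1,2)] by (simp add: blinfun_compose_assoc)
    then have "D.partial_sum (a o\<^sub>L b) (Suc N) = add X (add X (lact X a (D.partial_sum b N)) (f (a, ?s))) (add X (lact X a (f (?l, ?r))) (f (a, ?l o\<^sub>L ?r)))"
      by (simp add: D.partial_sum_Suc Suc)
    also have "\<dots> = add X (add X (lact X a (D.partial_sum b N)) (lact X a (f (?l, ?r)))) (add X (f (a, ?s)) (f (a, ?l o\<^sub>L ?r)))"
      using ab m fcar lact(2) by (intro D.add_interchange) auto
    also have "add X (lact X a (D.partial_sum b N)) (lact X a (f (?l, ?r))) = lact X a (D.partial_sum b (Suc N))"
      using lact(1)[OF ab(1)] ab m fcar by (simp add: clinear_on_def D.partial_sum_Suc)
    also have "add X (f (a, ?s)) (f (a, ?l o\<^sub>L ?r)) = f (a, \<Sum>n<Suc N. (b o\<^sub>L left_factor h n) o\<^sub>L right_factor h n)"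
      using D.beta_add_right[OF ab(1) m(3,4)] by simp
    finally show ?case .
  qed
  have diagonal_limit_eq: "D.diagonal_limit (a o\<^sub>L b) = add X (lact X a (D.diagonal_limit b)) (f (a, b))" if ab: "a \<in> A" "b \<in> A" for a b
  proof (rule D.diagonal_limit_eqI)
    have "tends_in X (\<lambda>n. lact X a (D.partial_sum b n)) (lact X a (D.diagonal_limit b))"
      by (rule bounded_clinear_tends_in[OF E E lact_b[OF ab(1)]]) (simp_all add: ab D.diagonal_limit_tends)
    moreover have "tends_in X (\<lambda>N. f (a, \<Sum>n<N. (b o\<^sub>L left_factor h n) o\<^sub>L right_factor h n)) (f (a, b))"
    proof (rule bounded_clinear_tends_in[OF complex_banach_space_AA E])
      show "bounded_clinear_on AA X (\<lambda>b. f (a, b))"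
        unfolding bounded_clinear_on_def using fr fb ab(1) by (auto intro!: exI[of _ "K * norm a"])
      show "tends_in AA (\<lambda>N. \<Sum>n<N. (b o\<^sub>L left_factor h n) o\<^sub>L right_factor h n) b"
        unfolding tends_in_AA by (rule factor_product_sum_tendsto[OF h ab(2)])
    qed (use ab in \<open>auto intro!: A_intros left_factor_in right_factor_in D.h_in\<close>)
    ultimately have "tends_in X (\<lambda>N. add X (lact X a (D.partial_sum b N)) (f (a, \<Sum>n<N. (b o\<^sub>L left_factor h n) o\<^sub>L right_factor h n)))
        (add X (lact X a (D.diagonal_limit b)) (f (a, b)))"
      using ab by (intro D.tends_in_add) (auto intro!: lact(2) fcar A_intros left_factor_in right_factor_in D.h_in)
    then show "tends_in X (D.partial_sum (a o\<^sub>L b)) (add X (lact X a (D.diagonal_limit b)) (f (a, b)))"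
      using ab by (simp add: tends_in_def partial_sum_cocycle)
  qed (use ab in \<open>auto intro!: A_intros D.add_car lact(2) fcar\<close>)
  define g where "g = (\<lambda>a\<in>A. scl X (- 1) (D.diagonal_limit a))"
  have Gb: "bounded_clinear_on AA X D.diagonal_limit" by (rule D.bounded_clinear_diagonal_limit)
  have "g \<in> cochains1 A X"
  proof -
    have "g \<in> extensional A" by (simp add: g_def)
    moreover obtain C where C: "clinear_on AA X D.diagonal_limit" "\<forall>x\<in>A. nrm X (D.diagonal_limit x) \<le> C * norm x"
      using Gb unfolding bounded_clinear_on_def by auto
    have "clinear_on AA X g"
      using C(1) unfolding clinear_on_def by (auto simp: g_def A_intros D.scl_add_right D.scl_scl)
    moreover have "\<forall>x\<in>A. nrm X (g x) \<le> C * norm x" using C(2) by (simp add: g_def D.nrm_scl)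
    ultimately show ?thesis by (auto simp: cochains1_def bounded_clinear_on_def)
  qed
  moreover have "f = coboundary1 A X g"
  proof (rule extensionalityI[OF fext])
    show "coboundary1 A X g \<in> extensional (A \<times> A)" by (simp add: coboundary1_def)
    fix p assume "p \<in> A \<times> A"
    then obtain a b where p: "p = (a, b)" and ab: "a \<in> A" "b \<in> A" by auto
    let ?u = "lact X a (D.diagonal_limit b)" and ?v = "f (a, b)"
    have c: "?u \<in> car X" "?v \<in> car X" using ab fcar lact(2) by auto
    have "lact X a (scl X (- 1) (D.diagonal_limit b)) = scl X (- 1) ?u" using lact(1)[OF ab(1)] ab by (simp add: clinear_on_def)
    then have "coboundary1 A X g (a, b) = add X (sub X (scl X (- 1) ?u) (scl X (- 1) (add X ?u ?v))) (zer X)"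
      using ab X(2) diagonal_limit_eq[OF ab] by (simp add: coboundary1_def g_def A_intros right_annihilator_def)
    also have "\<dots> = add X (scl X (- 1) ?u) (add X ?u ?v)"
      using c by (simp add: sub_def D.scl_scl)
    also have "\<dots> = ?v" using c by (simp add: D.add_assoc[symmetric] D.add_comm[of "scl X (- 1) ?u" ?u])
    finally show "f p = coboundary1 A X g p" by (simp add: p)
  qed
  ultimately show ?thesis by (auto simp: coboundaries2_def)
qed

end

text \<open>The cancellation behind the cocycle identity of \<open>module_defect\<close>.\<close>

lemma (in carrier_banach) alternating_sub_sum:
  assumes "p \<in> car E" "q \<in> car E" "t \<in> car E"
  shows "add E (sub E (sub E p q) (sub E p t)) (sub E q t) = zer E"
proof -
  define u v where "u = sub E p q" and "v = sub E q t"
  have c: "u \<in> car E" "v \<in> car E" using assms by (auto simp: u_def v_def)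
  have "p = add E u q" "q = add E v t" using assms by (simp_all add: u_def v_def sub_add_cancel)
  then have "p = add E (add E u v) t" using c assms by (metis add_assoc)
  then have "sub E p t = add E u v" using c assms sub_eq_iff[of p t "add E u v"] by simp
  then have "sub E (sub E p q) (sub E p t) = scl E (- 1) v"
    using c by (simp add: u_def[symmetric] sub_def[of E u] scl_add_right add_neg_cancel)
  then show ?thesis using c by (simp add: v_def[symmetric] add_comm[of "scl E (- 1) v"])
qed

section \<open>Module defects, coboundaries and the cohomology group\<close>

context comm_cstar
begin

lemma left_banach_moduleD:
  assumes "left_banach_module A Y"
  shows "complex_banach_space Y" and "a \<in> A \<Longrightarrow> clinear_on Y Y (lact Y a)"
    and "x \<in> car Y \<Longrightarrow> clinear_on AA Y (\<lambda>a. lact Y a x)"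
    and "a \<in> A \<Longrightarrow> b \<in> A \<Longrightarrow> x \<in> car Y \<Longrightarrow> lact Y (a o\<^sub>L b) x = lact Y a (lact Y b x)"
    and "a \<in> A \<Longrightarrow> x \<in> car Y \<Longrightarrow> lact Y a x \<in> car Y"
    and "\<exists>K\<ge>0. \<forall>a\<in>A. \<forall>x\<in>car Y. nrm Y (lact Y a x) \<le> K * norm a * nrm Y x"
proof -
  show Y: "complex_banach_space Y" and cl: "a \<in> A \<Longrightarrow> clinear_on Y Y (lact Y a)"
    and "x \<in> car Y \<Longrightarrow> clinear_on AA Y (\<lambda>a. lact Y a x)"
    and "a \<in> A \<Longrightarrow> b \<in> A \<Longrightarrow> x \<in> car Y \<Longrightarrow> lact Y (a o\<^sub>L b) x = lact Y a (lact Y b x)" for a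
    using assms by (auto simp: left_banach_module_def)
  then show "a \<in> A \<Longrightarrow> x \<in> car Y \<Longrightarrow> lact Y a x \<in> car Y" by (auto simp: clinear_on_def)
  interpret Y: carrier_banach Y by standard (rule Y)
  obtain K where K: "\<forall>a\<in>A. \<forall>x\<in>car Y. nrm Y (lact Y a x) \<le> K * norm a * nrm Y x"
    using assms unfolding left_banach_module_def by blast
  have "nrm Y (lact Y a x) \<le> \<bar>K\<bar> * norm a * nrm Y x" if "a \<in> A" "x \<in> car Y" for a x
  proof -
    have "K * norm a * nrm Y x \<le> \<bar>K\<bar> * norm a * nrm Y x" using that by (intro mult_right_mono) auto
    moreover have "nrm Y (lact Y a x) \<le> K * norm a * nrm Y x" using K that by blast
    ultimately show ?thesis by linarith
  qed
  then show "\<exists>K\<ge>0. \<forall>a\<in>A. \<forall>x\<in>car Y. nrm Y (lact Y a x) \<le> K * norm a * nrm Y x"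
    by (intro exI[of _ "\<bar>K\<bar>"]) auto
qed

text \<open>The failure of a linear map to be a module morphism. For zero right action it is also
  its Hochschild coboundary, which links splittings with cohomology.\<close>

definition module_defect :: "('h oper, 'x, 'm) left_struct_scheme \<Rightarrow> ('h oper \<Rightarrow> 'x) \<Rightarrow> 'h oper \<Rightarrow> 'h oper \<Rightarrow> 'x" where
  "module_defect Y \<sigma> a b = sub Y (lact Y a (\<sigma> b)) (\<sigma> (a o\<^sub>L b))"

lemma module_defect:
  assumes Y: "left_banach_module A Y" and s: "bounded_clinear_on AA Y \<sigma>"
  shows module_defect_car: "a \<in> A \<Longrightarrow> b \<in> A \<Longrightarrow> module_defect Y \<sigma> a b \<in> car Y"
    and module_defect_right: "a \<in> A \<Longrightarrow> clinear_on AA Y (module_defect Y \<sigma> a)"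
    and module_defect_left: "b \<in> A \<Longrightarrow> clinear_on AA Y (\<lambda>a. module_defect Y \<sigma> a b)"
    and module_defect_bound: "\<exists>K. \<forall>a\<in>A. \<forall>b\<in>A. nrm Y (module_defect Y \<sigma> a b) \<le> K * norm a * norm b"
    and module_defect_cocycle: "a \<in> A \<Longrightarrow> b \<in> A \<Longrightarrow> c \<in> A \<Longrightarrow>
      add Y (sub Y (lact Y a (module_defect Y \<sigma> b c)) (module_defect Y \<sigma> (a o\<^sub>L b) c))
        (module_defect Y \<sigma> a (b o\<^sub>L c)) = zer Y"
proof -
  note YD = left_banach_moduleD[OF Y]
  interpret Y: carrier_banach Y by standard (rule YD)
  have sc: "\<sigma> a \<in> car Y" if "a \<in> A" for a
    using s that by (auto simp: bounded_clinear_on_def clinear_on_def)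
  have sl: "a \<in> A \<Longrightarrow> b \<in> A \<Longrightarrow> \<sigma> (a + b) = add Y (\<sigma> a) (\<sigma> b)"
    "a \<in> A \<Longrightarrow> \<sigma> (op_scale z a) = scl Y z (\<sigma> a)" for a b z
    using s by (auto simp: bounded_clinear_on_def clinear_on_def)
  have ll: "a \<in> A \<Longrightarrow> x \<in> car Y \<Longrightarrow> y \<in> car Y \<Longrightarrow> lact Y a (add Y x y) = add Y (lact Y a x) (lact Y a y)"
    "a \<in> A \<Longrightarrow> x \<in> car Y \<Longrightarrow> lact Y a (scl Y z x) = scl Y z (lact Y a x)" for a x y z
    using YD(2)[of a] by (auto simp: clinear_on_def)
  have lr: "a \<in> A \<Longrightarrow> b \<in> A \<Longrightarrow> x \<in> car Y \<Longrightarrow> lact Y (a + b) x = add Y (lact Y a x) (lact Y b x)"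
    "a \<in> A \<Longrightarrow> x \<in> car Y \<Longrightarrow> lact Y (op_scale z a) x = scl Y z (lact Y a x)" for a b x z
    using YD(3)[of x] by (auto simp: clinear_on_def)
  note sc' = sc YD(5) A_intros
  show car: "module_defect Y \<sigma> a b \<in> car Y" if "a \<in> A" "b \<in> A" for a b
    using that by (simp add: module_defect_def sc')
  show "clinear_on AA Y (module_defect Y \<sigma> a)" if a: "a \<in> A" for a
    unfolding clinear_on_def
  proof (intro conjI ballI allI)
    fix x z assume x: "x \<in> car AA"
    show "module_defect Y \<sigma> a x \<in> car Y" using car a x by simp
    show "module_defect Y \<sigma> a (scl AA z x) = scl Y z (module_defect Y \<sigma> a x)"
      using a x by (simp add: module_defect_def op_scale_compose_right A_bounded_operators sl ll sc' Y.scl_sub)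
    fix y assume y: "y \<in> car AA"
    show "module_defect Y \<sigma> a (add AA x y) = add Y (module_defect Y \<sigma> a x) (module_defect Y \<sigma> a y)"
      using a x y by (simp add: module_defect_def blinfun_compose.add_right sl ll sc' Y.sub_add_sub)
  qed
  show "clinear_on AA Y (\<lambda>a. module_defect Y \<sigma> a b)" if b: "b \<in> A" for b
    unfolding clinear_on_def
  proof (intro conjI ballI allI)
    fix x z assume x: "x \<in> car AA"
    show "module_defect Y \<sigma> x b \<in> car Y" using car b x by simp
    show "module_defect Y \<sigma> (scl AA z x) b = scl Y z (module_defect Y \<sigma> x b)"
      using b x by (simp add: module_defect_def op_scale_compose_left sl lr sc' Y.scl_sub)
    fix y assume y: "y \<in> car AA"
    show "module_defect Y \<sigma> (add AA x y) b = add Y (module_defect Y \<sigma> x b) (module_defect Y \<sigma> y b)"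
      using b x y by (simp add: module_defect_def blinfun_compose.add_left sl lr sc' Y.sub_add_sub)
  qed
  show "\<exists>K. \<forall>a\<in>A. \<forall>b\<in>A. nrm Y (module_defect Y \<sigma> a b) \<le> K * norm a * norm b"
  proof -
    obtain K where K: "K \<ge> 0" "\<forall>a\<in>A. \<forall>x\<in>car Y. nrm Y (lact Y a x) \<le> K * norm a * nrm Y x" using YD(6) by blast
    obtain L where L: "\<forall>x\<in>A. nrm Y (\<sigma> x) \<le> L * norm x" using s by (auto simp: bounded_clinear_on_def)
    have "nrm Y (module_defect Y \<sigma> a b) \<le> (K * \<bar>L\<bar> + \<bar>L\<bar>) * norm a * norm b" if ab: "a \<in> A" "b \<in> A" for a b
    proof -
      have L': "nrm Y (\<sigma> x) \<le> \<bar>L\<bar> * norm x" if "x \<in> A" for x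
      proof -
        have "L * norm x \<le> \<bar>L\<bar> * norm x" by (intro mult_right_mono) auto
        then show ?thesis using L that by (meson order_trans)
      qed
      have "nrm Y (module_defect Y \<sigma> a b) \<le> nrm Y (lact Y a (\<sigma> b)) + nrm Y (\<sigma> (a o\<^sub>L b))"
        unfolding module_defect_def sub_def
        using ab by (intro order_trans[OF Y.nrm_add_le]) (auto simp: sc' Y.nrm_scl)
      also have "nrm Y (lact Y a (\<sigma> b)) \<le> K * norm a * nrm Y (\<sigma> b)" using K(2) ab sc by blast
      also have "\<dots> \<le> K * norm a * (\<bar>L\<bar> * norm b)" using L'[OF ab(2)] K(1) by (intro mult_left_mono) auto
      also have "nrm Y (\<sigma> (a o\<^sub>L b)) \<le> \<bar>L\<bar> * norm (a o\<^sub>L b)" using L' ab A_compose by blast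
      also have "\<dots> \<le> \<bar>L\<bar> * (norm a * norm b)" by (intro mult_left_mono norm_blinfun_compose) auto
      finally show ?thesis by (simp add: algebra_simps)
    qed
    then show ?thesis by blast
  qed
  show "add Y (sub Y (lact Y a (module_defect Y \<sigma> b c)) (module_defect Y \<sigma> (a o\<^sub>L b) c))
      (module_defect Y \<sigma> a (b o\<^sub>L c)) = zer Y" if abc: "a \<in> A" "b \<in> A" "c \<in> A" for a b c
  proof -
    have "lact Y a (module_defect Y \<sigma> b c) = sub Y (lact Y a (lact Y b (\<sigma> c))) (lact Y a (\<sigma> (b o\<^sub>L c)))"
      unfolding module_defect_def using abc
      by (intro clinear_on_sub[OF YD(1) YD(2)]) (auto intro!: sc')
    then show ?thesis
      using abc Y.alternating_sub_sum[of "lact Y a (lact Y b (\<sigma> c))" "lact Y a (\<sigma> (b o\<^sub>L c))" "\<sigma> (a o\<^sub>L (b o\<^sub>L c))"]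
      by (simp add: module_defect_def YD(4) sc' blinfun_compose_assoc)
  qed
qed

lemma coboundary1_right_annihilator:
  assumes X: "banach_bimodule A X" "right_annihilator A X"
    and g: "bounded_clinear_on AA X g" "a \<in> A" "b \<in> A"
  shows "coboundary1 A X g (a, b) = module_defect X g a b"
proof -
  have Y: "left_banach_module A X" using X by (simp add: banach_bimodule_def)
  interpret Y: carrier_banach X by standard (rule left_banach_moduleD[OF Y])
  have "g a \<in> car X" using g by (auto simp: bounded_clinear_on_def clinear_on_def)
  then show ?thesis
    using X(2) g module_defect_car[OF Y g(1) g(2,3)]
    by (simp add: coboundary1_def right_annihilator_def module_defect_def)
qed

lemma coboundaries_subset_cocycles:
  assumes X: "banach_bimodule A X" "right_annihilator A X"
  shows "coboundaries2 A X \<subseteq> cocycles2 A X"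
proof
  fix f assume "f \<in> coboundaries2 A X"
  then obtain g where g: "bounded_clinear_on AA X g" "f = coboundary1 A X g"
    by (auto simp: coboundaries2_def cochains1_def)
  have Y: "left_banach_module A X" using X by (simp add: banach_bimodule_def)
  interpret Y: carrier_banach X by standard (rule left_banach_moduleD[OF Y])
  have f: "f (a, b) = module_defect X g a b" if "a \<in> A" "b \<in> A" for a b
    using coboundary1_right_annihilator[OF X g(1) that] g(2) by simp
  note md = module_defect[OF Y g(1)]
  have cong: "clinear_on AA X u \<Longrightarrow> (\<And>x. x \<in> A \<Longrightarrow> v x = u x) \<Longrightarrow> clinear_on AA X v" for u v
    by (auto simp: clinear_on_def A_intros)
  have "f \<in> cochains2 A X"
    unfolding cochains2_def
  proof (intro CollectI conjI ballI)
    show "f \<in> extensional (A \<times> A)" by (simp add: g(2) coboundary1_def)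
    show "clinear_on AA X (\<lambda>b. f (a, b))" if "a \<in> A" for a
      by (rule cong[OF md(2)[OF that]]) (simp add: f that)
    show "clinear_on AA X (\<lambda>a. f (a, b))" if "b \<in> A" for b
      by (rule cong[OF md(3)[OF that]]) (simp add: f that)
    show "\<exists>K. \<forall>a\<in>A. \<forall>b\<in>A. nrm X (f (a, b)) \<le> K * norm a * norm b" using md(4) by (simp add: f)
  qed
  moreover have "coboundary2 A X f = (\<lambda>_\<in>A \<times> A \<times> A. zer X)"
  proof (rule extensionalityI)
    show "coboundary2 A X f \<in> extensional (A \<times> A \<times> A)" by (simp add: coboundary2_def)
    show "(\<lambda>_\<in>A \<times> A \<times> A. zer X) \<in> extensional (A \<times> A \<times> A)" by simp
    fix p assume "p \<in> A \<times> A \<times> A"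
    then obtain a b c where p: "p = (a, b, c)" and abc: "a \<in> A" "b \<in> A" "c \<in> A" by auto
    show "coboundary2 A X f p = (\<lambda>_\<in>A \<times> A \<times> A. zer X) p"
      using abc md(5)[OF abc] md(1)[OF abc(1,2)] X(2)
      by (simp add: p coboundary2_def f A_intros right_annihilator_def)
  qed
  ultimately show "f \<in> cocycles2 A X" by (simp add: cocycles2_def)
qed

lemma zero_coboundary:
  assumes X: "banach_bimodule A X" "right_annihilator A X"
  shows "(\<lambda>p\<in>A \<times> A. zer X) \<in> coboundaries2 A X"
proof -
  have Y: "left_banach_module A X" using X by (simp add: banach_bimodule_def)
  note YD = left_banach_moduleD[OF Y]
  interpret Y: carrier_banach X by standard (rule YD)
  define g where "g = (\<lambda>a\<in>A. zer X)"
  have g: "bounded_clinear_on AA X g"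
    by (auto simp: bounded_clinear_on_def clinear_on_def g_def A_intros intro!: exI[of _ 0])
  have "coboundary1 A X g = (\<lambda>p\<in>A \<times> A. zer X)"
  proof (rule extensionalityI)
    show "coboundary1 A X g \<in> extensional (A \<times> A)" by (simp add: coboundary1_def)
    show "(\<lambda>p\<in>A \<times> A. zer X) \<in> extensional (A \<times> A)" by simp
    fix p assume "p \<in> A \<times> A"
    then obtain a b where p: "p = (a, b)" "a \<in> A" "b \<in> A" by auto
    show "coboundary1 A X g p = (\<lambda>p\<in>A \<times> A. zer X) p"
      unfolding p(1) coboundary1_right_annihilator[OF X g p(2,3)]
      using p(2,3) clinear_on_zer[OF YD(1) YD(1) YD(2)[OF p(2)]] by (simp add: module_defect_def g_def A_intros)
  qed
  then show ?thesis using g unfolding coboundaries2_def cochains1_def by (metis (mono_tags, lifting) g_def image_eqI mem_Collect_eq restrict_extensional)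
qed

text \<open>Once every cocycle is a coboundary, differences of cocycles are coboundaries too, and
  all cocycles form one class.\<close>

lemma unit_strictly_positive_imp_H2_vanishes:
  assumes h: "unit_strictly_positive h"
  shows "H2_vanishes_right_annihilator TYPE('u) A"
  unfolding H2_vanishes_right_annihilator_def
proof (intro allI impI)
  fix X :: "('h oper, 'u) bi_struct"
  assume "banach_bimodule A X \<and> right_annihilator A X"
  then have X: "banach_bimodule A X" "right_annihilator A X" by auto
  have Y: "left_banach_module A X" using X by (simp add: banach_bimodule_def)
  interpret Y: carrier_banach X by standard (rule left_banach_moduleD[OF Y])
  have eq: "cocycles2 A X = coboundaries2 A X"
    using unit_strictly_positive_imp_cocycle_splits[OF h X] coboundaries_subset_cocycles[OF X] by blast
  let ?R = "{(f, f'). f \<in> cocycles2 A X \<and> f' \<in> cocycles2 A X \<and> (\<lambda>p\<in>A \<times> A. sub X (f' p) (f p)) \<in> coboundaries2 A X}"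
  have diff: "(\<lambda>p\<in>A \<times> A. sub X (f' p) (f p)) \<in> coboundaries2 A X"
    if f: "f \<in> coboundaries2 A X" "f' \<in> coboundaries2 A X" for f f'
  proof -
    obtain g where g: "bounded_clinear_on AA X g" "f = coboundary1 A X g"
      using f by (auto simp: coboundaries2_def cochains1_def)
    obtain g' where g': "bounded_clinear_on AA X g'" "f' = coboundary1 A X g'"
      using f by (auto simp: coboundaries2_def cochains1_def)
    note YD = left_banach_moduleD[OF Y]
    have gc: "g a \<in> car X" "g' a \<in> car X" if "a \<in> A" for a
      using g(1) g'(1) that by (auto simp: bounded_clinear_on_def clinear_on_def)
    define k where "k = (\<lambda>a\<in>A. sub X (g' a) (g a))"
    have k: "bounded_clinear_on AA X k"
      using bounded_clinear_on_sub[OF YD(1) g'(1) g(1)]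
      by (auto simp: k_def bounded_clinear_on_def clinear_on_def A_intros)
    have "(\<lambda>p\<in>A \<times> A. sub X (f' p) (f p)) = coboundary1 A X k"
    proof (rule extensionalityI)
      show "coboundary1 A X k \<in> extensional (A \<times> A)" by (simp add: coboundary1_def)
      show "(\<lambda>p\<in>A \<times> A. sub X (f' p) (f p)) \<in> extensional (A \<times> A)" by simp
      fix p assume "p \<in> A \<times> A"
      then obtain a b where p: "p = (a, b)" and ab: "a \<in> A" "b \<in> A" by auto
      have lk: "lact X a (sub X (g' b) (g b)) = sub X (lact X a (g' b)) (lact X a (g b))"
        using ab gc by (intro clinear_on_sub[OF YD(1) YD(2)])
      have c: "lact X a (g b) \<in> car X" "lact X a (g' b) \<in> car X" "g (a o\<^sub>L b) \<in> car X" "g' (a o\<^sub>L b) \<in> car X"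
        using ab gc YD(5) A_compose by auto
      have "sub X (f' p) (f p) = sub X (sub X (lact X a (g' b)) (g' (a o\<^sub>L b))) (sub X (lact X a (g b)) (g (a o\<^sub>L b)))"
        using ab by (simp add: p g(2) g'(2) coboundary1_right_annihilator[OF X g(1)]
            coboundary1_right_annihilator[OF X g'(1)] module_defect_def)
      also have "\<dots> = sub X (sub X (lact X a (g' b)) (lact X a (g b))) (sub X (g' (a o\<^sub>L b)) (g (a o\<^sub>L b)))"
        using c by (simp add: sub_def Y.scl_add_right Y.add_ac_car)
      also have "\<dots> = coboundary1 A X k p"
        unfolding p coboundary1_right_annihilator[OF X k ab] module_defect_def
        using ab by (simp add: k_def A_intros lk)
      finally show "(\<lambda>p\<in>A \<times> A. sub X (f' p) (f p)) p = coboundary1 A X k p" using ab by (simp add: p)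
    qed
    moreover have "k \<in> cochains1 A X" using k by (simp add: cochains1_def k_def)
    ultimately show ?thesis by (auto simp: coboundaries2_def)
  qed
  have cls: "?R `` {f} = coboundaries2 A X" if "f \<in> cocycles2 A X" for f
    using diff that unfolding eq by auto
  \<comment> \<open>The quotient of an empty set would be empty rather than a singleton.\<close>
  have "cocycles2 A X \<noteq> {}" using zero_coboundary[OF X] eq by blast
  then show "hochschild_H2 A X = {coboundaries2 A X}"
    unfolding hochschild_H2_def quotient_def using cls by auto
qed

text \<open>The class of f contains f, because f - f is the zero coboundary, and the only class
  there is consists of the coboundaries.\<close>

lemma H2_vanishes_imp_splits:
  assumes H: "hochschild_H2 A X = {coboundaries2 A X}"
    and X: "banach_bimodule A X" "right_annihilator A X" and f: "f \<in> cocycles2 A X"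
  shows "f \<in> coboundaries2 A X"
proof -
  have Y: "left_banach_module A X" using X by (simp add: banach_bimodule_def)
  interpret Y: carrier_banach X by standard (rule left_banach_moduleD[OF Y])
  let ?R = "{(f, f'). f \<in> cocycles2 A X \<and> f' \<in> cocycles2 A X \<and> (\<lambda>p\<in>A \<times> A. sub X (f' p) (f p)) \<in> coboundaries2 A X}"
  have "f (a, b) \<in> car X" if "a \<in> A" "b \<in> A" for a b
    using f that by (auto simp: cocycles2_def cochains2_def clinear_on_def)
  then have "(\<lambda>p\<in>A \<times> A. sub X (f p) (f p)) = (\<lambda>p\<in>A \<times> A. zer X)" by (intro restrict_ext) auto
  then have "f \<in> ?R `` {f}" using f zero_coboundary[OF X] by auto
  moreover have "?R `` {f} = coboundaries2 A X"
  proof -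
    have "?R `` {f} \<in> hochschild_H2 A X" unfolding hochschild_H2_def using f by (rule quotientI)
    then show ?thesis unfolding H by (rule singletonD)
  qed
  ultimately show ?thesis by (simp only:)
qed

text \<open>Equipping the kernel with zero right multiplication makes it an admissible coefficient
  bimodule for the vanishing hypothesis.\<close>

definition kernel_bimodule :: "('h oper, 'x) left_struct \<Rightarrow> ('x \<Rightarrow> 'h oper) \<Rightarrow> ('h oper, 'x) bi_struct" where
  "kernel_bimodule Y \<phi> = \<lparr>car = {y \<in> car Y. \<phi> y = 0}, zer = zer Y, add = add Y, scl = scl Y, nrm = nrm Y,
     lact = lact Y, ract = (\<lambda>_ _. zer Y)\<rparr>"

lemma kernel_bimodule_simps [simp]:
  "car (kernel_bimodule Y \<phi>) = {y \<in> car Y. \<phi> y = 0}" "zer (kernel_bimodule Y \<phi>) = zer Y"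
  "add (kernel_bimodule Y \<phi>) = add Y" "scl (kernel_bimodule Y \<phi>) = scl Y" "nrm (kernel_bimodule Y \<phi>) = nrm Y"
  "lact (kernel_bimodule Y \<phi>) = lact Y" "ract (kernel_bimodule Y \<phi>) x a = zer Y"
  "sub (kernel_bimodule Y \<phi>) x y = sub Y x y"
  by (simp_all add: kernel_bimodule_def sub_def)

lemma kernel_bimodule:
  assumes Y: "left_banach_module A Y" and phi: "module_morphism A Y AA \<phi>"
  shows "banach_bimodule A (kernel_bimodule Y \<phi>)" "right_annihilator A (kernel_bimodule Y \<phi>)"
proof -
  let ?X = "kernel_bimodule Y \<phi>"
  note YD = left_banach_moduleD[OF Y]
  interpret Y: carrier_banach Y by standard (rule YD)
  have pb: "bounded_clinear_on Y AA \<phi>" and pl: "\<And>a x. a \<in> A \<Longrightarrow> x \<in> car Y \<Longrightarrow> \<phi> (lact Y a x) = a o\<^sub>L \<phi> x"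
    using phi by (auto simp: module_morphism_def)
  have p: "x \<in> car Y \<Longrightarrow> \<phi> x \<in> A" "x \<in> car Y \<Longrightarrow> y \<in> car Y \<Longrightarrow> \<phi> (add Y x y) = \<phi> x + \<phi> y"
    "x \<in> car Y \<Longrightarrow> \<phi> (scl Y c x) = op_scale c (\<phi> x)" for x y c
    using pb by (auto simp: bounded_clinear_on_def clinear_on_def)
  have p0: "\<phi> (zer Y) = 0"
    using clinear_on_zer[OF YD(1) complex_banach_space_AA] pb by (simp add: bounded_clinear_on_def)
  show "right_annihilator A ?X" by (simp add: right_annihilator_def)
  have banach: "complex_banach_space ?X"
    unfolding complex_banach_space_def complex_vector_space_def
  proof (intro conjI ballI allI impI)
    fix u :: "nat \<Rightarrow> _"
    assume u: "(\<forall>n. u n \<in> car ?X) \<and> (\<forall>e>0. \<exists>N. \<forall>m\<ge>N. \<forall>n\<ge>N. nrm ?X (sub ?X (u m) (u n)) < e)"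
    then have uY: "\<And>n. u n \<in> car Y" "\<And>n. \<phi> (u n) = 0" by auto
    obtain l where l: "l \<in> car Y" "tends_in Y u l" using Y.complete[of u] u by auto
    have "tends_in AA (\<lambda>n. \<phi> (u n)) (\<phi> l)"
      by (rule bounded_clinear_tends_in[OF YD(1) complex_banach_space_AA pb uY(1) l])
    then have "\<phi> l = 0" by (simp add: tends_in_AA uY LIMSEQ_const_iff)
    then show "\<exists>l\<in>car ?X. (\<lambda>n. nrm ?X (sub ?X (u n) l)) \<longlonglongrightarrow> 0"
      using l by (intro bexI[of _ l]) (auto simp: tends_in_def)
  qed (auto simp: p p0 Y.add_assoc Y.scl_add_right Y.scl_add_left Y.scl_scl Y.nrm_eq_0 Y.nrm_scl
      intro: Y.add_comm Y.nrm_add_le)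
  have left: "left_banach_module A ?X"
    unfolding left_banach_module_def
  proof (intro conjI ballI banach)
    show "clinear_on ?X ?X (lact ?X a)" if "a \<in> A" for a
      using YD(2)[OF that] that YD(5) by (auto simp: clinear_on_def pl)
    show "clinear_on AA ?X (\<lambda>a. lact ?X a x)" if "x \<in> car ?X" for x
      using YD(3)[of x] that by (auto simp: clinear_on_def pl)
    show "\<exists>K. \<forall>a\<in>A. \<forall>x\<in>car ?X. nrm ?X (lact ?X a x) \<le> K * norm a * nrm ?X x" using YD(6) by auto
  qed (simp add: YD(4))
  show "banach_bimodule A ?X"
    unfolding banach_bimodule_def
  proof (intro conjI ballI left)
    have lz: "lact Y a (zer Y) = zer Y" if "a \<in> A" for a using clinear_on_zer[OF YD(1) YD(1) YD(2)[OF that]] .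
    show "\<exists>K. \<forall>a\<in>A. \<forall>x\<in>car ?X. nrm ?X (ract ?X x a) \<le> K * nrm ?X x * norm a" by (intro exI[of _ 0]) simp
    show "lact ?X a (ract ?X x b) = ract ?X (lact ?X a x) b" if "a \<in> A" "b \<in> A" for a b x using that lz by simp
  qed (auto simp: clinear_on_def p0)
qed

text \<open>The defect of a linear right inverse \<sigma> is killed by \<phi>, so it equals the
  defect of some g with values in the kernel. The difference of \<sigma> and g then has zero defect
  and is still a right inverse.\<close>

theorem H2_vanishes_imp_projective:
  assumes H: "H2_vanishes_right_annihilator TYPE('u) A"
  shows "projective_module TYPE('u) A AA"
  unfolding projective_module_def
proof (intro conjI left_banach_module_AA allI impI)
  fix Y :: "('h oper, 'u) left_struct" and \<phi>
  assume asm: "left_banach_module A Y \<and> module_morphism A Y AA \<phi> \<and> \<phi> ` car Y = car AA \<and>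
    (\<exists>\<sigma>. bounded_clinear_on AA Y \<sigma> \<and> (\<forall>x\<in>car AA. \<phi> (\<sigma> x) = x))"
  then obtain \<sigma> where Y: "left_banach_module A Y" and phi: "module_morphism A Y AA \<phi>"
    and s: "bounded_clinear_on AA Y \<sigma>" and ps: "\<And>x. x \<in> A \<Longrightarrow> \<phi> (\<sigma> x) = x" by auto
  let ?X = "kernel_bimodule Y \<phi>"
  note X = kernel_bimodule[OF Y phi]
  note YD = left_banach_moduleD[OF Y]
  interpret Y: carrier_banach Y by standard (rule YD)
  have pb: "clinear_on Y AA \<phi>" and pl: "\<And>a x. a \<in> A \<Longrightarrow> x \<in> car Y \<Longrightarrow> \<phi> (lact Y a x) = a o\<^sub>L \<phi> x"
    using phi by (auto simp: module_morphism_def bounded_clinear_on_def)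
  have psub: "\<phi> (sub Y x y) = \<phi> x - \<phi> y" if "x \<in> car Y" "y \<in> car Y" for x y
    using clinear_on_sub[OF YD(1) pb that] by simp
  have sc: "\<sigma> a \<in> car Y" if "a \<in> A" for a using s that by (auto simp: bounded_clinear_on_def clinear_on_def)
  note md = module_defect[OF Y s]
  have ker: "\<phi> (module_defect Y \<sigma> a b) = 0" if "a \<in> A" "b \<in> A" for a b
    using that by (simp add: module_defect_def psub sc YD(5) A_compose pl ps)
  define f where "f = (\<lambda>(a, b)\<in>A \<times> A. module_defect Y \<sigma> a b)"
  have f: "f (a, b) = module_defect Y \<sigma> a b" if "a \<in> A" "b \<in> A" for a b using that by (simp add: f_def)
  have "f \<in> cochains2 A ?X"
    unfolding cochains2_def
  proof (intro CollectI conjI ballI)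
    show "f \<in> extensional (A \<times> A)" by (simp add: f_def)
    show "clinear_on AA ?X (\<lambda>b. f (a, b))" if "a \<in> A" for a
      using md(2)[OF that] that ker by (auto simp: clinear_on_def f A_intros)
    show "clinear_on AA ?X (\<lambda>a. f (a, b))" if "b \<in> A" for b
      using md(3)[OF that] that ker by (auto simp: clinear_on_def f A_intros)
    show "\<exists>K. \<forall>a\<in>A. \<forall>b\<in>A. nrm ?X (f (a, b)) \<le> K * norm a * norm b" using md(4) by (simp add: f)
  qed
  moreover have "coboundary2 A ?X f = (\<lambda>_\<in>A \<times> A \<times> A. zer ?X)"
  proof (rule extensionalityI)
    show "coboundary2 A ?X f \<in> extensional (A \<times> A \<times> A)" by (simp add: coboundary2_def)
    show "(\<lambda>_\<in>A \<times> A \<times> A. zer ?X) \<in> extensional (A \<times> A \<times> A)" by simp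
    fix p assume "p \<in> A \<times> A \<times> A"
    then obtain a b c where p: "p = (a, b, c)" and abc: "a \<in> A" "b \<in> A" "c \<in> A" by auto
    show "coboundary2 A ?X f p = (\<lambda>_\<in>A \<times> A \<times> A. zer ?X) p"
      using abc md(5)[OF abc] by (simp add: p coboundary2_def f A_intros)
  qed
  ultimately have "f \<in> cocycles2 A ?X" by (simp add: cocycles2_def)
  moreover have "hochschild_H2 A ?X = {coboundaries2 A ?X}"
    using H X unfolding H2_vanishes_right_annihilator_def by blast
  ultimately have "f \<in> coboundaries2 A ?X" using H2_vanishes_imp_splits X by blast
  then obtain g where g: "bounded_clinear_on AA ?X g" "f = coboundary1 A ?X g"
    by (auto simp: coboundaries2_def cochains1_def)
  have gc: "g a \<in> car Y" "\<phi> (g a) = 0" if "a \<in> A" for a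
    using g(1) that by (auto simp: bounded_clinear_on_def clinear_on_def)
  have fg: "sub Y (lact Y a (\<sigma> b)) (\<sigma> (a o\<^sub>L b)) = sub Y (lact Y a (g b)) (g (a o\<^sub>L b))" if ab: "a \<in> A" "b \<in> A" for a b
  proof -
    have "f (a, b) = module_defect ?X g a b"
      using coboundary1_right_annihilator[OF X g(1) ab] g(2) by simp
    then show ?thesis using f[OF ab] by (simp add: module_defect_def)
  qed
  define \<rho> where "\<rho> a = sub Y (\<sigma> a) (g a)" for a
  have rc: "\<rho> a \<in> car Y" if "a \<in> A" for a using that by (simp add: \<rho>_def sc gc)
  have "module_morphism A AA Y \<rho>"
    unfolding module_morphism_def bounded_clinear_on_def
  proof (intro conjI ballI)
    have "bounded_clinear_on AA Y g" using g(1) by (auto simp: bounded_clinear_on_def clinear_on_def)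
    from bounded_clinear_on_sub[OF YD(1) s this]
    show "clinear_on AA Y \<rho>" "\<exists>K. \<forall>x\<in>car AA. nrm Y (\<rho> x) \<le> K * nrm AA x"
      unfolding bounded_clinear_on_def \<rho>_def by blast+
    fix a x assume a: "a \<in> A" and "x \<in> car AA"
    then have x: "x \<in> A" by simp
    let ?p = "lact Y a (\<sigma> x)" and ?q = "\<sigma> (a o\<^sub>L x)" and ?r = "lact Y a (g x)" and ?s = "g (a o\<^sub>L x)"
    have c: "?p \<in> car Y" "?q \<in> car Y" "?r \<in> car Y" "?s \<in> car Y"
      using a x sc gc YD(5) A_compose by auto
    have l: "lact Y a (\<rho> x) = sub Y ?p ?r"
      unfolding \<rho>_def using a x sc gc by (intro clinear_on_sub[OF YD(1) YD(2)]) auto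
    have "sub Y (sub Y ?p ?r) (sub Y ?q ?s) = sub Y (sub Y ?p ?q) (sub Y ?r ?s)"
      using c by (simp add: sub_def Y.scl_add_right Y.add_ac_car)
    also have "\<dots> = zer Y" using fg[OF a x] c by simp
    finally have "sub Y ?p ?r = sub Y ?q ?s" using c Y.sub_eq_zer[of "sub Y ?p ?r" "sub Y ?q ?s"] by simp
    then show "\<rho> (lact AA a x) = lact Y a (\<rho> x)" by (simp add: l) (simp add: \<rho>_def)
  qed
  moreover have "\<forall>x\<in>car AA. \<phi> (\<rho> x) = x" using sc gc by (simp add: \<rho>_def psub ps)
  ultimately show "\<exists>\<rho>. module_morphism A AA Y \<rho> \<and> (\<forall>x\<in>car AA. \<phi> (\<rho> x) = x)" by blast
qed

end

section \<open>Projectivity implies sigma-compactness of the spectrum\<close>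

context comm_cstar
begin

text \<open>Projectivity is tested on modules carried by the type \<open>'u\<close> only. An
  injection copies Y into that type, and the lifting found for the copy is carried back.\<close>

lemma projective_lifting_transport:
  fixes Y :: "('h oper, 'y) left_struct" and f :: "'y \<Rightarrow> 'u"
  assumes P: "projective_module TYPE('u) A AA"
    and Y: "left_banach_module A Y" and phi: "module_morphism A Y AA \<phi>"
    and s: "bounded_clinear_on AA Y \<sigma>" "\<And>x. x \<in> A \<Longrightarrow> \<phi> (\<sigma> x) = x"
    and f: "inj_on f (car Y)"
  shows "\<exists>\<rho>. module_morphism A AA Y \<rho> \<and> (\<forall>x\<in>A. \<phi> (\<rho> x) = x)"
proof -
  define g where "g = inv_into (car Y) f"
  have gf [simp]: "g (f x) = x" if "x \<in> car Y" for x using f that by (simp add: g_def)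
  define Y' :: "('h oper, 'u) left_struct" where
    "Y' = \<lparr>car = f ` car Y, zer = f (zer Y), add = (\<lambda>u v. f (add Y (g u) (g v))),
      scl = (\<lambda>c u. f (scl Y c (g u))), nrm = (\<lambda>u. nrm Y (g u)), lact = (\<lambda>a u. f (lact Y a (g u)))\<rparr>"
  note YD = left_banach_moduleD[OF Y]
  interpret Y: carrier_banach Y by standard (rule YD)
  have Y' [simp]: "car Y' = f ` car Y" "zer Y' = f (zer Y)" "add Y' u v = f (add Y (g u) (g v))"
    "scl Y' c u = f (scl Y c (g u))" "nrm Y' u = nrm Y (g u)" "lact Y' a u = f (lact Y a (g u))" for u v c a
    by (simp_all add: Y'_def)
  have sub': "sub Y' (f x) (f y) = f (sub Y x y)" if "x \<in> car Y" "y \<in> car Y" for x y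
    using that by (simp add: sub_def)
  have B: "complex_banach_space Y'"
    unfolding complex_banach_space_def complex_vector_space_def
  proof (intro conjI allI ballI impI)
    fix u :: "nat \<Rightarrow> 'u"
    assume u: "(\<forall>n. u n \<in> car Y') \<and> (\<forall>e>0. \<exists>N. \<forall>m\<ge>N. \<forall>n\<ge>N. nrm Y' (sub Y' (u m) (u n)) < e)"
    then have "\<forall>n. \<exists>x. x \<in> car Y \<and> u n = f x" by auto
    then obtain v where v: "\<And>n. v n \<in> car Y" "\<And>n. u n = f (v n)" by metis
    have "\<exists>l\<in>car Y. tends_in Y v l"
      by (rule Y.complete) (use u v in \<open>auto simp: sub'\<close>)
    then obtain l where "l \<in> car Y" "tends_in Y v l" by blast
    then show "\<exists>l\<in>car Y'. (\<lambda>n. nrm Y' (sub Y' (u n) l)) \<longlonglongrightarrow> 0"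
      using v by (intro bexI[of _ "f l"]) (auto simp: tends_in_def sub')
  qed (auto simp: Y.add_assoc Y.scl_add_right Y.scl_add_left Y.scl_scl Y.nrm_eq_0 Y.nrm_scl sub' inj_on_eq_iff[OF f]
      intro: Y.nrm_add_le arg_cong[where f = f] Y.add_comm)
  have M: "left_banach_module A Y'"
    unfolding left_banach_module_def
  proof (intro conjI ballI B)
    show "clinear_on Y' Y' (lact Y' a)" if "a \<in> A" for a
      using YD(2)[OF that] that YD(5) by (auto simp: clinear_on_def)
    show "clinear_on AA Y' (\<lambda>a. lact Y' a x)" if xin: "x \<in> car Y'" for x
    proof -
      obtain y where y: "y \<in> car Y" "x = f y" using xin by auto
      show ?thesis using YD(3)[OF y(1)] y by (auto simp: clinear_on_def)
    qed
    show "\<exists>K. \<forall>a\<in>A. \<forall>x\<in>car Y'. nrm Y' (lact Y' a x) \<le> K * norm a * nrm Y' x"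
      using YD(5,6) by auto
  qed (auto simp: YD(4,5))
  have mm: "module_morphism A Y' AA (\<lambda>u. \<phi> (g u))"
    using phi YD(5) by (auto simp: module_morphism_def bounded_clinear_on_def clinear_on_def)
  have sY: "\<sigma> x \<in> car Y" if "x \<in> A" for x using s(1) that by (auto simp: bounded_clinear_on_def clinear_on_def)
  have ss: "bounded_clinear_on AA Y' (\<lambda>x. f (\<sigma> x))"
    using s(1) sY by (auto simp: bounded_clinear_on_def clinear_on_def)
  have surj: "(\<lambda>u. \<phi> (g u)) ` car Y' = car AA"
  proof
    show "(\<lambda>u. \<phi> (g u)) ` car Y' \<subseteq> car AA"
      using mm by (auto simp: module_morphism_def bounded_clinear_on_def clinear_on_def)
    show "car AA \<subseteq> (\<lambda>u. \<phi> (g u)) ` car Y'"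
    proof
      fix x assume "x \<in> car AA"
      then have "x = \<phi> (g (f (\<sigma> x)))" "f (\<sigma> x) \<in> car Y'" using s(2) sY by auto
      then show "x \<in> (\<lambda>u. \<phi> (g u)) ` car Y'" by blast
    qed
  qed
  have "\<exists>\<sigma>. bounded_clinear_on AA Y' \<sigma> \<and> (\<forall>x\<in>car AA. \<phi> (g (\<sigma> x)) = x)"
    using ss s(2) sY by (intro exI[of _ "\<lambda>x. f (\<sigma> x)"]) auto
  then obtain \<rho> where r: "module_morphism A AA Y' \<rho>" "\<forall>x\<in>car AA. \<phi> (g (\<rho> x)) = x"
    using P M mm surj unfolding projective_module_def by blast
  have rY: "\<exists>y\<in>car Y. \<rho> x = f y" if "x \<in> A" for x
    using r(1) that by (auto simp: module_morphism_def bounded_clinear_on_def clinear_on_def)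
  then have rg: "g (\<rho> x) \<in> car Y" if "x \<in> A" for x using that by fastforce
  have "module_morphism A AA Y (\<lambda>x. g (\<rho> x))"
    using r(1) rg YD(5) by (auto simp: module_morphism_def bounded_clinear_on_def clinear_on_def A_intros)
  then show ?thesis using r(2) by auto
qed

text \<open>An entry (a, b, c) encodes the elementary tensor of a or a + 1 with b. A Boolean
  suffices for the unitization, as scalar multiples of 1 can be moved into b, and it keeps the codes
  of lists countable. The value zero off pairs of characters lets functions be compared
  everywhere.\<close>

definition pair_sum :: "('h oper \<times> 'h oper \<times> bool) list \<Rightarrow> ('h oper \<Rightarrow> complex) \<times> ('h oper \<Rightarrow> complex) \<Rightarrow> complex" where
  "pair_sum xs p = (if p \<in> chars \<times> chars then \<Sum>(a, b, c)\<leftarrow>xs. (fst p a + of_bool c) * snd p b else 0)"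

definition pair_list :: "('h oper \<times> 'h oper \<times> bool) list \<Rightarrow> bool" where
  "pair_list xs \<longleftrightarrow> set xs \<subseteq> A \<times> A \<times> UNIV"

definition pair_functions :: "(('h oper \<Rightarrow> complex) \<times> ('h oper \<Rightarrow> complex) \<Rightarrow> complex) set" where
  "pair_functions = {F. (\<forall>p. p \<notin> chars \<times> chars \<longrightarrow> F p = 0) \<and>
     (\<forall>e>0. \<exists>xs. pair_list xs \<and> (\<forall>p. cmod (F p - pair_sum xs p) \<le> e))}"

text \<open>This is the injective tensor product of the unitization of \<open>A\<close> with \<open>A\<close>, as a module of functions on
  pairs of characters; multiplication becomes restriction to the diagonal.\<close>

definition pair_module :: "('h oper, ('h oper \<Rightarrow> complex) \<times> ('h oper \<Rightarrow> complex) \<Rightarrow> complex) left_struct" where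
  "pair_module = \<lparr>car = pair_functions, zer = (\<lambda>p. 0), add = (\<lambda>F G p. F p + G p), scl = (\<lambda>c F p. c * F p),
     nrm = (\<lambda>F. SUP p. cmod (F p)), lact = (\<lambda>a F p. fst p a * F p)\<rparr>"

lemma pair_module_simps [simp]:
  "car pair_module = pair_functions" "zer pair_module = (\<lambda>p. 0)" "add pair_module F G = (\<lambda>p. F p + G p)"
  "scl pair_module c F = (\<lambda>p. c * F p)" "nrm pair_module F = (SUP p. cmod (F p))"
  "lact pair_module a F = (\<lambda>p. fst p a * F p)" "sub pair_module F G = (\<lambda>p. F p - G p)"
  by (simp_all add: pair_module_def sub_def)

lemma pair_list_simps [simp]:
  "pair_list []" "pair_list ((a, b, c) # xs) \<longleftrightarrow> a \<in> A \<and> b \<in> A \<and> pair_list xs"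
  "pair_list (xs @ ys) \<longleftrightarrow> pair_list xs \<and> pair_list ys"
  by (auto simp: pair_list_def)

lemma pair_sum_simps [simp]:
  "pair_sum [] p = 0"
  "pair_sum ((a, b, c) # xs) p = (if p \<in> chars \<times> chars then (fst p a + of_bool c) * snd p b else 0) + pair_sum xs p"
  "pair_sum (xs @ ys) p = pair_sum xs p + pair_sum ys p"
  by (auto simp: pair_sum_def)

lemma pair_sum_outside: "p \<notin> chars \<times> chars \<Longrightarrow> pair_sum xs p = 0"
  by (simp add: pair_sum_def)

lemma pair_functionsI:
  assumes "\<And>p. p \<notin> chars \<times> chars \<Longrightarrow> F p = 0"
    and "\<And>e. e > 0 \<Longrightarrow> \<exists>xs. pair_list xs \<and> (\<forall>p. cmod (F p - pair_sum xs p) \<le> e)"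
  shows "F \<in> pair_functions"
  using assms by (simp add: pair_functions_def)

lemma pair_functions_approx:
  assumes "F \<in> pair_functions" "e > 0"
  obtains xs where "pair_list xs" "\<And>p. cmod (F p - pair_sum xs p) \<le> e"
  using assms by (auto simp: pair_functions_def)

lemma pair_functions_outside: "F \<in> pair_functions \<Longrightarrow> p \<notin> chars \<times> chars \<Longrightarrow> F p = 0"
  unfolding pair_functions_def by blast

lemma pair_sum_in: "pair_list xs \<Longrightarrow> pair_sum xs \<in> pair_functions"
  by (intro pair_functionsI) (auto simp: pair_sum_outside intro!: exI[of _ xs])

text \<open>The bound is uniform in the first variable; for this reason only the second one is
  confined in \<open>pair_functions_level_compact\<close>.\<close>

lemma pair_sum_coeff_bound:
  assumes "pair_list xs" "s \<in> chars" "t \<in> chars"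
  shows "cmod (pair_sum xs (s, t)) \<le> (\<Sum>(a, b, c)\<leftarrow>xs. (norm a + 1) * cmod (t b))"
  using assms(1)
proof (induction xs)
  case (Cons x xs)
  obtain a b c where x: "x = (a, b, c)" by (cases x)
  have a: "a \<in> A" using Cons.prems by (simp add: x)
  have "cmod (s a + of_bool c) \<le> cmod (s a) + cmod (of_bool c)" by (rule norm_triangle_ineq)
  also have "\<dots> \<le> norm a + 1" using cmod_chi_le[OF assms(2) a] by (cases c) auto
  finally have "cmod ((s a + of_bool c) * t b) \<le> (norm a + 1) * cmod (t b)"
    unfolding norm_mult by (rule mult_right_mono) simp
  moreover have "cmod (pair_sum xs (s, t)) \<le> (\<Sum>(a, b, c)\<leftarrow>xs. (norm a + 1) * cmod (t b))"
    using Cons by (simp add: x)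
  ultimately have "cmod ((s a + of_bool c) * t b) + cmod (pair_sum xs (s, t))
      \<le> (norm a + 1) * cmod (t b) + (\<Sum>(a, b, c)\<leftarrow>xs. (norm a + 1) * cmod (t b))" by (rule add_mono)
  then show ?case
    using assms norm_triangle_ineq[of "(s a + of_bool c) * t b" "pair_sum xs (s, t)"] by (simp add: x)
qed simp

lemma pair_sum_bounded: "pair_list xs \<Longrightarrow> \<exists>C. \<forall>p. cmod (pair_sum xs p) \<le> C"
proof (induction xs)
  case (Cons x xs)
  obtain a b c where x: "x = (a, b, c)" by (cases x)
  have ab: "a \<in> A" "b \<in> A" using Cons.prems by (simp_all add: x)
  obtain C where C: "\<forall>p. cmod (pair_sum xs p) \<le> C" using Cons by (auto simp: x)
  have "cmod (pair_sum (x # xs) p) \<le> (norm a + 1) * norm b + C" for p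
  proof (cases "p \<in> chars \<times> chars")
    case True
    then obtain s t where p: "p = (s, t)" "s \<in> chars" "t \<in> chars" by auto
    have "cmod (s a + of_bool c) \<le> cmod (s a) + cmod (of_bool c)" by (rule norm_triangle_ineq)
    also have "\<dots> \<le> norm a + 1" using cmod_chi_le[OF p(2) ab(1)] by (cases c) auto
    finally have "cmod ((s a + of_bool c) * t b) \<le> (norm a + 1) * norm b"
      unfolding norm_mult by (intro mult_mono cmod_chi_le p ab) auto
    moreover have "pair_sum (x # xs) p = (s a + of_bool c) * t b + pair_sum xs p"
      using p by (simp add: x)
    ultimately show ?thesis
      using spec[OF C, of p] norm_triangle_ineq[of "(s a + of_bool c) * t b" "pair_sum xs p"] by simp
  next
    case False
    have "0 \<le> C" using C norm_ge_zero order_trans by blast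
    then show ?thesis using False by (simp add: pair_sum_outside)
  qed
  then show ?case by blast
qed auto

lemma pair_functions_bdd: "F \<in> pair_functions \<Longrightarrow> bdd_above (range (\<lambda>p. cmod (F p)))"
proof -
  assume F: "F \<in> pair_functions"
  obtain xs where xs: "pair_list xs" "\<And>p. cmod (F p - pair_sum xs p) \<le> 1"
    using pair_functions_approx[OF F, of 1] by auto
  obtain C where C: "\<forall>p. cmod (pair_sum xs p) \<le> C" using pair_sum_bounded[OF xs(1)] by blast
  have "cmod (F p) \<le> 1 + C" for p
    using xs(2)[of p] spec[OF C, of p] norm_triangle_ineq2[of "F p" "pair_sum xs p"] by linarith
  then show ?thesis by (auto intro!: bdd_aboveI[of _ "1 + C"])
qed

lemma pair_nrm_ge: "F \<in> pair_functions \<Longrightarrow> cmod (F p) \<le> nrm pair_module F"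
  unfolding pair_module_simps by (rule cSUP_upper[OF UNIV_I pair_functions_bdd])

lemma pair_nrm_le: "(\<And>p. cmod (F p) \<le> C) \<Longrightarrow> nrm pair_module F \<le> C"
  by (simp add: cSUP_least)

lemma pair_functions_zero: "(\<lambda>p. 0) \<in> pair_functions"
proof -
  have "(\<lambda>p. 0) = pair_sum []" by (simp add: fun_eq_iff)
  then show ?thesis using pair_sum_in[of "[]"] by (simp only: pair_list_simps)
qed

lemma pair_functions_add:
  assumes "F \<in> pair_functions" "G \<in> pair_functions"
  shows "(\<lambda>p. F p + G p) \<in> pair_functions"
proof (rule pair_functionsI)
  fix e :: real assume "e > 0"
  then obtain xs ys where "pair_list xs" "\<And>p. cmod (F p - pair_sum xs p) \<le> e / 2"
      "pair_list ys" "\<And>p. cmod (G p - pair_sum ys p) \<le> e / 2"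
    using pair_functions_approx[OF assms(1), of "e / 2"] pair_functions_approx[OF assms(2), of "e / 2"] by (metis half_gt_zero)
  note xy = this
  have "cmod (F p + G p - pair_sum (xs @ ys) p) \<le> e" for p
    using norm_triangle_ineq[of "F p - pair_sum xs p" "G p - pair_sum ys p"] xy(2)[of p] xy(4)[of p]
    by (simp add: algebra_simps)
  then show "\<exists>xs. pair_list xs \<and> (\<forall>p. cmod (F p + G p - pair_sum xs p) \<le> e)"
    using xy(1,3) by (intro exI[of _ "xs @ ys"]) simp
next
  fix p :: "('h oper \<Rightarrow> complex) \<times> ('h oper \<Rightarrow> complex)" assume p: "p \<notin> chars \<times> chars"
  show "F p + G p = 0"
    by (simp only: pair_functions_outside[OF assms(1) p] pair_functions_outside[OF assms(2) p] add_0)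
qed

text \<open>Extends an operation from finite tensors to the uniform closure: T performs it on lists,
  and the Lipschitz estimate carries approximations over.\<close>

lemma pair_functions_image:
  assumes F: "F \<in> pair_functions" and out: "\<And>p. p \<notin> chars \<times> chars \<Longrightarrow> G p = 0"
    and T: "\<And>xs. pair_list xs \<Longrightarrow> pair_list (T xs)"
    and le: "\<And>xs p. pair_list xs \<Longrightarrow> cmod (G p - pair_sum (T xs) p) \<le> C * cmod (F p - pair_sum xs p)"
  shows "G \<in> pair_functions"
proof (rule pair_functionsI)
  fix e :: real assume e: "e > 0"
  have pos: "e / (\<bar>C\<bar> + 1) > 0" using e by (intro divide_pos_pos) auto
  obtain xs where xs: "pair_list xs" "\<And>p. cmod (F p - pair_sum xs p) \<le> e / (\<bar>C\<bar> + 1)"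
    using pair_functions_approx[OF F pos] by blast
  have "cmod (G p - pair_sum (T xs) p) \<le> e" for p
  proof -
    have "cmod (G p - pair_sum (T xs) p) \<le> C * cmod (F p - pair_sum xs p)" by (rule le[OF xs(1)])
    also have "\<dots> \<le> (\<bar>C\<bar> + 1) * (e / (\<bar>C\<bar> + 1))" by (intro mult_mono xs) auto
    also have "\<dots> = e" by (simp add: add_nonneg_eq_0_iff)
    finally show ?thesis .
  qed
  then show "\<exists>xs. pair_list xs \<and> (\<forall>p. cmod (G p - pair_sum xs p) \<le> e)" using T[OF xs(1)] by blast
qed (rule out)

lemma pair_functions_scale:
  assumes F: "F \<in> pair_functions"
  shows "(\<lambda>p. z * F p) \<in> pair_functions"
proof (rule pair_functions_image[OF F, where C = "cmod z"])
  let ?T = "map (\<lambda>(a, b, c). (a, op_scale z b, c))"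
  show "z * F p = 0" if "p \<notin> chars \<times> chars" for p using pair_functions_outside[OF F that] by simp
  fix xs assume xs: "pair_list xs"
  then show "pair_list (?T xs)" by (auto simp: pair_list_def A_intros)
  have "pair_sum (?T xs) p = z * pair_sum xs p" for p
    using xs by (induction xs) (auto simp: chi_simps algebra_simps)
  then show "cmod (z * F p - pair_sum (?T xs) p) \<le> cmod z * cmod (F p - pair_sum xs p)" for p
    by (simp add: norm_mult[symmetric] right_diff_distrib)
qed

lemma pair_functions_lact:
  assumes F: "F \<in> pair_functions" and d: "d \<in> A"
  shows "(\<lambda>p. fst p d * F p) \<in> pair_functions"
proof (rule pair_functions_image[OF F, where C = "norm d"])
  \<comment> \<open>Multiplication by d absorbs the adjoined identity, since d (a + 1) = d a + d
    lies in A; the Boolean becomes \<open>False\<close>.\<close>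
  let ?T = "map (\<lambda>(a, b, c). ((d o\<^sub>L a) + op_scale (of_bool c) d, b, False))"
  show "fst p d * F p = 0" if "p \<notin> chars \<times> chars" for p using pair_functions_outside[OF F that] by simp
  fix xs assume xs: "pair_list xs"
  then show "pair_list (?T xs)" using d by (auto simp: pair_list_def intro!: A_intros)
  have eq: "pair_sum (?T xs) p = fst p d * pair_sum xs p" for p
    using xs
  proof (induction xs)
    case (Cons x xs)
    then show ?case using d by (cases x) (auto simp: chi_simps A_intros algebra_simps)
  qed simp
  show "cmod (fst p d * F p - pair_sum (?T xs) p) \<le> norm d * cmod (F p - pair_sum xs p)" for p
  proof (cases "p \<in> chars \<times> chars")
    case True
    then have "cmod (fst p d) \<le> norm d" using d by (intro cmod_chi_le) auto
    then have "cmod (fst p d) * cmod (F p - pair_sum xs p) \<le> norm d * cmod (F p - pair_sum xs p)"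
      by (rule mult_right_mono) simp
    then show ?thesis unfolding eq by (simp add: norm_mult[symmetric] right_diff_distrib)
  next
    case False
    then show ?thesis using pair_functions_outside[OF F False] by (simp add: pair_sum_outside)
  qed
qed

lemma pair_module_banach: "complex_banach_space pair_module"
  unfolding complex_banach_space_def complex_vector_space_def
proof (intro conjI ballI allI impI)
  fix F assume "F \<in> car pair_module"
  then have F: "F \<in> pair_functions" by simp
  show "0 \<le> nrm pair_module F" using order_trans[OF norm_ge_zero pair_nrm_ge[OF F]] .
  show "nrm pair_module F = 0 \<longleftrightarrow> F = zer pair_module"
  proof
    assume "nrm pair_module F = 0"
    then have "cmod (F p) \<le> 0" for p using pair_nrm_ge[OF F, of p] by simp
    then show "F = zer pair_module" by (auto simp: fun_eq_iff)
  qed simp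
  fix c show "nrm pair_module (scl pair_module c F) = cmod c * nrm pair_module F"
  proof (cases "c = 0")
    case False
    have 1: "nrm pair_module (scl pair_module c F) \<le> cmod c * nrm pair_module F"
      using mult_left_mono[OF pair_nrm_ge[OF F], of "cmod c"] by (intro pair_nrm_le) (simp add: norm_mult)
    have "nrm pair_module F \<le> nrm pair_module (scl pair_module c F) / cmod c"
    proof (rule pair_nrm_le)
      fix p
      have "cmod (c * F p) \<le> nrm pair_module (scl pair_module c F)"
        using pair_nrm_ge[OF pair_functions_scale[OF F, of c], of p] by simp
      then show "cmod (F p) \<le> nrm pair_module (scl pair_module c F) / cmod c"
        using False by (simp add: norm_mult field_simps)
    qed
    then have "cmod c * nrm pair_module F \<le> nrm pair_module (scl pair_module c F)"
      using False by (simp add: field_simps)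
    then show ?thesis using 1 by simp
  qed simp
next
  fix F G assume "F \<in> car pair_module" "G \<in> car pair_module"
  then have F: "F \<in> pair_functions" and G: "G \<in> pair_functions" by simp_all
  show "nrm pair_module (add pair_module F G) \<le> nrm pair_module F + nrm pair_module G"
    using pair_nrm_ge[OF F] pair_nrm_ge[OF G]
    by (intro pair_nrm_le) (simp only: pair_module_simps order_trans[OF norm_triangle_ineq] add_mono)
next
  fix u :: "nat \<Rightarrow> _"
  assume u: "(\<forall>n. u n \<in> car pair_module) \<and>
    (\<forall>e>0. \<exists>N. \<forall>m\<ge>N. \<forall>n\<ge>N. nrm pair_module (sub pair_module (u m) (u n)) < e)"
  have uF: "u n \<in> pair_functions" for n using u by simp
  have dF: "(\<lambda>p. u m p - u n p) \<in> pair_functions" for m n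
    using pair_functions_add[OF uF pair_functions_scale[OF uF, of "-1"]] by simp
  have "\<exists>N. \<forall>m\<ge>N. \<forall>n\<ge>N. \<forall>p. cmod (u m p - u n p) < e" if "e > 0" for e
  proof -
    have "\<exists>N. \<forall>m\<ge>N. \<forall>n\<ge>N. nrm pair_module (\<lambda>p. u m p - u n p) < e"
      using u \<open>e > 0\<close> by (simp del: pair_module_simps(5))
    then obtain N where N: "\<And>m n. m \<ge> N \<Longrightarrow> n \<ge> N \<Longrightarrow> nrm pair_module (\<lambda>p. u m p - u n p) < e" by blast
    show ?thesis using N le_less_trans[OF pair_nrm_ge[OF dF]] by blast
  qed
  note unif = this
  have "Cauchy (\<lambda>n. u n p)" for p unfolding Cauchy_def dist_norm using unif by meson
  then have "convergent (\<lambda>n. u n p)" for p using Cauchy_convergent_iff by blast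
  then obtain F where F: "\<And>p. (\<lambda>n. u n p) \<longlonglongrightarrow> F p" unfolding convergent_def by metis
  have lim: "\<exists>N. \<forall>n\<ge>N. \<forall>p. cmod (u n p - F p) \<le> e" if e: "e > 0" for e
  proof -
    obtain N where N: "\<And>m n p. m \<ge> N \<Longrightarrow> n \<ge> N \<Longrightarrow> cmod (u m p - u n p) < e" using unif[OF e] by blast
    have "cmod (u n p - F p) \<le> e" if "n \<ge> N" for n p
    proof (rule LIMSEQ_le_const2)
      show "(\<lambda>m. cmod (u n p - u m p)) \<longlonglongrightarrow> cmod (u n p - F p)" by (intro tendsto_intros F)
      show "\<exists>M. \<forall>m\<ge>M. cmod (u n p - u m p) \<le> e" using N that less_imp_le by blast
    qed
    then show ?thesis by blast
  qed
  have FF: "F \<in> pair_functions"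
  proof (rule pair_functionsI)
    fix p :: "('h oper \<Rightarrow> complex) \<times> ('h oper \<Rightarrow> complex)" assume p: "p \<notin> chars \<times> chars"
    have "(\<lambda>n. 0) \<longlonglongrightarrow> F p" using F[of p] pair_functions_outside[OF uF p] by simp
    then show "F p = 0" by (simp add: LIMSEQ_const_iff)
  next
    fix e :: real assume e: "e > 0"
    then obtain N where N: "\<And>n p. n \<ge> N \<Longrightarrow> cmod (u n p - F p) \<le> e / 2" using lim[of "e / 2"] by auto
    obtain xs where xs: "pair_list xs" "\<And>p. cmod (u N p - pair_sum xs p) \<le> e / 2"
      using pair_functions_approx[OF uF, of "e / 2"] e by auto
    have "cmod (F p - pair_sum xs p) \<le> e" for p
      using norm_triangle_ineq[of "F p - u N p" "u N p - pair_sum xs p"] N[of N p] xs(2)[of p]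
      by (simp add: norm_minus_commute)
    then show "\<exists>xs. pair_list xs \<and> (\<forall>p. cmod (F p - pair_sum xs p) \<le> e)" using xs(1) by blast
  qed
  have "(\<lambda>n. nrm pair_module (sub pair_module (u n) F)) \<longlonglongrightarrow> 0"
  proof (rule LIMSEQ_I)
    fix r :: real assume r: "r > 0"
    then obtain N where N: "\<And>n p. n \<ge> N \<Longrightarrow> cmod (u n p - F p) \<le> r / 2" using lim[of "r / 2"] by auto
    have "norm (nrm pair_module (sub pair_module (u n) F) - 0) < r" if n: "n \<ge> N" for n
    proof -
      have "nrm pair_module (\<lambda>p. u n p - F p) \<le> r / 2" by (rule pair_nrm_le) (rule N[OF n])
      moreover have "(\<lambda>p. u n p - F p) \<in> pair_functions"
        using pair_functions_add[OF uF pair_functions_scale[OF FF, of "-1"]] by simp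
      then have "0 \<le> nrm pair_module (\<lambda>p. u n p - F p)" using order_trans[OF norm_ge_zero pair_nrm_ge] by blast
      ultimately show ?thesis using r by (simp del: pair_module_simps(5))
    qed
    then show "\<exists>no. \<forall>n\<ge>no. norm (nrm pair_module (sub pair_module (u n) F) - 0) < r" by blast
  qed
  then show "\<exists>l\<in>car pair_module. (\<lambda>n. nrm pair_module (sub pair_module (u n) l)) \<longlonglongrightarrow> 0"
    using FF by (intro bexI[of _ F]) simp_all
qed (auto simp: pair_functions_zero pair_functions_add pair_functions_scale algebra_simps fun_eq_iff
    simp del: pair_module_simps(5))

lemma pair_module: "left_banach_module A pair_module"
  unfolding left_banach_module_def
proof (intro conjI ballI pair_module_banach)
  show "clinear_on pair_module pair_module (lact pair_module a)" if "a \<in> A" for a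
    using that by (auto simp: clinear_on_def pair_functions_lact distrib_left mult.left_commute)
  show "clinear_on AA pair_module (\<lambda>a. lact pair_module a F)" if F: "F \<in> car pair_module" for F
  proof -
    have F': "F \<in> pair_functions" using F by simp
    have 1: "fst p (a + b) * F p = fst p a * F p + fst p b * F p" if "a \<in> A" "b \<in> A" for a b p
      using that pair_functions_outside[OF F', of p] by (cases "p \<in> chars \<times> chars") (auto simp: chi_simps algebra_simps)
    have 2: "fst p (op_scale c a) * F p = c * (fst p a * F p)" if "a \<in> A" for a c p
      using that pair_functions_outside[OF F', of p] by (cases "p \<in> chars \<times> chars") (auto simp: chi_simps)
    show ?thesis using F' by (auto simp: clinear_on_def pair_functions_lact 1 2 fun_eq_iff)
  qed
  show "lact pair_module (a o\<^sub>L b) F = lact pair_module a (lact pair_module b F)"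
    if a: "a \<in> A" and b: "b \<in> A" and F: "F \<in> car pair_module" for a b F
  proof -
    have F': "F \<in> pair_functions" using F by simp
    have "fst p (a o\<^sub>L b) * F p = fst p a * (fst p b * F p)" for p
      using a b pair_functions_outside[OF F', of p] by (cases "p \<in> chars \<times> chars") (auto simp: chi_simps)
    then show ?thesis by (simp add: fun_eq_iff)
  qed
  have "nrm pair_module (lact pair_module a F) \<le> 1 * norm a * nrm pair_module F" if a: "a \<in> A" and F: "F \<in> pair_functions" for a F
  proof (rule pair_nrm_le)
    fix p
    have F0: "0 \<le> nrm pair_module F" using order_trans[OF norm_ge_zero pair_nrm_ge[OF F]] .
    show "cmod (lact pair_module a F p) \<le> 1 * norm a * nrm pair_module F"
    proof (cases "p \<in> chars \<times> chars")
      case True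
      then have "cmod (fst p a) \<le> norm a" using a by (intro cmod_chi_le) auto
      then have "cmod (fst p a) * cmod (F p) \<le> norm a * nrm pair_module F"
        using pair_nrm_ge[OF F] by (intro mult_mono) auto
      then show ?thesis by (simp add: norm_mult del: pair_module_simps(5))
    next
      case False
      then show ?thesis using F0 pair_functions_outside[OF F False] by (simp del: pair_module_simps(5))
    qed
  qed
  then show "\<exists>K. \<forall>a\<in>A. \<forall>x\<in>car pair_module. nrm pair_module (lact pair_module a x) \<le> K * norm a * nrm pair_module x"
    by (metis pair_module_simps(1))
qed

text \<open>A is complete and the Gelfand transform isometric, so uniform limits of transforms of
  elements of A are such transforms again.\<close>

lemma ex_element_of_values:
  assumes "\<And>e. e > 0 \<Longrightarrow> \<exists>a\<in>A. \<forall>\<theta>\<in>chars. cmod (\<theta> a - v \<theta>) \<le> e"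
  shows "\<exists>a\<in>A. \<forall>\<theta>\<in>chars. \<theta> a = v \<theta>"
proof -
  have "\<exists>a. a \<in> A \<and> (\<forall>\<theta>\<in>chars. cmod (\<theta> a - v \<theta>) \<le> 1 / real (Suc n))" for n
    using assms[of "1 / real (Suc n)"] by auto
  then obtain a where a: "\<And>n. a n \<in> A" "\<And>n \<theta>. \<theta> \<in> chars \<Longrightarrow> cmod (\<theta> (a n) - v \<theta>) \<le> 1 / real (Suc n)" by metis
  have "Cauchy a"
  proof (rule metric_CauchyI)
    fix e :: real assume e: "e > 0"
    obtain N where N: "1 / real (Suc N) < e / 3" using reals_Archimedean[of "e / 3"] e by (auto simp: inverse_eq_divide)
    have "dist (a m) (a n) < e" if mn: "m \<ge> N" "n \<ge> N" for m n
    proof -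
      have "norm (a m - a n) \<le> 2 * (e / 3)"
      proof (rule norm_le_of_characters)
        fix \<theta> assume th: "\<theta> \<in> chars"
        have "1 / real (Suc k) \<le> 1 / real (Suc N)" if "k \<ge> N" for k using that by (intro divide_left_mono) auto
        then have "cmod (\<theta> (a m) - v \<theta>) \<le> e / 3" "cmod (\<theta> (a n) - v \<theta>) \<le> e / 3"
          using a(2)[OF th, of m] a(2)[OF th, of n] N mn by fastforce+
        then show "cmod (\<theta> (a m - a n)) \<le> 2 * (e / 3)"
          using norm_triangle_ineq4[of "\<theta> (a m) - v \<theta>" "\<theta> (a n) - v \<theta>"] th a(1) by (simp add: chi_diff)
      qed (use e a in \<open>auto intro: A_diff\<close>)
      then show ?thesis using e by (simp add: dist_norm)
    qed
    then show "\<exists>M. \<forall>m\<ge>M. \<forall>n\<ge>M. dist (a m) (a n) < e" by blast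
  qed
  then obtain l where l: "a \<longlonglongrightarrow> l" using Cauchy_convergent_iff convergent_def by blast
  have lA: "l \<in> A" by (rule A_limit[OF a(1) l])
  have "\<theta> l = v \<theta>" if th: "\<theta> \<in> chars" for \<theta>
  proof -
    have "(\<lambda>n. norm (a n - l) + 1 / real (Suc n)) \<longlonglongrightarrow> 0 + 0"
      using LIMSEQ_inverse_real_of_nat by (intro tendsto_add tendsto_norm_zero LIM_zero l) (simp add: inverse_eq_divide)
    then have "cmod (\<theta> l - v \<theta>) \<le> 0 + 0"
    proof (rule LIMSEQ_le_const, intro exI allI impI)
      fix n :: nat
      have "cmod (\<theta> (a n - l)) \<le> norm (a n - l)" by (intro cmod_chi_le th A_diff a lA)
      then show "cmod (\<theta> l - v \<theta>) \<le> norm (a n - l) + 1 / real (Suc n)"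
        using norm_triangle_ineq4[of "\<theta> (a n) - v \<theta>" "\<theta> (a n - l)"] a(2)[OF th, of n] th a(1) lA by (simp add: chi_diff)
    qed
    then show ?thesis by simp
  qed
  then show ?thesis using lA by blast
qed

text \<open>The multiplication map, which sends the tensor of a and b to a b, read off at
  characters.\<close>

definition diag :: "(('h oper \<Rightarrow> complex) \<times> ('h oper \<Rightarrow> complex) \<Rightarrow> complex) \<Rightarrow> 'h oper" where
  "diag F = (SOME a. a \<in> A \<and> (\<forall>\<theta>\<in>chars. \<theta> a = F (\<theta>, \<theta>)))"

lemma
  assumes F: "F \<in> pair_functions"
  shows diag_in: "diag F \<in> A" and chi_diag: "\<theta> \<in> chars \<Longrightarrow> \<theta> (diag F) = F (\<theta>, \<theta>)"
proof -
  have "\<exists>a\<in>A. \<forall>\<theta>\<in>chars. \<theta> a = F (\<theta>, \<theta>)"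
  proof (rule ex_element_of_values)
    fix e :: real assume "e > 0"
    then obtain xs where xs: "pair_list xs" "\<And>p. cmod (F p - pair_sum xs p) \<le> e" using pair_functions_approx[OF F] by blast
    have "\<exists>a\<in>A. \<forall>\<theta>\<in>chars. \<theta> a = pair_sum xs (\<theta>, \<theta>)"
      using xs(1)
    proof (induction xs)
      case Nil
      then show ?case using A_zero chi_zero by (intro bexI[of _ 0]) auto
    next
      case (Cons x xs)
      obtain a b c where x: "x = (a, b, c)" by (cases x)
      obtain d where d: "d \<in> A" "\<forall>\<theta>\<in>chars. \<theta> d = pair_sum xs (\<theta>, \<theta>)" using Cons by (auto simp: x)
      have ab: "a \<in> A" "b \<in> A" using Cons.prems by (simp_all add: x)
      have "((a o\<^sub>L b) + op_scale (of_bool c) b) + d \<in> A" by (intro A_intros ab d)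
      moreover have "\<theta> (((a o\<^sub>L b) + op_scale (of_bool c) b) + d) = pair_sum (x # xs) (\<theta>, \<theta>)" if "\<theta> \<in> chars" for \<theta>
        using that ab d by (simp add: x chi_simps A_intros algebra_simps)
      ultimately show ?case by blast
    qed
    then obtain a where "a \<in> A" "\<forall>\<theta>\<in>chars. \<theta> a = pair_sum xs (\<theta>, \<theta>)" by blast
    then show "\<exists>a\<in>A. \<forall>\<theta>\<in>chars. cmod (\<theta> a - F (\<theta>, \<theta>)) \<le> e"
      using xs(2) by (intro bexI[of _ a]) (auto simp: norm_minus_commute)
  qed
  then have "\<exists>a. a \<in> A \<and> (\<forall>\<theta>\<in>chars. \<theta> a = F (\<theta>, \<theta>))" by blast
  then have "diag F \<in> A \<and> (\<forall>\<theta>\<in>chars. \<theta> (diag F) = F (\<theta>, \<theta>))" unfolding diag_def by (rule someI_ex)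
  then show "diag F \<in> A" "\<theta> \<in> chars \<Longrightarrow> \<theta> (diag F) = F (\<theta>, \<theta>)" by auto
qed

lemma diag_morphism: "module_morphism A pair_module AA diag"
  unfolding module_morphism_def bounded_clinear_on_def clinear_on_def
proof (intro conjI ballI allI exI)
  fix F assume "F \<in> car pair_module"
  then have F: "F \<in> pair_functions" by simp
  show "diag F \<in> car AA" using diag_in[OF F] by simp
  show "nrm AA (diag F) \<le> 1 * nrm pair_module F"
    using norm_le_of_characters[OF diag_in[OF F], of "nrm pair_module F"] pair_nrm_ge[OF F]
      order_trans[OF norm_ge_zero pair_nrm_ge[OF F]] by (simp add: chi_diag[OF F] del: pair_module_simps(5))
  show "diag (scl pair_module c F) = scl AA c (diag F)" for c
    by (rule eq_of_characters)
      (use F in \<open>auto simp: diag_in chi_diag pair_functions_scale chi_simps A_intros\<close>)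
  show "diag (lact pair_module a F) = lact AA a (diag F)" if "a \<in> A" for a
    by (rule eq_of_characters)
      (use F that in \<open>auto simp: diag_in chi_diag pair_functions_lact chi_simps A_intros\<close>)
  fix G assume "G \<in> car pair_module"
  then show "diag (add pair_module F G) = add AA (diag F) (diag G)"
    by (intro eq_of_characters)
      (use F in \<open>auto simp: diag_in chi_diag pair_functions_add chi_simps A_intros\<close>)
qed

text \<open>The map from b to the tensor of 1 and b: a bounded linear right inverse of
  multiplication, available because the first factor is unitized. In general it is no module
  morphism.\<close>

definition const_pair :: "'h oper \<Rightarrow> ('h oper \<Rightarrow> complex) \<times> ('h oper \<Rightarrow> complex) \<Rightarrow> complex" where
  "const_pair b = (\<lambda>p. if p \<in> chars \<times> chars then snd p b else 0)"

lemma const_pair_in: "b \<in> A \<Longrightarrow> const_pair b \<in> pair_functions"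
proof -
  assume b: "b \<in> A"
  have "const_pair b = pair_sum [(0, b, True)]" by (auto simp: fun_eq_iff const_pair_def chi_zero)
  then show ?thesis using pair_sum_in[of "[(0, b, True)]"] b A_zero by simp
qed

lemma const_pair_linear: "bounded_clinear_on AA pair_module const_pair"
  unfolding bounded_clinear_on_def clinear_on_def
proof (intro conjI ballI allI exI)
  fix b assume "b \<in> car AA"
  then have b: "b \<in> A" by simp
  show "const_pair b \<in> car pair_module" using const_pair_in[OF b] by simp
  show "nrm pair_module (const_pair b) \<le> 1 * nrm AA b"
    by (rule pair_nrm_le) (use b cmod_chi_le in \<open>auto simp: const_pair_def\<close>)
  show "const_pair (scl AA c b) = scl pair_module c (const_pair b)" for c
    using b by (auto simp: const_pair_def chi_simps fun_eq_iff)
  fix d assume "d \<in> car AA"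
  then show "const_pair (add AA b d) = add pair_module (const_pair b) (const_pair d)"
    using b by (auto simp: const_pair_def chi_simps fun_eq_iff)
qed

lemma diag_const_pair: "b \<in> A \<Longrightarrow> diag (const_pair b) = b"
  by (rule eq_of_characters) (auto simp: diag_in const_pair_in chi_diag, simp add: const_pair_def)

text \<open>F is close to a finite sum of tensors whose first factors are bounded. Where F is large,
  one of the finitely many second factors must be large at t, and this is a compact condition on t
  that does not involve s.\<close>

lemma pair_functions_level_compact:
  assumes F: "F \<in> pair_functions" and d: "\<delta> > 0"
  obtains K where "compactin (spectrum A) K" "\<And>s t. s \<in> chars \<Longrightarrow> t \<in> chars \<Longrightarrow> \<delta> \<le> cmod (F (s, t)) \<Longrightarrow> t \<in> K"
proof -
  obtain xs where xs: "pair_list xs" "\<And>p. cmod (F p - pair_sum xs p) \<le> \<delta> / 2"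
    using pair_functions_approx[OF F, of "\<delta> / 2"] d by auto
  \<comment> \<open>One more than the sum of the coefficients, so that B is positive and the final
    estimate (B - 1) \<delta> / (2 B) < \<delta> / 2 is strict.\<close>
  define B where "B = (\<Sum>(a, b, c)\<leftarrow>xs. norm a + 1) + 1"
  have "0 \<le> (\<Sum>(a, b, c)\<leftarrow>xs. norm a + 1)" by (rule sum_list_nonneg) auto
  then have B: "B > 0" by (simp add: B_def)
  define C where "C b = {t \<in> chars. \<delta> / (2 * B) \<le> cmod (t b)}" for b
  define K where "K = (\<Union>x\<in>set xs. C (fst (snd x)))"
  show ?thesis
  proof
    have "compactin (spectrum A) (C (fst (snd x)))" if "x \<in> set xs" for x
      unfolding C_def using that xs(1) d B by (intro compactin_cmod_ge) (auto simp: pair_list_def intro!: divide_pos_pos)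
    then show "compactin (spectrum A) K" unfolding K_def by (intro compactin_Union) auto
    fix s t assume st: "s \<in> chars" "t \<in> chars" "\<delta> \<le> cmod (F (s, t))"
    show "t \<in> K"
    proof (rule ccontr)
      assume "t \<notin> K"
      then have small: "cmod (t b) \<le> \<delta> / (2 * B)" if "(a, b, c) \<in> set xs" for a b c
        using that st by (force simp: K_def C_def not_le)
      have "\<delta> / 2 \<le> cmod (pair_sum xs (s, t))"
        using xs(2)[of "(s, t)"] st(3) norm_triangle_ineq2[of "F (s, t)" "F (s, t) - pair_sum xs (s, t)"] by simp
      also have "\<dots> \<le> (\<Sum>(a, b, c)\<leftarrow>xs. (norm a + 1) * cmod (t b))" by (rule pair_sum_coeff_bound[OF xs(1) st(1,2)])
      also have "\<dots> \<le> (\<Sum>(a, b, c)\<leftarrow>xs. (norm a + 1) * (\<delta> / (2 * B)))"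
        using small by (intro sum_list_mono) (auto intro!: mult_left_mono simp del: times_divide_eq_right)
      also have "\<dots> = (\<Sum>(a, b, c)\<leftarrow>xs. norm a + 1) * (\<delta> / (2 * B))"
        by (induction xs) (auto simp: distrib_right simp del: times_divide_eq_right)
      also have "\<dots> = (B - 1) * (\<delta> / (2 * B))" by (simp add: B_def)
      also have "\<dots> < \<delta> / 2" using d B by (simp add: field_simps)
      finally show False by simp
    qed
  qed
qed

lemma continuous_map_pair_sum:
  assumes "pair_list xs" "t \<in> chars"
  shows "continuous_map (spectrum A) euclidean (\<lambda>s. \<Sum>(a, b, c)\<leftarrow>xs. (s a + of_bool c) * t b)"
  using assms(1)
proof (induction xs)
  case (Cons x xs)
  then show ?case
    by (cases x) (auto intro!: continuous_map_add continuous_map_mult_field continuous_map_eval)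
qed simp

text \<open>For each t some \<rho> x equals one at (t, t) and stays nonzero at (s, t) for s near t.
  Among these s there is one at which some a n does not vanish, and commutativity makes \<rho> (a n)
  nonzero at (s, t). Hence t lies in one of the countably many compact sets attached to the
  sequence.\<close>

lemma module_section_imp_sigma_compact:
  assumes sep: "separable_space (euclidean :: 'h topology)"
    and r: "module_morphism A AA pair_module \<rho>" and dr: "\<And>x. x \<in> A \<Longrightarrow> diag (\<rho> x) = x"
  shows "sigma_compact_space (spectrum A)"
proof -
  obtain a :: "nat \<Rightarrow> 'h oper" where a: "\<And>n. a n \<in> A" "\<And>b. b \<in> A \<Longrightarrow> (\<And>n. b o\<^sub>L a n = 0) \<Longrightarrow> b = 0"
    using ex_separating_sequence[OF sep] by blast
  have rF: "\<rho> x \<in> pair_functions" if "x \<in> A" for x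
    using r that by (auto simp: module_morphism_def bounded_clinear_on_def clinear_on_def)
  have rm: "\<rho> (x o\<^sub>L y) (s, t) = s x * \<rho> y (s, t)" if "x \<in> A" "y \<in> A" for x y s t
    using r that by (simp add: module_morphism_def)
  define P where "P n k K \<longleftrightarrow> compactin (spectrum A) K \<and>
    (\<forall>s\<in>chars. \<forall>t\<in>chars. 1 / real (Suc k) \<le> cmod (\<rho> (a n) (s, t)) \<longrightarrow> t \<in> K)" for n k K
  define K where "K n k = (SOME K. P n k K)" for n k
  have "P n k (K n k)" for n k
  proof -
    obtain L where "compactin (spectrum A) L"
      "\<And>s t. s \<in> chars \<Longrightarrow> t \<in> chars \<Longrightarrow> 1 / real (Suc k) \<le> cmod (\<rho> (a n) (s, t)) \<Longrightarrow> t \<in> L"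
      by (rule pair_functions_level_compact[OF rF[OF a(1)[of n]], of "1 / real (Suc k)"])
        (simp, rule that, assumption, blast)
    then have "P n k L" by (simp add: P_def)
    then show ?thesis unfolding K_def by (rule someI)
  qed
  then have K: "compactin (spectrum A) (K n k)"
    "s \<in> chars \<Longrightarrow> t \<in> chars \<Longrightarrow> 1 / real (Suc k) \<le> cmod (\<rho> (a n) (s, t)) \<Longrightarrow> t \<in> K n k" for n k s t
    by (simp_all add: P_def)
  show ?thesis
  proof (rule sigma_compact_spaceI)
    show "countable (range (\<lambda>(n, k). K n k))" by simp
    show "compactin (spectrum A) L" if "L \<in> range (\<lambda>(n, k). K n k)" for L using that K(1) by auto
    show "topspace (spectrum A) \<subseteq> \<Union>(range (\<lambda>(n, k). K n k))"
    proof
      fix t assume "t \<in> topspace (spectrum A)"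
      then have t: "t \<in> chars" by simp
      obtain x where x: "x \<in> A" "t x = 1" using ex_chi_eq_one[OF t] by blast
      have one: "\<rho> x (t, t) = 1" using chi_diag[OF rF[OF x(1)] t] dr[OF x(1)] x(2) by simp
      obtain xs where xs: "pair_list xs" "\<And>p. cmod (\<rho> x p - pair_sum xs p) \<le> 1/4"
        using pair_functions_approx[OF rF[OF x(1)], of "1/4"] by auto
      \<comment> \<open>Continuity in s is used for the approximating sum. With error 1/4 and
        threshold 1/2, t itself qualifies because 1 - 1/4 > 1/2, and on the set \<rho> x stays
        nonzero because 1/2 - 1/4 > 0.\<close>
      let ?U = "{s \<in> topspace (spectrum A). cmod (\<Sum>(a, b, c)\<leftarrow>xs. (s a + of_bool c) * t b) \<in> {1/2<..}}"
      have U: "openin (spectrum A) ?U"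
        by (rule openin_continuous_map_preimage[OF continuous_map_norm[OF continuous_map_pair_sum[OF xs(1) t]]]) simp
      have U_eq: "s \<in> ?U \<longleftrightarrow> s \<in> chars \<and> 1/2 < cmod (pair_sum xs (s, t))" for s
        using t by (auto simp: pair_sum_def)
      have "t \<in> ?U"
        unfolding U_eq using t xs(2)[of "(t, t)"] one norm_triangle_ineq2[of "\<rho> x (t, t)" "\<rho> x (t, t) - pair_sum xs (t, t)"] by simp
      then obtain n s where s: "s \<in> ?U" "s (a n) \<noteq> 0"
        using separating_sequence_dense_support[of a ?U, OF a(1) a(2) U] by blast
      then have sc: "s \<in> chars" "1/2 < cmod (pair_sum xs (s, t))" unfolding U_eq by auto
      have "\<rho> x (s, t) \<noteq> 0" using xs(2)[of "(s, t)"] sc(2) by (auto simp: norm_minus_commute)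
      \<comment> \<open>Both sides are the value of \<rho> at the product of a n and x.\<close>
      moreover have "s (a n) * \<rho> x (s, t) = s x * \<rho> (a n) (s, t)"
        using rm[OF a(1) x(1), of n s t] rm[OF x(1) a(1), of n s t] A_commute[OF a(1) x(1), of n] by simp
      ultimately have "\<rho> (a n) (s, t) \<noteq> 0" using s(2) by auto
      then obtain k where "1 / real (Suc k) < cmod (\<rho> (a n) (s, t))"
        using reals_Archimedean[of "cmod (\<rho> (a n) (s, t))"] by (auto simp: inverse_eq_divide)
      then have "t \<in> K n k" using K(2)[OF sc(1) t, of k n] by simp
      then show "t \<in> \<Union>(range (\<lambda>(n, k). K n k))" by auto
    qed
  qed
qed

section \<open>An injection of the function module into the universe\<close>

lemma ex_inj_sequences_real: "\<exists>f :: (nat \<Rightarrow> nat \<Rightarrow> nat \<Rightarrow> nat) \<Rightarrow> real. inj f"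
proof -
  obtain g :: "nat set \<Rightarrow> real" where g: "inj g"
    using nat_sets_eqpoll_reals unfolding eqpoll_def bij_betw_def by blast
  \<comment> \<open>A function of natural numbers is determined by its graph, here coded as a set of
    naturals.\<close>
  define f where "f u = g (range (\<lambda>(n, i, j). to_nat (n, i, j, u n i j :: nat)))" for u :: "nat \<Rightarrow> nat \<Rightarrow> nat \<Rightarrow> nat"
  have "u = v" if "f u = f v" for u v
  proof (intro ext)
    fix n i j
    have "range (\<lambda>(n, i, j). to_nat (n, i, j, u n i j)) = range (\<lambda>(n, i, j). to_nat (n, i, j, v n i j))"
      using that g by (auto simp: f_def inj_eq)
    moreover have "to_nat (n, i, j, u n i j) \<in> range (\<lambda>(n, i, j). to_nat (n, i, j, u n i j))" by (auto intro!: image_eqI[of _ _ "(n, i, j)"])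
    ultimately have "to_nat (n, i, j, u n i j) \<in> range (\<lambda>(n, i, j). to_nat (n, i, j, v n i j))" by simp
    then show "u n i j = v n i j" by auto
  qed
  then have "inj f" by (rule injI)
  then show ?thesis by blast
qed

text \<open>An operator is determined by its values on the dense sequence, and a vector by the
  indices of the first members of the sequence within 1/(n+1) of it.\<close>

lemma ex_inj_operator_code:
  assumes "separable_space (euclidean :: 'h topology)"
  shows "\<exists>\<kappa> :: 'h oper \<Rightarrow> nat \<Rightarrow> nat \<Rightarrow> nat. inj \<kappa>"
proof -
  obtain x :: "nat \<Rightarrow> 'h" where x: "\<And>v e. 0 < e \<Longrightarrow> \<exists>n. norm (v - x n) < e"
    using separable_dense_sequence[OF assms] by blast
  define q where "q v n = (LEAST m. norm (v - x m) < 1 / real (Suc n))" for v n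
  have q: "norm (v - x (q v n)) < 1 / real (Suc n)" for v n
    unfolding q_def by (rule LeastI_ex) (intro x, simp)
  have q_inj: "v = w" if "q v = q w" for v w
  proof (rule ccontr)
    assume "v \<noteq> w"
    then obtain n where n: "inverse (real (Suc n)) < norm (v - w) / 2" using reals_Archimedean[of "norm (v - w) / 2"] by auto
    have "norm (v - w) < 2 * (1 / real (Suc n))"
      using q[of v n] q[of w n] norm_triangle_ineq4[of "v - x (q v n)" "w - x (q v n)"] by (simp add: that)
    then show False using n by (simp add: inverse_eq_divide)
  qed
  define \<kappa> where "\<kappa> T i = q (blinfun_apply T (x i))" for T :: "'h oper" and i
  have "S = T" if "\<kappa> S = \<kappa> T" for S T
  proof (rule ccontr)
    assume ne: "S \<noteq> T"
    then obtain v where v: "blinfun_apply (S - T) v \<noteq> 0" by (metis blinfun.diff_left blinfun_eqI right_minus_eq)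
    have pos: "norm (blinfun_apply (S - T) v) / norm (S - T) > 0" using v ne by (intro divide_pos_pos) auto
    obtain k where k: "norm (v - x k) < norm (blinfun_apply (S - T) v) / norm (S - T)" using x[OF pos] by blast
    have "blinfun_apply S (x k) = blinfun_apply T (x k)"
      using fun_cong[OF that, of k] by (auto simp: \<kappa>_def intro: q_inj)
    then have "blinfun_apply (S - T) v = blinfun_apply (S - T) (v - x k)" by (simp add: blinfun.diff_left blinfun.diff_right)
    then have "norm (blinfun_apply (S - T) v) \<le> norm (S - T) * norm (v - x k)" using norm_blinfun by metis
    moreover have "norm (S - T) * norm (v - x k) < norm (blinfun_apply (S - T) v)" using k ne by (simp add: field_simps)
    ultimately show False by simp
  qed
  then have "inj \<kappa>" by (rule injI)
  then show ?thesis by blast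
qed

text \<open>F is recovered from a chosen sequence of approximating lists, and each list from the
  numerical codes of its operators.\<close>

lemma ex_inj_pair_functions:
  assumes "separable_space (euclidean :: 'h topology)"
  shows "\<exists>f :: _ \<Rightarrow> 'u + real. inj_on f pair_functions"
proof -
  obtain g :: "(nat \<Rightarrow> nat \<Rightarrow> nat \<Rightarrow> nat) \<Rightarrow> real" where g: "inj g" using ex_inj_sequences_real by blast
  obtain \<kappa> :: "'h oper \<Rightarrow> nat \<Rightarrow> nat \<Rightarrow> nat" where k: "inj \<kappa>" using ex_inj_operator_code[OF assms] by blast
  have "\<exists>xs. F \<in> pair_functions \<longrightarrow> pair_list xs \<and> (\<forall>p. cmod (F p - pair_sum xs p) \<le> 1 / real (Suc n))" for F n
    unfolding pair_functions_def by auto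
  then obtain X where X: "\<And>F n. F \<in> pair_functions \<Longrightarrow> (\<forall>p. cmod (F p - pair_sum (X F n) p) \<le> 1 / real (Suc n))" by metis
  \<comment> \<open>The list is coded one coordinate (i, j) at a time: at a fixed coordinate only
    naturals and Booleans remain, so the whole list is a single natural number.\<close>
  define code where "code F n i j = to_nat (map (\<lambda>(a, b, c). (\<kappa> a i j, \<kappa> b i j, c)) (X F n))" for F n i j
  have "F = F'" if FF: "F \<in> pair_functions" "F' \<in> pair_functions" and eq: "code F = code F'" for F F'
  proof
    fix p
    have XX: "X F n = X F' n" for n
    proof -
      have m: "map (\<lambda>(a, b, c). (\<kappa> a i j, \<kappa> b i j, c)) (X F n) = map (\<lambda>(a, b, c). (\<kappa> a i j, \<kappa> b i j, c)) (X F' n)" for i j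
        using fun_cong[OF fun_cong[OF fun_cong[OF eq, of n], of i], of j] by (simp add: code_def)
      have len: "length (X F n) = length (X F' n)" using map_eq_imp_length_eq[OF m] .
      show ?thesis
      proof (rule nth_equalityI[OF len])
        fix l assume l: "l < length (X F n)"
        obtain a b c a' b' c' where abc: "X F n ! l = (a, b, c)" "X F' n ! l = (a', b', c')" by (metis prod_cases3)
        have "(\<kappa> a i j, \<kappa> b i j, c) = (\<kappa> a' i j, \<kappa> b' i j, c')" for i j
          using arg_cong[OF m[of i j], of "\<lambda>zs. zs ! l"] l len abc by simp
        then have "\<kappa> a = \<kappa> a'" "\<kappa> b = \<kappa> b'" "c = c'" by (auto simp: fun_eq_iff)
        then show "X F n ! l = X F' n ! l" using k abc by (simp add: inj_eq)
      qed
    qed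
    have "cmod (F p - F' p) \<le> 2 * (1 / real (Suc n))" for n
      using norm_triangle_ineq4[of "F p - pair_sum (X F n) p" "F' p - pair_sum (X F n) p"] X[OF FF(1), of n] X[OF FF(2), of n] XX[of n]
      by (smt (verit) diff_diff_eq2 diff_add_cancel add_diff_cancel_right)
    moreover have "(\<lambda>n. 2 * (1 / real (Suc n))) \<longlonglongrightarrow> 2 * 0"
      using LIMSEQ_inverse_real_of_nat by (intro tendsto_mult tendsto_const) (simp add: inverse_eq_divide)
    ultimately have "cmod (F p - F' p) \<le> 2 * 0" using LIMSEQ_le_const by blast
    then show "F p = F' p" by simp
  qed
  then have "inj_on (\<lambda>F. Inr (g (code F)) :: 'u + real) pair_functions"
    using g by (intro inj_onI) (auto simp: inj_eq)
  then show ?thesis by blast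
qed

theorem projective_imp_sigma_compact:
  assumes sep: "separable_space (euclidean :: 'h topology)"
    and P: "projective_module TYPE('u + real) A AA"
  shows "sigma_compact_space (spectrum A)"
proof -
  obtain f :: "_ \<Rightarrow> 'u + real" where "inj_on f pair_functions" using ex_inj_pair_functions[OF sep] by blast
  then have f: "inj_on f (car pair_module)" by simp
  obtain \<rho> where "module_morphism A AA pair_module \<rho>" "\<forall>x\<in>A. diag (\<rho> x) = x"
    using projective_lifting_transport[OF P pair_module diag_morphism const_pair_linear diag_const_pair f] by blast
  then show ?thesis using module_section_imp_sigma_compact[OF sep] by blast
qed

end

theorem corollary6p4:
  fixes A :: "'h::complex_hilbert_space oper set"
  assumes "separable_space (euclidean :: 'h topology)"
    and "cstar_subalgebra A"
    and "commutative_algebra A"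
  shows "all_equivalent
    [projective_module TYPE('u universe) A (regular_module A),
     paracompact_space (spectrum A),
     \<exists>h\<in>A. strictly_positive A h,
     sigma_compact_space (spectrum A),
     Lindelof_space (spectrum A),
     \<exists>e. sequential_approximate_identity A e \<and> (\<forall>n. norm (e n) \<le> 1),
     H2_vanishes_right_annihilator TYPE('u universe) A]"
proof -
  interpret comm_cstar A by standard fact+
  let ?sc = "sigma_compact_space (spectrum A)"
  have usp: "\<exists>h. unit_strictly_positive h" if ?sc
    using sigma_compact_imp_unit_strictly_positive[OF that] by blast
  \<comment> \<open>A cycle through (vii): sigma-compactness makes the cohomology vanish, vanishing
    gives projectivity in the same universe, and projectivity gives back sigma-compactness.\<close>
  have i: "projective_module TYPE('u universe) A (regular_module A) \<longleftrightarrow> ?sc"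
    using projective_imp_sigma_compact[OF assms(1)] usp unit_strictly_positive_imp_H2_vanishes
      H2_vanishes_imp_projective by blast
  have ii: "paracompact_space (spectrum A) \<longleftrightarrow> ?sc"
    using paracompact_imp_sigma_compact[OF assms(1)] usp unit_strictly_positive_imp_paracompact by blast
  have iii: "(\<exists>h\<in>A. strictly_positive A h) \<longleftrightarrow> ?sc"
  proof
    show ?sc if "\<exists>h\<in>A. strictly_positive A h" using that strictly_positive_imp_sigma_compact by blast
    assume ?sc
    then obtain h where h: "unit_strictly_positive h" using usp by blast
    then have "adjoint_op h o\<^sub>L h \<in> A" by (simp add: unit_strictly_positive_def A_intros)
    then show "\<exists>h\<in>A. strictly_positive A h" using unit_strictly_positive_imp_strictly_positive[OF h] by blast
  qed
  have v: "Lindelof_space (spectrum A) \<longleftrightarrow> ?sc"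
    using Lindelof_imp_sigma_compact_spectrum sigma_compact_imp_Lindelof_space by blast
  have vi: "(\<exists>e. sequential_approximate_identity A e \<and> (\<forall>n. norm (e n) \<le> 1)) \<longleftrightarrow> ?sc"
    using approximate_identity_imp_sigma_compact usp unit_strictly_positive_imp_approximate_identity by blast
  have vii: "H2_vanishes_right_annihilator TYPE('u universe) A \<longleftrightarrow> ?sc"
    using H2_vanishes_imp_projective i usp unit_strictly_positive_imp_H2_vanishes by blast
  show ?thesis
    unfolding all_equivalent_def i ii iii v vi vii by simp
qed

end
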